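(* Let $G$ be a compact Hausdorff group (not necessarily abelian) and let $K$ be a bounded subset of $L^2(G)$. Then the following are equivalent: (i) $K$ is precompact in $L^2(G)$. (ii) $\widehat{K}=\{\widehat f: f\in K\}$ has uniform $\ell^2\text{-}\bigoplus_{\pi\in\widehat G}\mathcal{B}_2(\mathcal{H}_\pi)$-decay. (iii) $K$ is uniformly $L^2(G)$-equicontinuous.
   Context: $m_G$ is the normalized Haar measure on $G$, $L^p(G)=L^p(G,m_G)$ (complex-valued functions) with norm $\|\cdot\|_p$, and $e$ is the identity of $G$. $\widehat G$ is the set of irreducible unitary representations $\pi$ of $G$ up to unitary equivalence; each $\pi$ acts on a finite-dimensional complex Hilbert space $\mathcal{H}_\pi$ of dimension $d_\pi$. For $f\in L^1(G)$ (in particular for $f\in L^2(G)$) the Fourier transform is $\widehat f(\pi)=\int_G f(t)\pi(t)^*\,dm_G(t)$, $\pi\in\widehat G$, an operator on $\mathcal{H}_\pi$. $\mathcal{B}_2(\mathcal{H}_\pi)$ is the space of linear operators $T$ on $\mathcal{H}_\pi$ with the Hilbert-Schmidt norm $\|T\|_{\mathcal{B}_2(\mathcal{H}_\pi)}=(\mathrm{tr}(|T|^2))^{1/2}$. For $\Lambda\subset\widehat G$, $\ell^2\text{-}\bigoplus_{\pi\in\Lambda}\mathcal{B}_2(\mathcal{H}_\pi)$ is the space of families $(x_\pi)_{\pi\in\Lambda}$, $x_\pi\in\mathcal{B}_2(\mathcal{H}_\pi)$, with finite norm $\left(\sum_{\pi\in\Lambda}d_\pi\|x_\pi\|_{\mathcal{B}_2(\mathcal{H}_\pi)}^2\right)^{1/2}$.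 Uniform decay: a set $F\subset \ell^2\text{-}\bigoplus_{\pi\in\widehat G}\mathcal{B}_2(\mathcal{H}_\pi)$ has uniform $\ell^2\text{-}\bigoplus_{\pi\in\widehat G}\mathcal{B}_2(\mathcal{H}_\pi)$-decay if for every $\epsilon>0$ there is a finite set $A\subset\widehat G$ such that $\left(\sum_{\pi\in\widehat G\setminus A}d_\pi\|\phi(\pi)\|_{\mathcal{B}_2(\mathcal{H}_\pi)}^2\right)^{1/2}<\epsilon$ for all $\phi\in F$. Uniform equicontinuity: $K\subset L^2(G)$ is uniformly $L^2(G)$-equicontinuous if for every $\epsilon>0$ there is an open neighbourhood $O$ of $e$ such that $\|R_yf-f\|_2<\epsilon$ for all $f\in K$ and $y\in O$, where $(R_yf)(x)=f(xy)$. Precompact means having compact closure. *)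

theory Defs
  imports
    "HOL-Analysis.Analysis"
    "Jordan_Normal_Form.VS_Connect"
    "Jordan_Normal_Form.Schur_Decomposition"
begin

text \<open>
  Groups are written additively: the type class \<^class>\<open>topological_group_add\<close> does not
  assume commutativity. Thus \<open>x + y\<close> stands for the product \<open>xy\<close>, \<open>- x\<close> for the inverse
  and \<open>0\<close> for the identity \<open>e\<close>.
\<close>

definition normalized_haar_measure ::
  "'g::{topological_group_add,t2_space} measure \<Rightarrow> bool" where
  "normalized_haar_measure m \<longleftrightarrow>
     sets m = sets borel \<and>
     emeasure m UNIV = 1 \<and>
     (\<forall>x. \<forall>A\<in>sets borel. emeasure m ((+) x ` A) = emeasure m A) \<and>
     (\<forall>A\<in>sets borel.
        emeasure m A = (INF U\<in>{U. open U \<and> A \<subseteq> U}. emeasure m U) \<and>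
        emeasure m A = (SUP C\<in>{C. compact C \<and> C \<subseteq> A}. emeasure m C))"

text \<open>A fixed choice of representative of an equivalence class.\<close>

definition class_rep :: "'a set \<Rightarrow> 'a" where
  "class_rep C = (SOME c. c \<in> C)"


subsection \<open>The space of square-integrable functions modulo null functions\<close>

definition square_integrable :: "'g measure \<Rightarrow> ('g \<Rightarrow> complex) \<Rightarrow> bool" where
  "square_integrable m f \<longleftrightarrow> f \<in> borel_measurable m \<and> integrable m (\<lambda>x. (cmod (f x))\<^sup>2)"

definition L2_rel :: "'g measure \<Rightarrow> (('g \<Rightarrow> complex) \<times> ('g \<Rightarrow> complex)) set" where
  "L2_rel m = {(f, g). square_integrable m f \<and> square_integrable m g \<and> (AE x in m. f x = g x)}"

definition L2 :: "'g measure \<Rightarrow> ('g \<Rightarrow> complex) set set" where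
  "L2 m = {f. square_integrable m f} // L2_rel m"

definition L2_norm :: "'g measure \<Rightarrow> ('g \<Rightarrow> complex) \<Rightarrow> real" where
  "L2_norm m f = sqrt (LINT x|m. (cmod (f x))\<^sup>2)"

definition L2_dist :: "'g measure \<Rightarrow> ('g \<Rightarrow> complex) set \<Rightarrow> ('g \<Rightarrow> complex) set \<Rightarrow> real" where
  "L2_dist m F G = L2_norm m (\<lambda>x. class_rep F x - class_rep G x)"

lemma equiv_L2_rel: "equiv {f. square_integrable m f} (L2_rel m)"
proof (rule equivI)
  show "L2_rel m \<subseteq> {f. square_integrable m f} \<times> {f. square_integrable m f}"
    by (auto simp: L2_rel_def)
  show "refl_on {f. square_integrable m f} (L2_rel m)"
    by (auto simp: L2_rel_def refl_on_def)
  show "sym (L2_rel m)"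
    by (auto simp: L2_rel_def intro!: symI)
  show "trans (L2_rel m)"
  proof (rule transI)
    fix f g h assume "(f, g) \<in> L2_rel m" "(g, h) \<in> L2_rel m"
    then have s: "square_integrable m f" "square_integrable m h"
      and fg: "AE x in m. f x = g x" and gh: "AE x in m. g x = h x"
      by (auto simp: L2_rel_def)
    have "AE x in m. f x = h x" using fg gh by eventually_elim simp
    with s show "(f, h) \<in> L2_rel m" by (simp add: L2_rel_def)
  qed
qed

lemma class_rep_L2:
  assumes "F \<in> L2 m"
  shows "class_rep F \<in> F" and "square_integrable m (class_rep F)"
    and "F = L2_rel m `` {class_rep F}"
proof -
  obtain f where f: "square_integrable m f" "F = L2_rel m `` {f}"
    using assms unfolding L2_def by (auto elim!: quotientE)
  have "f \<in> F" using f by (simp add: L2_rel_def)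
  then show r: "class_rep F \<in> F" unfolding class_rep_def by (rule someI[where P = "\<lambda>c. c \<in> F"])
  then have "(f, class_rep F) \<in> L2_rel m" unfolding f(2) by simp
  then show "square_integrable m (class_rep F)" by (simp add: L2_rel_def)
  have "(f, class_rep F) \<in> L2_rel m" using r unfolding f(2) by simp
  from equiv_class_eq[OF equiv_L2_rel this] show "F = L2_rel m `` {class_rep F}"
    unfolding f(2) .
qed

lemma square_integrable_add:
  assumes "square_integrable m f" "square_integrable m g"
  shows "square_integrable m (\<lambda>x. f x + g x)"
proof -
  have "integrable m (\<lambda>x. 2 * (cmod (f x))\<^sup>2 + 2 * (cmod (g x))\<^sup>2)"
    using assms by (auto simp: square_integrable_def)
  moreover have "(cmod (f x + g x))\<^sup>2 \<le> 2 * (cmod (f x))\<^sup>2 + 2 * (cmod (g x))\<^sup>2" for x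
  proof -
    have "(cmod (f x + g x))\<^sup>2 \<le> (cmod (f x) + cmod (g x))\<^sup>2"
      by (intro power_mono norm_triangle_ineq) auto
    also have "\<dots> \<le> 2 * (cmod (f x))\<^sup>2 + 2 * (cmod (g x))\<^sup>2"
      using sum_squares_bound[of "cmod (f x)" "cmod (g x)"] by (simp add: power2_sum)
    finally show ?thesis .
  qed
  moreover have "(\<lambda>x. (cmod (f x + g x))\<^sup>2) \<in> borel_measurable m"
    using assms by (auto simp: square_integrable_def)
  ultimately have "integrable m (\<lambda>x. (cmod (f x + g x))\<^sup>2)"
    by (rule_tac Bochner_Integration.integrable_bound) (auto intro!: AE_I2 order_trans[OF _ abs_ge_self])
  then show ?thesis using assms by (auto simp: square_integrable_def)
qed

lemma square_integrable_diff:
  assumes "square_integrable m f" "square_integrable m g"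
  shows "square_integrable m (\<lambda>x. f x - g x)"
  using square_integrable_add[of m f "\<lambda>x. - g x"] assms
  by (simp add: square_integrable_def)

lemma L2_norm_eq_0_iff:
  assumes "square_integrable m f"
  shows "L2_norm m f = 0 \<longleftrightarrow> (AE x in m. f x = 0)"
  using assms integral_nonneg_eq_0_iff_AE[of m "\<lambda>x. (cmod (f x))\<^sup>2"]
  by (simp add: L2_norm_def square_integrable_def)

lemma L2_norm_triangle:
  assumes f: "square_integrable m f" and g: "square_integrable m g"
  shows "L2_norm m (\<lambda>x. f x + g x) \<le> L2_norm m f + L2_norm m g"
proof -
  define a b where "a = L2_norm m f" and "b = L2_norm m g"
  have nn: "a \<ge> 0" "b \<ge> 0" by (auto simp: a_def b_def L2_norm_def)
  have a2: "(LINT x|m. (cmod (f x))\<^sup>2) = a\<^sup>2" and b2: "(LINT x|m. (cmod (g x))\<^sup>2) = b\<^sup>2"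
    by (auto simp: a_def b_def L2_norm_def)
  have eq: "L2_norm m h = L2_norm m k"
    if "AE x in m. h x = k x" "square_integrable m h" "square_integrable m k" for h k
    proof -
    have "AE x in m. (cmod (h x))\<^sup>2 = (cmod (k x))\<^sup>2"
      using that(1) by eventually_elim simp
    moreover have [measurable]: "h \<in> borel_measurable m" "k \<in> borel_measurable m"
      using that by (auto simp: square_integrable_def)
    ultimately have "(LINT x|m. (cmod (h x))\<^sup>2) = (LINT x|m. (cmod (k x))\<^sup>2)"
      by (intro integral_cong_AE) measurable
    then show ?thesis by (simp add: L2_norm_def)
  qed
  note fg = square_integrable_add[OF f g]
  show ?thesis
  proof (cases "a = 0 \<or> b = 0")
    case True
    then show ?thesis
    proof
      assume "a = 0"
      then have "AE x in m. f x = 0" using L2_norm_eq_0_iff[OF f] by (simp add: a_def)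
      then have "L2_norm m (\<lambda>x. f x + g x) = L2_norm m g"
        by (intro eq fg g) auto
      then show ?thesis using nn by (simp add: a_def)
    next
      assume "b = 0"
      then have "AE x in m. g x = 0" using L2_norm_eq_0_iff[OF g] by (simp add: b_def)
      then have "L2_norm m (\<lambda>x. f x + g x) = L2_norm m f"
        by (intro eq fg f) auto
      then show ?thesis using nn by (simp add: b_def)
    qed
  next
    case False
    with nn have ab: "a > 0" "b > 0" by auto
    define t where "t = b / a"
    have t: "t > 0" using ab by (simp add: t_def)
    have le: "(cmod (f x + g x))\<^sup>2 \<le> (1 + t) * (cmod (f x))\<^sup>2 + (1 + 1 / t) * (cmod (g x))\<^sup>2" for x
    proof -
      let ?p = "cmod (f x)" and ?q = "cmod (g x)"
      have "(cmod (f x + g x))\<^sup>2 \<le> (?p + ?q)\<^sup>2"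
        by (intro power_mono norm_triangle_ineq) auto
      also have "0 \<le> (t * ?p - ?q)\<^sup>2 / t" using t by simp
      then have "2 * ?p * ?q \<le> t * ?p\<^sup>2 + ?q\<^sup>2 / t"
        using t by (simp add: power2_eq_square field_simps)
      then have "(?p + ?q)\<^sup>2 \<le> (1 + t) * ?p\<^sup>2 + (1 + 1 / t) * ?q\<^sup>2"
        by (simp add: power2_sum algebra_simps)
      finally show ?thesis .
    qed
    have "(LINT x|m. (cmod (f x + g x))\<^sup>2)
        \<le> (LINT x|m. (1 + t) * (cmod (f x))\<^sup>2 + (1 + 1 / t) * (cmod (g x))\<^sup>2)"
    proof (rule integral_mono)
      show "integrable m (\<lambda>x. (cmod (f x + g x))\<^sup>2)"
        using fg by (simp add: square_integrable_def)
      show "integrable m (\<lambda>x. (1 + t) * (cmod (f x))\<^sup>2 + (1 + 1 / t) * (cmod (g x))\<^sup>2)"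
        using f g by (intro Bochner_Integration.integrable_add integrable_mult_right)
          (auto simp: square_integrable_def)
    qed (rule le)
    also have "\<dots> = (1 + t) * a\<^sup>2 + (1 + 1 / t) * b\<^sup>2"
      using f g by (simp add: square_integrable_def a2 b2)
    also have "\<dots> = (a + b)\<^sup>2"
      using ab by (simp add: t_def power2_eq_square field_simps)
    finally have "sqrt (LINT x|m. (cmod (f x + g x))\<^sup>2) \<le> sqrt ((a + b)\<^sup>2)"
      by (rule real_sqrt_le_mono)
    then show ?thesis using nn by (simp add: L2_norm_def[of m "\<lambda>x. f x + g x"] a_def b_def)
  qed
qed

lemma Metric_space_L2: "Metric_space (L2 m) (L2_dist m)"
proof
  fix F G :: "('a \<Rightarrow> complex) set"
  show "0 \<le> L2_dist m F G" by (simp add: L2_dist_def L2_norm_def)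
  show "L2_dist m F G = L2_dist m G F"
    by (simp add: L2_dist_def L2_norm_def norm_minus_commute)
next
  fix F G assume F: "F \<in> L2 m" and G: "G \<in> L2 m"
  note f = class_rep_L2[OF F] and g = class_rep_L2[OF G]
  have "L2_dist m F G = 0 \<longleftrightarrow> (AE x in m. class_rep F x = class_rep G x)"
    unfolding L2_dist_def
    by (subst L2_norm_eq_0_iff) (auto intro: square_integrable_diff f g)
  also have "\<dots> \<longleftrightarrow> F = G"
  proof
    assume ae: "AE x in m. class_rep F x = class_rep G x"
    then have "(class_rep F, class_rep G) \<in> L2_rel m"
      using f(2) g(2) by (simp add: L2_rel_def)
    then have "L2_rel m `` {class_rep F} = L2_rel m `` {class_rep G}"
      by (rule equiv_class_eq[OF equiv_L2_rel])
    then show "F = G" using f(3) g(3) by simp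
  qed simp
  finally show "L2_dist m F G = 0 \<longleftrightarrow> F = G" .
next
  fix F G H assume "F \<in> L2 m" "G \<in> L2 m" "H \<in> L2 m"
  then show "L2_dist m F H \<le> L2_dist m F G + L2_dist m G H"
    using L2_norm_triangle[of m "\<lambda>x. class_rep F x - class_rep G x"
        "\<lambda>x. class_rep G x - class_rep H x"]
    unfolding L2_dist_def by (simp add: class_rep_L2 square_integrable_diff)
qed

definition L2_bounded :: "'g measure \<Rightarrow> ('g \<Rightarrow> complex) set set \<Rightarrow> bool" where
  "L2_bounded m K \<longleftrightarrow> Metric_space.mbounded (L2 m) (L2_dist m) K"

definition L2_precompact :: "'g measure \<Rightarrow> ('g \<Rightarrow> complex) set set \<Rightarrow> bool" where
  "L2_precompact m K \<longleftrightarrow>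
     (let T = Metric_space.mtopology (L2 m) (L2_dist m) in compactin T (T closure_of K))"

definition L2_translate ::
  "'g::topological_group_add measure \<Rightarrow> 'g \<Rightarrow> ('g \<Rightarrow> complex) set \<Rightarrow> ('g \<Rightarrow> complex) set" where
  "L2_translate m y F = L2_rel m `` {\<lambda>x. class_rep F (x + y)}"

definition uniformly_L2_equicontinuous ::
  "'g::topological_group_add measure \<Rightarrow> ('g \<Rightarrow> complex) set set \<Rightarrow> bool" where
  "uniformly_L2_equicontinuous m K \<longleftrightarrow>
     (\<forall>\<epsilon>>0. \<exists>V. open V \<and> 0 \<in> V \<and> (\<forall>F\<in>K. \<forall>y\<in>V. L2_dist m (L2_translate m y F) F < \<epsilon>))"


subsection \<open>Irreducible unitary representations and the dual\<close>

text \<open>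
  Irreducible unitary representations of a compact group are finite-dimensional, so up to
  unitary equivalence they act on some \<open>\<complex>\<^sup>d\<close> with its standard inner product, and
  strong continuity is continuity of all matrix coefficients.
\<close>

definition unitary_mat :: "nat \<Rightarrow> complex mat \<Rightarrow> bool" where
  "unitary_mat d T \<longleftrightarrow>
     T \<in> carrier_mat d d \<and> mat_adjoint T * T = 1\<^sub>m d \<and> T * mat_adjoint T = 1\<^sub>m d"

definition rep_dim :: "('g::topological_group_add \<Rightarrow> complex mat) \<Rightarrow> nat" where
  "rep_dim U = dim_row (U 0)"

definition unitary_rep :: "('g::topological_group_add \<Rightarrow> complex mat) \<Rightarrow> bool" where
  "unitary_rep U \<longleftrightarrow>
     (\<forall>x. unitary_mat (rep_dim U) (U x)) \<and>
     (\<forall>x y. U (x + y) = U x * U y) \<and>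
     (\<forall>i<rep_dim U. \<forall>j<rep_dim U. continuous_on UNIV (\<lambda>x. U x $$ (i, j)))"

definition irreducible_unitary_rep :: "('g::topological_group_add \<Rightarrow> complex mat) \<Rightarrow> bool" where
  "irreducible_unitary_rep U \<longleftrightarrow>
     unitary_rep U \<and> rep_dim U > 0 \<and>
     (\<forall>W. VectorSpace.subspace class_ring W (module_vec TYPE(complex) (rep_dim U)) \<and>
          (\<forall>x. \<forall>v\<in>W. U x *\<^sub>v v \<in> W) \<longrightarrow>
          W = {0\<^sub>v (rep_dim U)} \<or> W = carrier_vec (rep_dim U))"

definition unitary_equiv ::
  "(('g::topological_group_add \<Rightarrow> complex mat) \<times> ('g \<Rightarrow> complex mat)) set" where
  "unitary_equiv =
     {(U, V). irreducible_unitary_rep U \<and> irreducible_unitary_rep V \<and> rep_dim U = rep_dim V \<and>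
              (\<exists>T. unitary_mat (rep_dim U) T \<and> (\<forall>x. V x = T * U x * mat_adjoint T))}"

definition unitary_dual :: "('g::topological_group_add \<Rightarrow> complex mat) set set" where
  "unitary_dual = {U. irreducible_unitary_rep U} // unitary_equiv"

definition dual_dim :: "('g::topological_group_add \<Rightarrow> complex mat) set \<Rightarrow> nat" where
  "dual_dim \<pi> = rep_dim (class_rep \<pi>)"


subsection \<open>The Fourier transform and uniform decay\<close>

definition fourier_transform ::
  "'g::topological_group_add measure \<Rightarrow> ('g \<Rightarrow> complex) set \<Rightarrow>
     ('g \<Rightarrow> complex mat) set \<Rightarrow> complex mat" where
  "fourier_transform m F =
     (\<lambda>\<pi>\<in>unitary_dual. Matrix.mat (dual_dim \<pi>) (dual_dim \<pi>)
        (\<lambda>(i, j). LINT t|m. class_rep F t * mat_adjoint (class_rep \<pi> t) $$ (i, j)))"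

definition hs_norm :: "complex mat \<Rightarrow> real" where
  "hs_norm T = sqrt (Re (\<Sum>i<dim_col T. (mat_adjoint T * T) $$ (i, i)))"

definition l2_sum_space ::
  "('g::topological_group_add \<Rightarrow> complex mat) set set \<Rightarrow>
     (('g \<Rightarrow> complex mat) set \<Rightarrow> complex mat) set" where
  "l2_sum_space \<Lambda> =
     {\<phi> \<in> (\<Pi>\<^sub>E \<pi>\<in>\<Lambda>. carrier_mat (dual_dim \<pi>) (dual_dim \<pi>)).
        (\<lambda>\<pi>. real (dual_dim \<pi>) * (hs_norm (\<phi> \<pi>))\<^sup>2) summable_on \<Lambda>}"

definition l2_sum_norm ::
  "('g::topological_group_add \<Rightarrow> complex mat) set set \<Rightarrow>
     (('g \<Rightarrow> complex mat) set \<Rightarrow> complex mat) \<Rightarrow> real" where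
  "l2_sum_norm \<Lambda> \<phi> = sqrt (\<Sum>\<^sub>\<infinity>\<pi>\<in>\<Lambda>. real (dual_dim \<pi>) * (hs_norm (\<phi> \<pi>))\<^sup>2)"

text \<open>
  Membership in the \<open>\<ell>\<^sup>2\<close>-sum is part of the predicate, because an infinite sum over a
  family that is not summable has the default value \<open>0\<close>.
\<close>

definition uniform_l2_decay ::
  "(('g::topological_group_add \<Rightarrow> complex mat) set \<Rightarrow> complex mat) set \<Rightarrow> bool" where
  "uniform_l2_decay \<F> \<longleftrightarrow>
     \<F> \<subseteq> l2_sum_space unitary_dual \<and>
     (\<forall>\<epsilon>>0. \<exists>A. finite A \<and> A \<subseteq> unitary_dual \<and>
        (\<forall>\<phi>\<in>\<F>. l2_sum_norm (unitary_dual - A) \<phi> < \<epsilon>))"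

end

theory Submission
  imports Defs "Jordan_Normal_Form.Spectral_Radius"
begin

text \<open>
  Since \<open>L\<^sup>2\<close> is complete, (i) means total boundedness. By the Peter--Weyl theorem the Fourier transform
  is isometric, so the tail of the transform of \<open>f\<close> outside a finite set \<open>A\<close> is the distance of \<open>f\<close> to the
  finite-dimensional space spanned by the matrix coefficients of \<open>A\<close>; this gives (i) \<open>\<longleftrightarrow>\<close> (ii). For (i) \<open>\<longleftrightarrow>\<close> (iii), single functions
  are translation continuous, and convolution with a bump function supported near the identity is a compact
  operator that moves every \<open>f\<close> by at most the \<open>L\<^sup>2\<close>-modulus of continuity of \<open>f\<close>.

  Peter--Weyl: if some \<open>r \<noteq> 0\<close> were orthogonal to all matrix coefficients, convolution by a symmetric bump function
  would be a nonzero compact self-adjoint operator on the space of all such functions, which is invariant under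
  left translations. An eigenspace is finite-dimensional and invariant, and a minimal invariant subspace of it carries
  an irreducible representation whose coefficients span that subspace; so it would be orthogonal to itself.

  \<open>G\<close> need not be second countable, so Borel sets of \<open>G \<times> G\<close> need not be product measurable. Fubini's theorem is
  only used for continuous kernels, which are uniform limits of product measurable functions.
\<close>

section \<open>The space of square-integrable functions\<close>

text \<open>Condition (iii) concerns right translations, while the Haar measure is given as left
  invariant. Right invariance is therefore derived: for continuous integrands from Fubini's theorem,
  then for Borel sets from regularity. Convolution on the right by a bump averages right translates
  of \<open>f\<close>, so (iii) controls it; it commutes with left translations, so its eigenspaces
  are left invariant. This is why one operator serves both the compactness criterion and
  Peter--Weyl. Its eigenvalue comes from a maximizing sequence for the operator norm, which yields
  an eigenfunction of the squared operator; factoring a difference of squares gives one of the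
  operator itself. Most arguments concern functions and the seminorm \<open>L2_norm\<close>, and
  classes are reached through \<open>class_rep\<close>. Invariant spaces consist of continuous
  functions, because an eigenfunction is recovered from matrix coefficients by evaluating at the
  identity.\<close>

definition ip :: "'g measure \<Rightarrow> ('g \<Rightarrow> complex) \<Rightarrow> ('g \<Rightarrow> complex) \<Rightarrow> complex" where
  "ip m f g = (LINT x|m. f x * cnj (g x))"

lemma borel_measurable_cnj [measurable (raw)]:
  "f \<in> borel_measurable m \<Longrightarrow> (\<lambda>x. cnj (f x)) \<in> borel_measurable m"
  by (rule borel_measurable_continuous_on[of cnj]) (auto intro: continuous_intros)

lemma square_integrable_scale:
  "square_integrable m f \<Longrightarrow> square_integrable m (\<lambda>x. c * f x)"
  by (auto simp: square_integrable_def norm_mult power_mult_distrib)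

lemma square_integrable_cnj:
  "square_integrable m f \<Longrightarrow> square_integrable m (\<lambda>x. cnj (f x))"
  by (simp add: square_integrable_def borel_measurable_cnj)

lemma square_integrable_zero: "square_integrable m (\<lambda>x. 0)"
  by (auto simp: square_integrable_def)

lemma square_integrable_sum:
  "(\<And>i. i \<in> I \<Longrightarrow> square_integrable m (f i)) \<Longrightarrow> square_integrable m (\<lambda>x. \<Sum>i\<in>I. f i x)"
  by (induction I rule: infinite_finite_induct)
     (auto intro: square_integrable_zero square_integrable_add)

lemma L2_norm_nonneg [simp]: "0 \<le> L2_norm m f"
  by (simp add: L2_norm_def)

lemma L2_norm_power2: "(L2_norm m f)\<^sup>2 = (LINT x|m. (cmod (f x))\<^sup>2)"
  by (simp add: L2_norm_def)

lemma cnj_mult_self: "cnj z * z = of_real ((cmod z)\<^sup>2)"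
  by (metis complex_norm_square mult.commute of_real_power)

lemma ip_self: "ip m f f = of_real ((L2_norm m f)\<^sup>2)"
  unfolding ip_def L2_norm_power2 complex_norm_square[symmetric]
  by (simp flip: of_real_power)

lemma L2_norm_scale: "L2_norm m (\<lambda>x. c * f x) = cmod c * L2_norm m f"
  by (simp add: L2_norm_def norm_mult power_mult_distrib real_sqrt_mult)

lemma L2_norm_minus_commute: "L2_norm m (\<lambda>x. f x - g x) = L2_norm m (\<lambda>x. g x - f x)"
  by (simp add: L2_norm_def norm_minus_commute)

lemma L2_norm_cong_AE:
  assumes "AE x in m. f x = g x" "f \<in> borel_measurable m" "g \<in> borel_measurable m"
  shows "L2_norm m f = L2_norm m g"
proof -
  have "AE x in m. (cmod (f x))\<^sup>2 = (cmod (g x))\<^sup>2" using assms(1) by eventually_elim simp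
  then have "(LINT x|m. (cmod (f x))\<^sup>2) = (LINT x|m. (cmod (g x))\<^sup>2)"
    using assms(2,3) by (intro integral_cong_AE) auto
  then show ?thesis by (simp add: L2_norm_def)
qed

lemma L2_norm_diff_triangle:
  assumes "square_integrable m f" "square_integrable m g" "square_integrable m h"
  shows "L2_norm m (\<lambda>x. f x - h x) \<le> L2_norm m (\<lambda>x. f x - g x) + L2_norm m (\<lambda>x. g x - h x)"
  using L2_norm_triangle[of m "\<lambda>x. f x - g x" "\<lambda>x. g x - h x"] assms
  by (simp add: square_integrable_diff)

lemma integrable_norm_mult_square_integrable:
  assumes "square_integrable m f" "square_integrable m g"
  shows "integrable m (\<lambda>x. cmod (f x) * cmod (g x))"
proof (rule Bochner_Integration.integrable_bound)
  show "integrable m (\<lambda>x. (cmod (f x))\<^sup>2 + (cmod (g x))\<^sup>2)"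
    using assms by (auto simp: square_integrable_def)
  show "(\<lambda>x. cmod (f x) * cmod (g x)) \<in> borel_measurable m"
    using assms by (auto simp: square_integrable_def)
  show "AE x in m. norm (cmod (f x) * cmod (g x)) \<le> norm ((cmod (f x))\<^sup>2 + (cmod (g x))\<^sup>2)"
  proof (rule AE_I2)
    fix x
    have "2 * (cmod (f x) * cmod (g x)) \<le> (cmod (f x))\<^sup>2 + (cmod (g x))\<^sup>2"
      using sum_squares_bound[of "cmod (f x)" "cmod (g x)"] by simp
    moreover have "0 \<le> cmod (f x) * cmod (g x)" by simp
    moreover have "0 \<le> (cmod (f x))\<^sup>2 + (cmod (g x))\<^sup>2" by simp
    ultimately show "norm (cmod (f x) * cmod (g x)) \<le> norm ((cmod (f x))\<^sup>2 + (cmod (g x))\<^sup>2)"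
      unfolding real_norm_def by linarith
  qed
qed

lemma integrable_mult_square_integrable:
  assumes "square_integrable m f" "square_integrable m g"
  shows "integrable m (\<lambda>x. f x * g x)"
  using integrable_norm_mult_square_integrable[OF assms]
  by (rule Bochner_Integration.integrable_bound)
     (use assms in \<open>auto simp: norm_mult square_integrable_def\<close>)

lemma integrable_ip:
  assumes "square_integrable m f" "square_integrable m g"
  shows "integrable m (\<lambda>x. f x * cnj (g x))"
  using assms by (intro integrable_mult_square_integrable square_integrable_cnj)

lemma ip_cnj: "cnj (ip m f g) = ip m g f"
  using Bochner_Integration.integral_cnj[of m "\<lambda>x. f x * cnj (g x)"]
  unfolding ip_def by (simp add: mult.commute)

lemma ip_add_left:
  assumes "square_integrable m f" "square_integrable m g" "square_integrable m h"
  shows "ip m (\<lambda>x. f x + g x) h = ip m f h + ip m g h"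
  unfolding ip_def using assms by (simp add: distrib_right integrable_ip)

lemma ip_diff_left:
  assumes "square_integrable m f" "square_integrable m g" "square_integrable m h"
  shows "ip m (\<lambda>x. f x - g x) h = ip m f h - ip m g h"
  unfolding ip_def using assms by (simp add: left_diff_distrib integrable_ip)

lemma ip_diff_right:
  assumes "square_integrable m f" "square_integrable m g" "square_integrable m h"
  shows "ip m h (\<lambda>x. f x - g x) = ip m h f - ip m h g"
  using arg_cong[OF ip_diff_left[OF assms], of cnj] by (simp add: ip_cnj)

lemma ip_scale_left: "ip m (\<lambda>x. c * f x) h = c * ip m f h"
  unfolding ip_def by (simp add: mult.assoc)

lemma ip_scale_right: "ip m h (\<lambda>x. c * f x) = cnj c * ip m h f"
  unfolding ip_def by (simp add: mult.left_commute)

lemma ip_sum_left: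
  assumes "\<And>i. i \<in> I \<Longrightarrow> square_integrable m (f i)" "square_integrable m h"
  shows "ip m (\<lambda>x. \<Sum>i\<in>I. f i x) h = (\<Sum>i\<in>I. ip m (f i) h)"
  unfolding ip_def using assms by (simp add: sum_distrib_right integrable_ip)

lemma ip_sum_right:
  assumes "\<And>i. i \<in> I \<Longrightarrow> square_integrable m (f i)" "square_integrable m h"
  shows "ip m h (\<lambda>x. \<Sum>i\<in>I. f i x) = (\<Sum>i\<in>I. ip m h (f i))"
  unfolding ip_def using assms by (simp add: sum_distrib_left integrable_ip)

lemma ip_cong_AE:
  assumes "AE x in m. f x = f' x" "f \<in> borel_measurable m" "f' \<in> borel_measurable m"
    "g \<in> borel_measurable m"
  shows "ip m f g = ip m f' g"
  unfolding ip_def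
proof (intro integral_cong_AE)
  have [measurable]: "f \<in> borel_measurable m" "f' \<in> borel_measurable m" "g \<in> borel_measurable m"
    using assms by auto
  show "(\<lambda>x. f x * cnj (g x)) \<in> borel_measurable m" "(\<lambda>x. f' x * cnj (g x)) \<in> borel_measurable m"
    by measurable
qed (use assms in auto)

section \<open>The Cauchy-Schwarz inequality\<close>

lemma ip_norm_le_integral:
  assumes "square_integrable m f" "square_integrable m g"
  shows "cmod (ip m f g) \<le> (LINT x|m. cmod (f x) * cmod (g x))"
  unfolding ip_def by (rule order_trans[OF integral_norm_bound]) (simp add: norm_mult)

lemma Cauchy_Schwarz_norms:
  assumes f: "square_integrable m f" and g: "square_integrable m g"
  shows "(LINT x|m. cmod (f x) * cmod (g x)) \<le> L2_norm m f * L2_norm m g"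
proof (cases "L2_norm m f = 0 \<or> L2_norm m g = 0")
  case True
  then have "AE x in m. cmod (f x) * cmod (g x) = 0"
    using L2_norm_eq_0_iff[OF f] L2_norm_eq_0_iff[OF g] by (auto elim: eventually_mono)
  then show ?thesis using True by (simp add: integral_eq_zero_AE)
next
  case False
  define a b where "a = L2_norm m f" and "b = L2_norm m g"
  have ab: "a > 0" "b > 0" using False by (auto simp: a_def b_def less_le)
  have "(LINT x|m. cmod (f x) * cmod (g x)) \<le>
        (LINT x|m. (b / a / 2) * (cmod (f x))\<^sup>2 + (a / b / 2) * (cmod (g x))\<^sup>2)"
  proof (rule integral_mono)
    show "integrable m (\<lambda>x. cmod (f x) * cmod (g x))"
      using f g by (rule integrable_norm_mult_square_integrable)
    show "integrable m (\<lambda>x. b / a / 2 * (cmod (f x))\<^sup>2 + a / b / 2 * (cmod (g x))\<^sup>2)"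
      using f g by (auto simp: square_integrable_def)
    fix x
    \<comment> \<open>Arithmetic-geometric mean with weights chosen so that both integrals on the
      right contribute \<open>a * b / 2\<close>. The weights divide by the norms, so norm 0 is
      treated apart.\<close>
    have "0 \<le> (b * cmod (f x) - a * cmod (g x))\<^sup>2 / (2 * a * b)" using ab by simp
    then show "cmod (f x) * cmod (g x) \<le> b / a / 2 * (cmod (f x))\<^sup>2 + a / b / 2 * (cmod (g x))\<^sup>2"
      using ab by (simp add: power2_eq_square field_simps)
  qed
  also have "\<dots> = b / a / 2 * a\<^sup>2 + a / b / 2 * b\<^sup>2"
    using f g by (simp add: square_integrable_def L2_norm_power2 a_def b_def)
  also have "\<dots> = a * b" using ab by (simp add: power2_eq_square field_simps)
  finally show ?thesis by (simp add: a_def b_def)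
qed

lemma Cauchy_Schwarz_ip:
  assumes "square_integrable m f" "square_integrable m g"
  shows "cmod (ip m f g) \<le> L2_norm m f * L2_norm m g"
  using ip_norm_le_integral[OF assms] Cauchy_Schwarz_norms[OF assms] by linarith

lemma L2_norm_diff_power2:
  assumes "square_integrable m f" "square_integrable m g"
  shows "(L2_norm m (\<lambda>x. f x - g x))\<^sup>2 = (L2_norm m f)\<^sup>2 - 2 * Re (ip m f g) + (L2_norm m g)\<^sup>2"
proof -
  have "complex_of_real ((L2_norm m (\<lambda>x. f x - g x))\<^sup>2) = ip m (\<lambda>x. f x - g x) (\<lambda>x. f x - g x)"
    by (simp only: ip_self)
  also have "\<dots> = ip m f f - ip m f g - (ip m g f - ip m g g)"
    using assms by (simp add: ip_diff_left ip_diff_right square_integrable_diff)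
  finally have "Re (complex_of_real ((L2_norm m (\<lambda>x. f x - g x))\<^sup>2))
      = Re (ip m f f - ip m f g - (ip m g f - ip m g g))"
    by (rule arg_cong)
  moreover have "Re (ip m g f) = Re (ip m f g)" by (subst ip_cnj[symmetric]) simp
  ultimately show ?thesis by (simp add: ip_self)
qed

section \<open>Orthonormal families and orthogonal projection\<close>

definition orthonormal :: "'g measure \<Rightarrow> 'i set \<Rightarrow> ('i \<Rightarrow> 'g \<Rightarrow> complex) \<Rightarrow> bool" where
  "orthonormal m I e \<longleftrightarrow> (\<forall>i\<in>I. square_integrable m (e i)) \<and>
     (\<forall>i\<in>I. \<forall>j\<in>I. ip m (e i) (e j) = (if i = j then 1 else 0))"

lemma orthonormal_subset: "orthonormal m I e \<Longrightarrow> J \<subseteq> I \<Longrightarrow> orthonormal m J e"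
  by (simp add: orthonormal_def subset_iff)

lemma orthonormal_ip_sum:
  assumes "orthonormal m I e" "finite I" "j \<in> I"
  shows "ip m (\<lambda>x. \<Sum>i\<in>I. c i * e i x) (e j) = c j"
proof -
  have "ip m (\<lambda>x. \<Sum>i\<in>I. c i * e i x) (e j) = (\<Sum>i\<in>I. c i * ip m (e i) (e j))"
    using assms by (subst ip_sum_left)
      (auto simp: orthonormal_def ip_scale_left square_integrable_scale)
  also have "\<dots> = (\<Sum>i\<in>I. if i = j then c i else 0)"
    using assms by (intro sum.cong) (auto simp: orthonormal_def)
  finally show ?thesis using assms by simp
qed

lemma orthonormal_norm_sum:
  assumes "orthonormal m I e" "finite I"
  shows "(L2_norm m (\<lambda>x. \<Sum>i\<in>I. c i * e i x))\<^sup>2 = (\<Sum>i\<in>I. (cmod (c i))\<^sup>2)"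
proof -
  let ?s = "\<lambda>x. \<Sum>i\<in>I. c i * e i x"
  have sq: "square_integrable m (e i)" if "i \<in> I" for i using assms that by (auto simp: orthonormal_def)
  have "complex_of_real ((L2_norm m ?s)\<^sup>2) = ip m ?s ?s" by (simp only: ip_self)
  also have "\<dots> = (\<Sum>i\<in>I. cnj (c i) * ip m ?s (e i))"
    by (subst ip_sum_right)
       (auto simp: ip_scale_right intro!: square_integrable_scale square_integrable_sum sq)
  also have "\<dots> = (\<Sum>i\<in>I. cnj (c i) * c i)"
    using assms by (intro sum.cong) (auto simp: orthonormal_ip_sum)
  also have "\<dots> = of_real (\<Sum>i\<in>I. (cmod (c i))\<^sup>2)"
    by (simp add: cnj_mult_self)
  finally show ?thesis by (simp only: of_real_eq_iff)
qed

text \<open>Pythagoras: the inner product of \<open>f\<close> with its projection is real and equals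
  the squared norm of the projection. Bessel's inequality, Parseval's identity and the reading of
  Fourier tails as projection errors all start here.\<close>

lemma orthonormal_norm_projection:
  assumes e: "orthonormal m I e" "finite I" and f: "square_integrable m f"
  shows "(L2_norm m (\<lambda>x. f x - (\<Sum>i\<in>I. ip m f (e i) * e i x)))\<^sup>2
       = (L2_norm m f)\<^sup>2 - (\<Sum>i\<in>I. (cmod (ip m f (e i)))\<^sup>2)"
proof -
  let ?s = "\<lambda>x. \<Sum>i\<in>I. ip m f (e i) * e i x"
  have sq: "square_integrable m (e i)" if "i \<in> I" for i using e that by (auto simp: orthonormal_def)
  have s: "square_integrable m ?s" by (intro square_integrable_sum square_integrable_scale sq)
  have "ip m f ?s = (\<Sum>i\<in>I. cnj (ip m f (e i)) * ip m f (e i))"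
    by (subst ip_sum_right) (auto simp: ip_scale_right intro!: square_integrable_scale sq f)
  also have "\<dots> = of_real (\<Sum>i\<in>I. (cmod (ip m f (e i)))\<^sup>2)"
    by (simp add: cnj_mult_self)
  finally have "Re (ip m f ?s) = (\<Sum>i\<in>I. (cmod (ip m f (e i)))\<^sup>2)"
    by (simp only: Re_complex_of_real)
  then show ?thesis
    using L2_norm_diff_power2[OF f s] orthonormal_norm_sum[OF e, of "\<lambda>i. ip m f (e i)"] by simp
qed

lemma Bessel_finite:
  assumes "orthonormal m I e" "finite I" "square_integrable m f"
  shows "(\<Sum>i\<in>I. (cmod (ip m f (e i)))\<^sup>2) \<le> (L2_norm m f)\<^sup>2"
  using orthonormal_norm_projection[OF assms]
    zero_le_power2[of "L2_norm m (\<lambda>x. f x - (\<Sum>i\<in>I. ip m f (e i) * e i x))"]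
  by linarith

section \<open>Completeness and total boundedness\<close>

lemma nn_integral_square_integrable:
  assumes "square_integrable m f"
  shows "(\<integral>\<^sup>+x. ennreal ((cmod (f x))\<^sup>2) \<partial>m) = ennreal ((L2_norm m f)\<^sup>2)"
  using assms by (subst nn_integral_eq_integral) (auto simp: square_integrable_def L2_norm_power2)

text \<open>The nonnegative integral is meaningful before integrability is known, so a bound
  obtained from Fatou's lemma yields both membership and the norm estimate.\<close>

lemma square_integrable_nn_integral_le:
  assumes "f \<in> borel_measurable m" "(\<integral>\<^sup>+x. ennreal ((cmod (f x))\<^sup>2) \<partial>m) \<le> ennreal (C\<^sup>2)" "C \<ge> 0"
  shows "square_integrable m f" "L2_norm m f \<le> C"
proof -
  have "integrable m (\<lambda>x. (cmod (f x))\<^sup>2)"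
    using assms(1,2) by (intro integrableI_bounded) (auto intro: le_less_trans)
  then show s: "square_integrable m f" using assms(1) by (simp add: square_integrable_def)
  have "(L2_norm m f)\<^sup>2 \<le> C\<^sup>2"
    using assms(2) nn_integral_square_integrable[OF s] by simp
  then show "L2_norm m f \<le> C" using assms(3) by (rule power2_le_imp_le)
qed

text \<open>Riesz-Fischer: a rapidly Cauchy subsequence converges almost everywhere, and Fatou's
  lemma carries the Cauchy estimate of the whole sequence over to the limit.\<close>

theorem L2_complete:
  fixes f :: "nat \<Rightarrow> 'g \<Rightarrow> complex"
  assumes sq: "\<And>n. square_integrable m (f n)"
    and cau: "\<And>\<epsilon>. \<epsilon> > 0 \<Longrightarrow> \<exists>N. \<forall>n\<ge>N. \<forall>k\<ge>N. L2_norm m (\<lambda>x. f n x - f k x) < \<epsilon>"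
  obtains g where "square_integrable m g" "(\<lambda>n. L2_norm m (\<lambda>x. f n x - g x)) \<longlonglongrightarrow> 0"
proof -
  have [measurable]: "f n \<in> borel_measurable m" for n using sq by (simp add: square_integrable_def)
  have "\<exists>N. \<forall>j. \<forall>n\<ge>N j. \<forall>k\<ge>N j. L2_norm m (\<lambda>x. f n x - f k x) < (1/4) ^ j"
    using cau by (intro choice allI) simp
  then obtain N where N: "\<And>j n k. n \<ge> N j \<Longrightarrow> k \<ge> N j \<Longrightarrow> L2_norm m (\<lambda>x. f n x - f k x) < (1/4) ^ j"
    by blast
  \<comment> \<open>Summing the thresholds gives nondecreasing indices with
    \<open>r j \<ge> N j\<close>.\<close>
  define r where "r j = (\<Sum>i\<le>j. N i)" for j
  have r1: "r j \<ge> N j" for j by (auto simp: r_def intro: member_le_sum)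
  have r2: "r (Suc j) \<ge> r j" for j by (simp add: r_def)
  define d where "d j x = f (r (Suc j)) x - f (r j) x" for j x
  have [measurable]: "d j \<in> borel_measurable m" for j unfolding d_def by measurable
  have d: "L2_norm m (d j) < (1/4) ^ j" "square_integrable m (d j)" for j
    unfolding d_def using N[of j "r (Suc j)" "r j"] r1[of j] r2[of j]
    by (auto intro: square_integrable_diff sq)
  \<comment> \<open>The weight \<open>4 ^ j\<close> is small enough for the integrals to be
    summable, the squared norms being below \<open>(1/16) ^ j\<close>, and large enough to force
    \<open>cmod (d j x)\<close> to decay like \<open>(1/2) ^ j\<close> wherever the weighted series
    is finite.\<close>
  have "(\<integral>\<^sup>+x. (\<Sum>j. ennreal (4 ^ j * (cmod (d j x))\<^sup>2)) \<partial>m) = (\<Sum>j. \<integral>\<^sup>+x. ennreal (4 ^ j * (cmod (d j x))\<^sup>2) \<partial>m)"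
    by (rule nn_integral_suminf) measurable
  also have "\<dots> = (\<Sum>j. ennreal (4 ^ j * (L2_norm m (d j))\<^sup>2))"
    by (simp add: ennreal_mult' nn_integral_cmult nn_integral_square_integrable[OF d(2)])
  also have "\<dots> \<le> (\<Sum>j. ennreal ((1/4) ^ j))"
  proof (intro suminf_le ennreal_leI)
    fix j
    have "(L2_norm m (d j))\<^sup>2 \<le> ((1/4) ^ j)\<^sup>2"
      using d(1)[of j] by (intro power_mono) auto
    then have "4 ^ j * (L2_norm m (d j))\<^sup>2 \<le> 4 ^ j * ((1/4) ^ j)\<^sup>2" by simp
    also have "\<dots> = (1/4) ^ j" by (simp add: power2_eq_square power_divide)
    finally show "4 ^ j * (L2_norm m (d j))\<^sup>2 \<le> (1/4) ^ j" .
  qed auto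
  also have "\<dots> = ennreal (\<Sum>j. (1/4) ^ j)"
    by (rule suminf_ennreal2) (auto intro: summable_geometric)
  also have "\<dots> < \<infinity>" by simp
  finally have "AE x in m. (\<Sum>j. ennreal (4 ^ j * (cmod (d j x))\<^sup>2)) \<noteq> \<infinity>"
    by (intro nn_integral_PInf_AE) auto
  then have conv: "AE x in m. convergent (\<lambda>j. f (r j) x)"
  proof eventually_elim
    fix x assume fin: "(\<Sum>j. ennreal (4 ^ j * (cmod (d j x))\<^sup>2)) \<noteq> \<infinity>"
    define C where "C = (\<Sum>j. ennreal (4 ^ j * (cmod (d j x))\<^sup>2))"
    obtain c where c: "C = ennreal c" "c \<ge> 0" using fin by (cases C) (auto simp: C_def)
    have b: "cmod (d j x) \<le> sqrt c * (1/2) ^ j" for j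
    proof -
      have "(\<Sum>i\<in>{j}. ennreal (4 ^ i * (cmod (d i x))\<^sup>2)) \<le> C"
        unfolding C_def by (intro sum_le_suminf) auto
      then have "4 ^ j * (cmod (d j x))\<^sup>2 \<le> c" using c by simp
      moreover have "(4::real) ^ j * (cmod (d j x))\<^sup>2 = (2 ^ j * cmod (d j x))\<^sup>2"
        by (simp add: power_mult_distrib flip: power_mult) (simp add: power_mult mult.commute[of j 2])
      ultimately have "2 ^ j * cmod (d j x) \<le> sqrt c" by (simp add: real_le_rsqrt)
      then show ?thesis by (simp add: power_divide field_simps)
    qed
    have "summable (\<lambda>j. sqrt c * (1/2::real) ^ j)" by (intro summable_mult summable_geometric) simp
    then have "summable (\<lambda>j. d j x)" 
      by (rule summable_comparison_test') (use b in auto)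
    then have "summable (\<lambda>j. f (r (Suc j)) x - f (r j) x)" by (simp add: d_def)
    then have "convergent (\<lambda>n. \<Sum>j<n. f (r (Suc j)) x - f (r j) x)" by (simp add: summable_iff_convergent)
    then have "convergent (\<lambda>n. f (r n) x - f (r 0) x)"
      by (simp add: sum_lessThan_telescope[of "\<lambda>n. f (r n) x"])
    then have "convergent (\<lambda>n. (f (r n) x - f (r 0) x) + f (r 0) x)"
      by (intro convergent_add convergent_const)
    then show "convergent (\<lambda>j. f (r j) x)" by simp
  qed
  \<comment> \<open>Where the subsequence diverges the value of \<open>lim\<close> is unspecified;
    this happens only on a null set.\<close>
  define g where "g x = lim (\<lambda>j. f (r j) x)" for x
  have [measurable]: "g \<in> borel_measurable m" unfolding g_def by measurable
  have bound: "square_integrable m (\<lambda>x. f n x - g x) \<and> L2_norm m (\<lambda>x. f n x - g x) \<le> (1/4) ^ j"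
    if "n \<ge> N j" for n j
  proof -
    have "(\<integral>\<^sup>+x. ennreal ((cmod (f n x - g x))\<^sup>2) \<partial>m)
        = (\<integral>\<^sup>+x. liminf (\<lambda>k. ennreal ((cmod (f n x - f (r k) x))\<^sup>2)) \<partial>m)"
    proof (rule nn_integral_cong_AE, use conv in eventually_elim)
      fix x assume "convergent (\<lambda>j. f (r j) x)"
      then have "(\<lambda>k. f (r k) x) \<longlonglongrightarrow> g x" unfolding g_def by (simp add: convergent_LIMSEQ_iff)
      then have "(\<lambda>k. ennreal ((cmod (f n x - f (r k) x))\<^sup>2)) \<longlonglongrightarrow> ennreal ((cmod (f n x - g x))\<^sup>2)"
        by (intro tendsto_intros tendsto_ennrealI)
      then show "ennreal ((cmod (f n x - g x))\<^sup>2) = liminf (\<lambda>k. ennreal ((cmod (f n x - f (r k) x))\<^sup>2))"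
        by (intro lim_imp_Liminf[symmetric]) auto
    qed
    \<comment> \<open>Fatou's lemma with \<open>n\<close> fixed; once \<open>k \<ge> j\<close>, both
      indices lie beyond \<open>N j\<close>.\<close>
    also have "\<dots> \<le> liminf (\<lambda>k. \<integral>\<^sup>+x. ennreal ((cmod (f n x - f (r k) x))\<^sup>2) \<partial>m)"
      by (rule nn_integral_liminf) measurable
    also have "\<dots> \<le> liminf (\<lambda>k. ennreal (((1/4) ^ j)\<^sup>2))"
    proof (rule Liminf_mono, rule eventually_sequentiallyI[of j])
      fix k assume "k \<ge> j"
      have mono: "r j \<le> r k" using \<open>k \<ge> j\<close> by (rule lift_Suc_mono_le[of r, OF r2])
      then have "r k \<ge> N j" using r1[of j] by linarith
      then have "L2_norm m (\<lambda>x. f n x - f (r k) x) \<le> (1/4) ^ j" using N that by (simp add: less_imp_le)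
      then have "(L2_norm m (\<lambda>x. f n x - f (r k) x))\<^sup>2 \<le> ((1/4) ^ j)\<^sup>2" by (intro power_mono) auto
      then show "(\<integral>\<^sup>+x. ennreal ((cmod (f n x - f (r k) x))\<^sup>2) \<partial>m) \<le> ennreal (((1/4) ^ j)\<^sup>2)"
        by (subst nn_integral_square_integrable) (auto intro: square_integrable_diff sq ennreal_leI)
    qed
    also have "\<dots> = ennreal (((1/4) ^ j)\<^sup>2)" by (simp add: Liminf_const)
    finally show ?thesis
      using square_integrable_nn_integral_le[of "\<lambda>x. f n x - g x" m "(1/4) ^ j"] by simp
  qed
  have "square_integrable m (\<lambda>x. f (N 0) x - g x)" using bound[of 0 "N 0"] by simp
  then have "square_integrable m (\<lambda>x. f (N 0) x - (f (N 0) x - g x))"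
    by (rule square_integrable_diff[OF sq])
  then have "square_integrable m g" by simp
  moreover have "(\<lambda>n. L2_norm m (\<lambda>x. f n x - g x)) \<longlonglongrightarrow> 0"
  proof (rule LIMSEQ_I)
    fix e :: real assume "e > 0"
    then obtain j where "(1/4::real) ^ j < e" using real_arch_pow_inv[of e "1/4"] by auto
    then show "\<exists>n0. \<forall>n\<ge>n0. norm (L2_norm m (\<lambda>x. f n x - g x) - 0) < e"
      using bound by (intro exI[of _ "N j"]) fastforce
  qed
  ultimately show ?thesis by (rule that)
qed

lemma L2_class_mem: "square_integrable m f \<Longrightarrow> L2_rel m `` {f} \<in> L2 m"
  unfolding L2_def by (intro quotientI) simp

lemma class_rep_L2_class:
  assumes "square_integrable m f"
  shows "AE x in m. class_rep (L2_rel m `` {f}) x = f x"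
proof -
  have "class_rep (L2_rel m `` {f}) \<in> L2_rel m `` {f}"
    using assms by (intro class_rep_L2(1)[where m = m] L2_class_mem)
  then have "(f, class_rep (L2_rel m `` {f})) \<in> L2_rel m" by blast
  then have "AE x in m. f x = class_rep (L2_rel m `` {f}) x" unfolding L2_rel_def by blast
  then show ?thesis by eventually_elim simp
qed

lemma L2_dist_class_right:
  assumes "F \<in> L2 m" "square_integrable m g"
  shows "L2_dist m F (L2_rel m `` {g}) = L2_norm m (\<lambda>x. class_rep F x - g x)"
proof -
  have "square_integrable m (class_rep F)" "square_integrable m (class_rep (L2_rel m `` {g}))"
    using assms by (auto intro: class_rep_L2 L2_class_mem)
  then show ?thesis unfolding L2_dist_def using class_rep_L2_class[OF assms(2)] assms(2)
    by (intro L2_norm_cong_AE) (auto simp: square_integrable_def)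
qed

theorem L2_mcomplete: "Metric_space.mcomplete (L2 m) (L2_dist m)"
proof -
  interpret Metric_space "L2 m" "L2_dist m" by (rule Metric_space_L2)
  show ?thesis unfolding mcomplete_def
  proof (intro allI impI)
    fix \<sigma> assume "MCauchy \<sigma>"
    then have M: "\<And>n. \<sigma> n \<in> L2 m" and
      C: "\<And>\<epsilon>. \<epsilon> > 0 \<Longrightarrow> \<exists>N. \<forall>n\<ge>N. \<forall>k\<ge>N. L2_dist m (\<sigma> n) (\<sigma> k) < \<epsilon>"
      by (simp_all add: MCauchy_def image_subset_iff)
    have "\<exists>N. \<forall>n\<ge>N. \<forall>k\<ge>N. L2_norm m (\<lambda>x. class_rep (\<sigma> n) x - class_rep (\<sigma> k) x) < \<epsilon>"
      if "\<epsilon> > 0" for \<epsilon> using C[OF that] unfolding L2_dist_def .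
    then obtain g where g: "square_integrable m g"
        "(\<lambda>n. L2_norm m (\<lambda>x. class_rep (\<sigma> n) x - g x)) \<longlonglongrightarrow> 0"
      using L2_complete[of m "\<lambda>n. class_rep (\<sigma> n)"] class_rep_L2(2)[OF M] by blast
    have "(\<lambda>n. L2_dist m (\<sigma> n) (L2_rel m `` {g})) \<longlonglongrightarrow> 0"
      using g M by (simp add: L2_dist_class_right)
    then have "limitin mtopology \<sigma> (L2_rel m `` {g}) sequentially"
      unfolding limit_metric_sequentially using L2_class_mem[OF g(1)] M
      by (auto simp: LIMSEQ_def)
    then show "\<exists>x. limitin mtopology \<sigma> x sequentially" ..
  qed
qed

text \<open>Total boundedness for the seminorm on functions instead of the metric on classes, so
  distinct functions may be at distance 0. The centres lie in \<open>R\<close>, as in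
  \<open>mtotally_bounded\<close>.\<close>

definition L2_totally_bounded :: "'g measure \<Rightarrow> ('g \<Rightarrow> complex) set \<Rightarrow> bool" where
  "L2_totally_bounded m R \<longleftrightarrow>
     (\<forall>\<epsilon>>0. \<exists>S. finite S \<and> S \<subseteq> R \<and> (\<forall>f\<in>R. \<exists>g\<in>S. L2_norm m (\<lambda>x. f x - g x) < \<epsilon>))"

text \<open>By completeness, compact closure amounts to total boundedness. \<open>L2_dist\<close> is
  computed on the chosen representatives, so passing to them changes no distance.\<close>

lemma L2_precompact_iff:
  assumes K: "K \<subseteq> L2 m"
  shows "L2_precompact m K \<longleftrightarrow> L2_totally_bounded m (class_rep ` K)"
proof -
  interpret Metric_space "L2 m" "L2_dist m" by (rule Metric_space_L2)
  have "L2_precompact m K \<longleftrightarrow> mtotally_bounded K"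
    using K by (simp add: L2_precompact_def Let_def mtotally_bounded_eq_compact_closure_of L2_mcomplete)
  also have "\<dots> \<longleftrightarrow> (\<forall>\<epsilon>>0. \<exists>S. finite S \<and> S \<subseteq> K \<and> (\<forall>F\<in>K. \<exists>G\<in>S. L2_dist m F G < \<epsilon>))"
  proof -
    have *: "(K \<subseteq> (\<Union>x\<in>S. mball x \<epsilon>)) \<longleftrightarrow> (\<forall>F\<in>K. \<exists>G\<in>S. L2_dist m F G < \<epsilon>)" if "S \<subseteq> K" for S \<epsilon>
      using that K commute by (fastforce simp: subset_iff)
    show ?thesis unfolding mtotally_bounded_def using * by (metis (no_types, lifting))
  qed
  also have "\<dots> \<longleftrightarrow> L2_totally_bounded m (class_rep ` K)"
    unfolding L2_totally_bounded_def L2_dist_def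
    by (intro all_cong1 imp_cong refl) (simp add: ex_finite_subset_image)
  finally show ?thesis .
qed

lemma L2_bounded_imp_norm_bound:
  assumes K: "K \<subseteq> L2 m" and bdd: "L2_bounded m K"
  obtains B where "B > 0" "\<And>F. F \<in> K \<Longrightarrow> L2_norm m (class_rep F) \<le> B"
proof -
  interpret Metric_space "L2 m" "L2_dist m" by (rule Metric_space_L2)
  let ?O = "L2_rel m `` {\<lambda>x. 0}"
  have O: "?O \<in> L2 m" by (intro L2_class_mem square_integrable_zero)
  \<comment> \<open>Metric boundedness has no preferred centre; adjoining the class of 0 turns it
    into a bound on norms.\<close>
  have "mbounded (insert ?O K)"
    using bdd O by (simp add: L2_bounded_def mbounded_insert)
  then obtain B where B: "B > 0" "\<And>F. F \<in> K \<Longrightarrow> L2_dist m F ?O \<le> B"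
    unfolding mbounded_alt_pos by blast
  show ?thesis
  proof (rule that[OF B(1)])
    fix F assume "F \<in> K"
    then show "L2_norm m (class_rep F) \<le> B"
      using B(2)[of F] K L2_dist_class_right[OF _ square_integrable_zero, of F m] by auto
  qed
qed

section \<open>Invariant integration on a compact group\<close>

locale compact_group =
  fixes m :: "'g::{topological_group_add,t2_space} measure"
  assumes compact: "compact (UNIV :: 'g set)"
    and haar: "normalized_haar_measure m"
begin

lemma sets_haar [measurable_cong, simp]: "sets m = sets borel"
  using haar by (simp add: normalized_haar_measure_def)

lemma space_haar [simp]: "space m = UNIV"
  using sets_eq_imp_space_eq[OF sets_haar] by simp

lemma emeasure_UNIV [simp]: "emeasure m UNIV = 1"
  using haar by (simp add: normalized_haar_measure_def)

lemma outer_regular: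
  "A \<in> sets borel \<Longrightarrow> emeasure m A = (INF U\<in>{U. open U \<and> A \<subseteq> U}. emeasure m U)"
  using haar unfolding normalized_haar_measure_def by blast

lemma inner_regular:
  "A \<in> sets borel \<Longrightarrow> emeasure m A = (SUP C\<in>{C. compact C \<and> C \<subseteq> A}. emeasure m C)"
  using haar unfolding normalized_haar_measure_def by blast

sublocale finite_measure m
  by standard simp

lemma measure_UNIV [simp]: "measure m UNIV = 1"
  by (simp add: measure_def)

lemma integrable_indicator: "A \<in> sets m \<Longrightarrow> integrable m (indicator A :: 'g \<Rightarrow> real)"
  by (simp add: emeasure_eq_measure)

lemma measurable_continuous:
  fixes f :: "'g \<Rightarrow> 'b::topological_space"
  shows "continuous_on UNIV f \<Longrightarrow> f \<in> borel_measurable m"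
  by (simp cong: measurable_cong_sets add: borel_measurable_continuous_onI)

lemma continuous_bounded:
  fixes f :: "'g \<Rightarrow> 'b::real_normed_vector"
  assumes "continuous_on UNIV f"
  obtains B where "B > 0" "\<And>x. norm (f x) \<le> B"
proof -
  have "bounded (range f)" using assms compact by (intro compact_imp_bounded compact_continuous_image)
  then show ?thesis using that by (auto simp: bounded_pos)
qed

lemma integrable_continuous:
  fixes f :: "'g \<Rightarrow> 'b::{banach,second_countable_topology}"
  assumes "continuous_on UNIV f"
  shows "integrable m f"
proof -
  obtain B where "\<And>x. norm (f x) \<le> B" using continuous_bounded[OF assms] by blast
  then show ?thesis by (intro integrable_const_bound[of _ B] measurable_continuous assms) auto
qed

lemma square_integrable_continuous:
  "continuous_on UNIV f \<Longrightarrow> square_integrable m f"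
  unfolding square_integrable_def
  by (auto intro!: measurable_continuous integrable_continuous continuous_intros)

lemma integrable_square_integrable:
  assumes "square_integrable m f"
  shows "integrable m f"
  using integrable_mult_square_integrable[OF assms square_integrable_continuous[of "\<lambda>x. 1"]] by simp

text \<open>The constant is exactly \<open>B\<close> because the total mass is 1.\<close>

lemma L2_norm_le_sup:
  assumes "f \<in> borel_measurable m" "\<And>x. cmod (f x) \<le> B" "0 \<le> B"
  shows "L2_norm m f \<le> B"
proof -
  have "(\<integral>\<^sup>+x. ennreal ((cmod (f x))\<^sup>2) \<partial>m) \<le> (\<integral>\<^sup>+x. ennreal (B\<^sup>2) \<partial>m)"
    using assms by (intro nn_integral_mono ennreal_leI power_mono) auto
  then show ?thesis using assms by (intro square_integrable_nn_integral_le(2)) auto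
qed

lemma continuous_translate [continuous_intros]:
  "continuous_on UNIV (\<lambda>x::'g. a + x)" "continuous_on UNIV (\<lambda>x::'g. x + a)"
  "continuous_on UNIV (\<lambda>x::'g. - x)"
  by (intro continuous_intros)+

lemma measurable_translate [measurable]:
  "(\<lambda>x. a + x) \<in> measurable m m" "(\<lambda>x. x + a) \<in> measurable m m" "uminus \<in> measurable m m"
  using borel_measurable_continuous_onI[OF continuous_translate(1)]
    borel_measurable_continuous_onI[OF continuous_translate(2)]
    borel_measurable_continuous_onI[OF continuous_translate(3)]
  by (simp_all cong: measurable_cong_sets)

lemma distr_left: "distr m m (\<lambda>x. a + x) = m"
proof (rule measure_eqI)
  fix A assume "A \<in> sets (distr m m (\<lambda>x. a + x))"
  then have A: "A \<in> sets borel" by simp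
  have "(\<lambda>x. a + x) -` A = (+) (- a) ` A"
    by (auto simp: image_iff minus_add_cancel add_minus_cancel intro!: bexI[of _ "a + x" for x])
  then show "emeasure (distr m m (\<lambda>x. a + x)) A = emeasure m A"
    using A haar by (simp add: emeasure_distr normalized_haar_measure_def)
qed simp

lemma integral_left:
  fixes f :: "'g \<Rightarrow> 'b::{banach,second_countable_topology}"
  assumes "f \<in> borel_measurable m"
  shows "(LINT x|m. f (a + x)) = (LINT x|m. f x)"
  using integral_distr[of "\<lambda>x. a + x" m m f] assms by (simp add: distr_left)

section \<open>Fubini's theorem for continuous kernels\<close>

lemma measurable_kernel:
  fixes F :: "'g \<times> 'g \<Rightarrow> complex"
  assumes F: "continuous_on UNIV F"
  shows "F \<in> borel_measurable (m \<Otimes>\<^sub>M m)"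
proof -
  \<comment> \<open>Compactness in the second variable makes the sections of \<open>F\<close> vary
    continuously in the supremum norm, and compactness in the first leaves finitely many sections to
    choose from. A function that uses the first variable only to select one of these sections is
    product measurable.\<close>
  have approx: "\<exists>G. G \<in> borel_measurable (m \<Otimes>\<^sub>M m) \<and> (\<forall>p. dist (G p) (F p) \<le> e)" if "e > 0" for e
  proof -
    have "\<exists>U. open U \<and> x \<in> U \<and> (\<forall>x'\<in>U. \<forall>y. dist (F (x', y)) (F (x, y)) \<le> e)" for x
    proof -
      have F': "continuous_on (UNIV \<times> UNIV) F" using F by simp
      obtain U where "x \<in> U" "open U" "\<forall>x'\<in>U \<inter> UNIV. \<forall>y\<in>UNIV. dist (F (x', y)) (F (x, y)) \<le> e"
        using continuous_on_prod_compactE[OF F' compact UNIV_I \<open>e > 0\<close>] by blast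
      then show ?thesis by auto
    qed
    then obtain U where U: "\<And>x. open (U x)" "\<And>x. x \<in> U x"
      "\<And>x x' y. x' \<in> U x \<Longrightarrow> dist (F (x', y)) (F (x, y)) \<le> e" by metis
    obtain C where C: "finite C" "UNIV \<subseteq> (\<Union>c\<in>C. U c)"
      by (rule compactE_image[OF compact, of UNIV U]) (use U in auto)
    obtain xs where xs: "set xs = C" using finite_list[OF C(1)] by blast
    \<comment> \<open>Taking the first suitable index turns the overlapping cover into a measurable
      partition.\<close>
    define s where "s x = (LEAST i. x \<in> U (xs ! i))" for x
    have s: "x \<in> U (xs ! s x)" for x
    proof -
      obtain i where "x \<in> U (xs ! i)" using C(2) xs by (force simp: in_set_conv_nth)
      then show ?thesis unfolding s_def by (rule LeastI)
    qed
    have [measurable]: "U x \<in> sets m" for x using U(1) by simp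
    have s_m [measurable]: "s \<in> measurable m (count_space UNIV)" unfolding s_def by measurable
    have c: "(\<lambda>y. F (x, y)) \<in> borel_measurable m" for x
      by (intro measurable_continuous continuous_on_compose2[OF F] continuous_intros) auto
    have "(\<lambda>p. F (xs ! s (fst p), snd p)) \<in> borel_measurable (m \<Otimes>\<^sub>M m)"
      by (rule measurable_compose_countable[where f = "\<lambda>i p. F (xs ! i, snd p)"])
         (auto intro: measurable_compose[OF measurable_snd c])
    moreover have "dist (F (xs ! s (fst p), snd p)) (F p) \<le> e" for p
      using U(3)[OF s, of "fst p" "snd p"] by (simp add: dist_commute)
    ultimately show ?thesis by blast
  qed
  have "\<exists>G. \<forall>n. G n \<in> borel_measurable (m \<Otimes>\<^sub>M m) \<and> (\<forall>p. dist (G n p) (F p) \<le> inverse (real (Suc n)))"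
    by (intro choice allI approx) simp
  then obtain G where G: "\<And>n. G n \<in> borel_measurable (m \<Otimes>\<^sub>M m)"
    "\<And>n p. dist (G n p) (F p) \<le> inverse (real (Suc n))" by blast
  show ?thesis
  proof (rule borel_measurable_LIMSEQ_metric[OF G(1)])
    fix p
    have "\<forall>\<^sub>F i in sequentially. 0 \<le> dist (G i p) (F p)"
      "\<forall>\<^sub>F i in sequentially. dist (G i p) (F p) \<le> inverse (real (Suc i))"
      by (rule always_eventually, rule allI, rule zero_le_dist G(2))+
    from tendsto_sandwich[OF this tendsto_const LIMSEQ_inverse_real_of_nat]
    have "(\<lambda>i. dist (G i p) (F p)) \<longlonglongrightarrow> 0" .
    then show "(\<lambda>i. G i p) \<longlonglongrightarrow> F p" by (rule tendsto_dist_iff[THEN iffD2])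
  qed
qed

text \<open>\<open>F\<close> is bounded by compactness, so a multiple of the tensor product of
  \<open>f\<close> and \<open>g\<close> dominates the integrand. The integrable factors are there
  for the self-adjointness of convolution on square-integrable functions.\<close>

lemma Fubini_kernel:
  fixes F :: "'g \<times> 'g \<Rightarrow> complex"
  assumes F: "continuous_on UNIV F" and f: "integrable m f" and g: "integrable m g"
  shows "(LINT x|m. LINT y|m. f x * F (x, y) * g y) = (LINT y|m. LINT x|m. f x * F (x, y) * g y)"
proof -
  interpret P: pair_sigma_finite m m ..
  have "compact (UNIV :: ('g \<times> 'g) set)"
    using compact_Times[OF compact compact] by simp
  then have "bounded (range F)" using F by (intro compact_imp_bounded compact_continuous_image)
  then obtain B where B: "\<And>p. cmod (F p) \<le> B" by (auto simp: bounded_iff)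
  note [measurable] = measurable_kernel[OF F]
  have [measurable]: "f \<in> borel_measurable m" "g \<in> borel_measurable m" using f g by auto
  have "integrable (m \<Otimes>\<^sub>M m) (\<lambda>p. f (fst p) * g (snd p))"
  proof (rule P.Fubini_integrable)
    show "integrable m (\<lambda>x. LINT y|m. cmod (f (fst (x, y)) * g (snd (x, y))))"
      using f by (simp add: norm_mult)
    show "AE x in m. integrable m (\<lambda>y. f (fst (x, y)) * g (snd (x, y)))"
      using g by simp
  qed measurable
  then have "integrable (m \<Otimes>\<^sub>M m) (\<lambda>p. B * (f (fst p) * g (snd p)))"
    by (rule integrable_mult_right)
  then have "integrable (m \<Otimes>\<^sub>M m) (\<lambda>(x, y). f x * F (x, y) * g y)"
  proof (rule Bochner_Integration.integrable_bound)
    show "AE p in m \<Otimes>\<^sub>M m. cmod (case p of (x, y) \<Rightarrow> f x * F (x, y) * g y) \<le> cmod (B * (f (fst p) * g (snd p)))"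
    proof (rule AE_I2)
      fix p
      have "cmod (F p) \<le> \<bar>B\<bar>" using B[of p] by simp
      then have "cmod (F p) * (cmod (f (fst p)) * cmod (g (snd p))) \<le> \<bar>B\<bar> * (cmod (f (fst p)) * cmod (g (snd p)))"
        by (intro mult_right_mono) auto
      then show "cmod (case p of (x, y) \<Rightarrow> f x * F (x, y) * g y) \<le> cmod (B * (f (fst p) * g (snd p)))"
        by (simp add: norm_mult split_beta mult_ac)
    qed
  qed measurable
  then show ?thesis by (rule P.Fubini_integral[symmetric])
qed

lemma Fubini_continuous:
  fixes F :: "'g \<times> 'g \<Rightarrow> complex"
  assumes F: "continuous_on UNIV F"
  shows "(LINT x|m. LINT y|m. F (x, y)) = (LINT y|m. LINT x|m. F (x, y))"
  using Fubini_kernel[OF F, of "\<lambda>x. 1" "\<lambda>x. 1"] by simp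

section \<open>Invariance under inversion and right translation\<close>

lemma integral_uminus_continuous:
  fixes f :: "'g \<Rightarrow> complex"
  assumes f: "continuous_on UNIV f"
  shows "(LINT x|m. f (- x)) = (LINT x|m. f x)"
proof -
  have fm: "f \<in> borel_measurable m" by (rule measurable_continuous[OF f])
  \<comment> \<open>The double integral of \<open>f (- x + y)\<close> is evaluated in two ways. By
    left invariance, integrating over \<open>y\<close> first gives the integral of \<open>f\<close>,
    and integrating over \<open>x\<close> first gives that of \<open>f (- x)\<close>.\<close>
  have "(LINT x|m. LINT y|m. f (- x + y)) = (LINT y|m. LINT x|m. f (- x + y))"
    using Fubini_continuous[of "\<lambda>p. f (- fst p + snd p)"]
      continuous_on_compose2[OF f, of UNIV "\<lambda>p. - fst p + snd p"]
    by (simp add: continuous_intros)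
  also have "(LINT y|m. LINT x|m. f (- x + y)) = (LINT y|m. LINT x|m. f (- x))"
  proof (rule Bochner_Integration.integral_cong[OF refl])
    fix y
    have "(LINT x|m. f (- x + y)) = (LINT x|m. f (- (- y + x)))" by (simp add: minus_add)
    also have "\<dots> = (LINT x|m. f (- x))" 
      by (intro integral_left) (use measurable_compose[OF measurable_translate(3) fm] in simp)
    finally show "(LINT x|m. f (- x + y)) = (LINT x|m. f (- x))" .
  qed
  finally show ?thesis using fm by (simp add: integral_left)
qed

text \<open>Inversion exchanges left and right translations.\<close>

lemma integral_right_continuous:
  fixes f :: "'g \<Rightarrow> complex"
  assumes f: "continuous_on UNIV f"
  shows "(LINT x|m. f (x + a)) = (LINT x|m. f x)"
proof -
  have fm: "f \<in> borel_measurable m" by (rule measurable_continuous[OF f])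
  have "(LINT x|m. f (x + a)) = (LINT x|m. f (- x + a))"
    by (rule integral_uminus_continuous[symmetric])
       (intro continuous_on_compose2[OF f] continuous_intros, auto)
  also have "\<dots> = (LINT x|m. f (- (- a + x)))" by (simp add: minus_add)
  also have "\<dots> = (LINT x|m. f (- x))" 
      by (intro integral_left) (use measurable_compose[OF measurable_translate(3) fm] in simp)
  also have "\<dots> = (LINT x|m. f x)" by (rule integral_uminus_continuous[OF f])
  finally show ?thesis .
qed

lemma Urysohn:
  fixes A U :: "'g set"
  assumes "closed A" "open U" "A \<subseteq> U"
  obtains h :: "'g \<Rightarrow> real" where "continuous_on UNIV h" "\<And>x. 0 \<le> h x" "\<And>x. h x \<le> 1"
    "\<And>x. x \<in> A \<Longrightarrow> h x = 1" "\<And>x. x \<notin> U \<Longrightarrow> h x = 0"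
proof -
  have "Hausdorff_space (euclidean :: 'g topology)"
    unfolding Hausdorff_space_def disjnt_def by simp (meson hausdorff)
  then have "normal_space (euclidean :: 'g topology)"
    using compact by (intro compact_Hausdorff_or_regular_imp_normal_space)
      (auto simp: compact_space_def)
  then obtain f where f: "continuous_map euclidean (top_of_set {0..1::real}) f"
      "f ` (- U) \<subseteq> {0}" "f ` A \<subseteq> {1}"
    by (rule Urysohn_lemma[of _ "- U" A 0 1]) (use assms in \<open>auto simp: disjnt_def\<close>)
  then have "continuous_on UNIV f" "\<And>x. f x \<in> {0..1}"
    by (auto simp: continuous_map_in_subtopology Pi_iff)
  then show ?thesis using f that[of f] by force
qed

text \<open>A Urysohn function between \<open>C\<close> and an open \<open>U\<close> carries the
  invariance of integrals over to measures: the shifted set is bounded by the integral of the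
  shifted function, hence by the measure of \<open>U\<close>. Outer regularity lets \<open>U\<close>
  shrink to \<open>C\<close>.\<close>

lemma measure_shift_compact_le:
  assumes C: "compact C"
  shows "emeasure m ((\<lambda>x. x + a) -` C) \<le> emeasure m C"
proof -
  have Cb: "C \<in> sets borel" "closed C" using C by (auto intro: compact_imp_closed borel_closed)
  have "emeasure m ((\<lambda>x. x + a) -` C) \<le> (INF U\<in>{U. open U \<and> C \<subseteq> U}. emeasure m U)"
  proof (rule INF_greatest)
    fix U assume "U \<in> {U. open U \<and> C \<subseteq> U}"
    then have U: "open U" "C \<subseteq> U" by auto
    obtain h :: "'g \<Rightarrow> real" where h: "continuous_on UNIV h" "\<And>x. 0 \<le> h x" "\<And>x. h x \<le> 1"
      "\<And>x. x \<in> C \<Longrightarrow> h x = 1" "\<And>x. x \<notin> U \<Longrightarrow> h x = 0"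
      using Urysohn[OF Cb(2) U] by blast
    have h': "continuous_on UNIV (\<lambda>x. h (x + a))"
      by (intro continuous_on_compose2[OF h(1)] continuous_intros) auto
    have sh: "(\<lambda>x. x + a) -` C \<in> sets m"
      using measurable_sets[OF measurable_translate(2)[of a], of C] Cb by simp
    have "complex_of_real (LINT x|m. h (x + a)) = (LINT x|m. complex_of_real (h (x + a)))" by simp
    also have "\<dots> = (LINT x|m. complex_of_real (h x))"
      by (rule integral_right_continuous) (intro continuous_intros h)
    also have "\<dots> = complex_of_real (LINT x|m. h x)" by simp
    finally have eq: "(LINT x|m. h (x + a)) = (LINT x|m. h x)"
      by (simp only: of_real_eq_iff)
    have "measure m ((\<lambda>x. x + a) -` C) = (LINT x|m. indicator ((\<lambda>x. x + a) -` C) x)"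
      using sh by simp
    also have "\<dots> \<le> (LINT x|m. h (x + a))"
      using h sh by (intro integral_mono integrable_continuous h' integrable_indicator)
        (auto simp: indicator_def)
    also have "\<dots> = (LINT x|m. h x)" by (rule eq)
    also have "\<dots> \<le> (LINT x|m. indicator U x)"
      using h U by (intro integral_mono integrable_continuous h integrable_indicator)
        (auto simp: indicator_def)
    also have "\<dots> = measure m U" using U by simp
    finally show "emeasure m ((\<lambda>x. x + a) -` C) \<le> emeasure m U" by (simp add: emeasure_eq_measure)
  qed
  then show ?thesis using outer_regular[OF Cb(1)] by simp
qed

text \<open>Inner regularity is applied to the shifted set: each compact subset of it is the shift
  of a compact subset of \<open>A\<close>, for which the estimate is known.\<close>

lemma measure_shift_le:
  assumes A: "A \<in> sets borel"
  shows "emeasure m ((\<lambda>x. x + a) -` A) \<le> emeasure m A"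
proof -
  have sh: "(\<lambda>x. x + a) -` A \<in> sets borel"
    using measurable_sets[OF measurable_translate(2)[of a], of A] A by simp
  have "(SUP C\<in>{C. compact C \<and> C \<subseteq> (\<lambda>x. x + a) -` A}. emeasure m C) \<le> emeasure m A"
  proof (rule SUP_least)
    fix C assume "C \<in> {C. compact C \<and> C \<subseteq> (\<lambda>x. x + a) -` A}"
    then have C: "compact C" "(\<lambda>x. x + a) ` C \<subseteq> A" by auto
    have c: "compact ((\<lambda>x. x + a) ` C)"
      by (intro compact_continuous_image C continuous_on_subset[OF continuous_translate(2)]) simp
    have "C = (\<lambda>x. x + a) -` ((\<lambda>x. x + a) ` C)" by auto
    then have "emeasure m C \<le> emeasure m ((\<lambda>x. x + a) ` C)"
      using measure_shift_compact_le[OF c, of a] by simp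
    also have "\<dots> \<le> emeasure m A" using C A by (intro emeasure_mono) auto
    finally show "emeasure m C \<le> emeasure m A" .
  qed
  then show ?thesis using inner_regular[OF sh] by simp
qed

text \<open>Unimodularity: the shift inequality for \<open>a\<close> and the one for
  \<open>- a\<close> together give equality.\<close>

lemma distr_right: "distr m m (\<lambda>x. x + a) = m"
proof (rule measure_eqI)
  fix A assume "A \<in> sets (distr m m (\<lambda>x. x + a))"
  then have A: "A \<in> sets borel" by simp
  have sh: "(\<lambda>x. x + a) -` A \<in> sets borel"
    using measurable_sets[OF measurable_translate(2)[of a], of A] A by simp
  have "A = (\<lambda>x. x + - a) -` ((\<lambda>x. x + a) -` A)" by auto
  then have "emeasure m A \<le> emeasure m ((\<lambda>x. x + a) -` A)"
    using measure_shift_le[OF sh, of "- a"] by simp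
  with measure_shift_le[OF A, of a] show "emeasure (distr m m (\<lambda>x. x + a)) A = emeasure m A"
    using A by (simp add: emeasure_distr)
qed simp

lemma square_integrable_translate:
  assumes "square_integrable m f"
  shows "square_integrable m (\<lambda>x. f (x + a))" "square_integrable m (\<lambda>x. f (a + x))"
proof -
  have [measurable]: "f \<in> borel_measurable m" and "integrable m (\<lambda>x. (cmod (f x))\<^sup>2)"
    using assms by (auto simp: square_integrable_def)
  then have "integrable (distr m m (\<lambda>x. x + a)) (\<lambda>x. (cmod (f x))\<^sup>2)"
    "integrable (distr m m (\<lambda>x. a + x)) (\<lambda>x. (cmod (f x))\<^sup>2)" by (simp_all add: distr_right distr_left)
  then have "integrable m (\<lambda>x. (cmod (f (x + a)))\<^sup>2)" "integrable m (\<lambda>x. (cmod (f (a + x)))\<^sup>2)"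
    by (auto dest!: integrable_distr[rotated])
  then show "square_integrable m (\<lambda>x. f (x + a))" "square_integrable m (\<lambda>x. f (a + x))"
    using measurable_compose[OF measurable_translate(1)] measurable_compose[OF measurable_translate(2)]
    unfolding square_integrable_def by auto
qed

lemma L2_norm_translate:
  assumes "f \<in> borel_measurable m"
  shows "L2_norm m (\<lambda>x. f (x + a)) = L2_norm m f"
proof -
  have [measurable]: "f \<in> borel_measurable m" by fact
  have "(LINT x|distr m m (\<lambda>x. x + a). (cmod (f x))\<^sup>2) = (LINT x|m. (cmod (f (x + a)))\<^sup>2)"
    by (rule integral_distr) measurable
  then show ?thesis by (simp add: L2_norm_def distr_right)
qed

section \<open>Density of the continuous functions and continuity of translation\<close>

lemma indicator_approx:
  assumes A: "A \<in> sets m" and e: "e > 0"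
  obtains g where "continuous_on UNIV g" "L2_norm m (\<lambda>x. complex_of_real (indicator A x) - g x) < e"
proof -
  \<comment> \<open>Outer and inner regularity each lose at most \<open>d\<close>, so
    \<open>U - C\<close> has measure at most \<open>e\<^sup>2 / 2\<close>. Outside it the Urysohn
    function agrees with the indicator of \<open>A\<close>, and inside it the two differ by at most
    1.\<close>
  define d where "d = e\<^sup>2 / 4"
  have d: "d > 0" using e by (simp add: d_def)
  have Ab: "A \<in> sets borel" using A by simp
  have "(INF U\<in>{U. open U \<and> A \<subseteq> U}. emeasure m U) = emeasure m A"
    "(SUP C\<in>{C. compact C \<and> C \<subseteq> A}. emeasure m C) = emeasure m A"
    using outer_regular[OF Ab] inner_regular[OF Ab] by simp_all
  moreover have "emeasure m A < ennreal (measure m A + d)"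
    using d by (simp add: emeasure_eq_measure ennreal_less_iff)
  \<comment> \<open>If \<open>measure m A < d\<close>, the left side is 0 and the strict inequality
    fails for a null set; the empty set then serves as \<open>C\<close>.\<close>
  moreover have "ennreal (measure m A - d) < emeasure m A \<or> measure m A < d"
  proof (cases "measure m A < d")
    case False
    then have "0 \<le> measure m A - d" by simp
    then show ?thesis using d by (simp add: emeasure_eq_measure ennreal_less_iff)
  qed simp
  ultimately obtain U where U: "open U" "A \<subseteq> U" "emeasure m U < ennreal (measure m A + d)"
    by (metis (mono_tags, lifting) INF_less_iff mem_Collect_eq)
  obtain C where C: "compact C" "C \<subseteq> A" "measure m A - d \<le> measure m C"
  proof (cases "measure m A < d")
    case True
    then show ?thesis by (intro that[of "{}"]) auto
  next
    case False
    then have "ennreal (measure m A - d) < (SUP C\<in>{C. compact C \<and> C \<subseteq> A}. emeasure m C)"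
      using \<open>(SUP C\<in>_. _) = _\<close> \<open>_ \<or> _\<close> by simp
    then obtain C where "compact C" "C \<subseteq> A" "ennreal (measure m A - d) < emeasure m C"
      unfolding less_SUP_iff by auto
    then show ?thesis using False by (intro that[of C]) (auto simp: emeasure_eq_measure ennreal_less_iff)
  qed
  have Cb: "closed C" "C \<in> sets m" using C by (auto intro: compact_imp_closed borel_closed)
  have Ub: "U \<in> sets m" using U by simp
  have "measure m (U - C) = measure m U - measure m C"
    using Ub Cb U C by (intro finite_measure_Diff) auto
  also have "\<dots> < e\<^sup>2"
  proof -
    have "measure m U < measure m A + d"
      using U(3) d by (simp add: emeasure_eq_measure ennreal_less_iff del: ennreal_plus)
    then show ?thesis using C(3) zero_less_power[OF e, of 2] unfolding d_def by linarith
  qed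
  finally have small: "measure m (U - C) < e\<^sup>2" .
  obtain h :: "'g \<Rightarrow> real" where h: "continuous_on UNIV h" "\<And>x. 0 \<le> h x" "\<And>x. h x \<le> 1"
    "\<And>x. x \<in> C \<Longrightarrow> h x = 1" "\<And>x. x \<notin> U \<Longrightarrow> h x = 0"
    using Urysohn[OF Cb(1) U(1)] U C by (metis order_trans)
  have hm [measurable]: "h \<in> borel_measurable m" by (rule measurable_continuous[OF h(1)])
  have "(LINT x|m. (cmod (complex_of_real (indicator A x) - complex_of_real (h x)))\<^sup>2)
      \<le> (LINT x|m. indicator (U - C) x)"
  proof (rule integral_mono_AE')
    show "integrable m (indicator (U - C) :: 'g \<Rightarrow> real)" using Ub Cb by (simp add: emeasure_eq_measure)
    have "(cmod (complex_of_real (indicator A x) - complex_of_real (h x)))\<^sup>2 \<le> indicator (U - C) x" for x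
    proof -
      have "cmod (complex_of_real (indicator A x) - complex_of_real (h x)) = \<bar>indicator A x - h x\<bar>"
        unfolding of_real_diff[symmetric] norm_of_real ..
      moreover have "\<bar>indicator A x - h x\<bar> \<le> indicator (U - C) x"
        using h(2-5)[of x] U(2) C(2) by (cases "x \<in> A"; cases "x \<in> U"; cases "x \<in> C") (auto simp: indicator_def)
      moreover have "(indicator (U - C) x)\<^sup>2 = (indicator (U - C) x :: real)" by (simp add: indicator_def)
      ultimately show ?thesis by (metis abs_ge_zero power_mono)
    qed
    then show "AE x in m. (cmod (complex_of_real (indicator A x) - complex_of_real (h x)))\<^sup>2 \<le> indicator (U - C) x"
      by simp
  qed auto
  also have "\<dots> = measure m (U - C)" using Ub Cb by simp
  also note small
  finally have "L2_norm m (\<lambda>x. complex_of_real (indicator A x) - complex_of_real (h x)) < e"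
    unfolding L2_norm_def using e by (intro real_less_lsqrt) auto
  then show ?thesis using h(1) by (intro that[of "\<lambda>x. complex_of_real (h x)"]) (auto intro: continuous_intros)
qed

text \<open>Membership in the closure of the continuous functions, as a predicate closed under
  linear combinations; density then reduces to indicators.\<close>

definition C_approximable :: "('g \<Rightarrow> complex) \<Rightarrow> bool" where
  "C_approximable f \<longleftrightarrow> square_integrable m f \<and>
     (\<forall>e>0. \<exists>g. continuous_on UNIV g \<and> L2_norm m (\<lambda>x. f x - g x) < e)"

lemma C_approximable_scale:
  assumes "C_approximable f"
  shows "C_approximable (\<lambda>x. c * f x)"
  unfolding C_approximable_def
proof (intro conjI allI impI)
  show "square_integrable m (\<lambda>x. c * f x)"
    using assms by (auto simp: C_approximable_def intro: square_integrable_scale)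
  fix e :: real assume "e > 0"
  then have "e / (cmod c + 1) > 0" by (simp add: add_nonneg_pos)
  then obtain g where g: "continuous_on UNIV g" "L2_norm m (\<lambda>x. f x - g x) < e / (cmod c + 1)"
    using assms by (auto simp: C_approximable_def)
  have "L2_norm m (\<lambda>x. c * f x - c * g x) = cmod c * L2_norm m (\<lambda>x. f x - g x)"
    by (simp add: L2_norm_scale flip: right_diff_distrib)
  also have "\<dots> \<le> (cmod c + 1) * L2_norm m (\<lambda>x. f x - g x)" by (intro mult_right_mono) auto
  also have "\<dots> < (cmod c + 1) * (e / (cmod c + 1))"
    using g(2) by (intro mult_strict_left_mono) (auto intro: add_nonneg_pos)
  also have "\<dots> = e" using add_nonneg_pos[of "cmod c" 1] by simp
  finally show "\<exists>g. continuous_on UNIV g \<and> L2_norm m (\<lambda>x. c * f x - g x) < e"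
    using g(1) by (intro exI[of _ "\<lambda>x. c * g x"]) (auto intro: continuous_intros)
qed

lemma C_approximable_add:
  assumes f: "C_approximable f" and g: "C_approximable g"
  shows "C_approximable (\<lambda>x. f x + g x)"
  unfolding C_approximable_def
proof (intro conjI allI impI)
  show "square_integrable m (\<lambda>x. f x + g x)"
    using assms by (auto simp: C_approximable_def intro: square_integrable_add)
  fix e :: real assume "e > 0"
  then have "e / 2 > 0" by simp
  then obtain f' g' where f': "continuous_on UNIV f'" "L2_norm m (\<lambda>x. f x - f' x) < e / 2"
    and g': "continuous_on UNIV g'" "L2_norm m (\<lambda>x. g x - g' x) < e / 2"
    using f g unfolding C_approximable_def by blast
  have "L2_norm m (\<lambda>x. f x + g x - (f' x + g' x)) = L2_norm m (\<lambda>x. (f x - f' x) + (g x - g' x))"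
    by (simp add: algebra_simps)
  also have "\<dots> \<le> L2_norm m (\<lambda>x. f x - f' x) + L2_norm m (\<lambda>x. g x - g' x)"
    using f g f' g'
    by (intro L2_norm_triangle square_integrable_diff) (auto simp: C_approximable_def intro: square_integrable_continuous)
  also have "\<dots> < e" using f' g' by simp
  finally show "\<exists>h. continuous_on UNIV h \<and> L2_norm m (\<lambda>x. f x + g x - h x) < e"
    using f' g' by (intro exI[of _ "\<lambda>x. f' x + g' x"]) (auto intro: continuous_intros)
qed

lemma C_approximable_simple:
  assumes s: "simple_function m (s :: 'g \<Rightarrow> complex)"
  shows "C_approximable s"
proof -
  have fin: "finite (range s)" and me: "\<And>y. s -` {y} \<in> sets m"
    using simple_functionD[OF s] by (simp_all del: sets_haar)
  have ind: "C_approximable (\<lambda>x. complex_of_real (indicator (s -` {y}) x))" for y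
    unfolding C_approximable_def
  proof (intro conjI allI impI)
    have [measurable]: "s -` {y} \<in> sets m" by (rule me)
    show "square_integrable m (\<lambda>x. complex_of_real (indicator (s -` {y}) x))"
      unfolding square_integrable_def
    proof
      have "(\<lambda>x. (cmod (complex_of_real (indicator (s -` {y}) x)))\<^sup>2) = indicator (s -` {y})"
        by (auto simp: indicator_def)
      then show "integrable m (\<lambda>x. (cmod (complex_of_real (indicator (s -` {y}) x)))\<^sup>2)"
        using integrable_indicator[OF me] by simp
    qed measurable
  qed (use indicator_approx[OF me] in blast)
  have z: "C_approximable (\<lambda>x. 0)"
    using C_approximable_scale[OF ind, of 0] by simp
  have "C_approximable (\<lambda>x. \<Sum>y\<in>I. y * complex_of_real (indicator (s -` {y}) x))" if "finite I" for I
    using that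
  proof induction
    case (insert y I)
    show ?case using insert.hyps C_approximable_add[OF C_approximable_scale[OF ind] insert.IH] by simp
  qed (use z in simp)
  from this[OF fin] show ?thesis
    using fin by (simp add: indicator_def of_bool_def if_distrib sum.delta cong: if_cong)
qed

theorem continuous_dense:
  assumes f: "square_integrable m f" and e: "e > 0"
  obtains g where "continuous_on UNIV g" "L2_norm m (\<lambda>x. f x - g x) < e"
proof -
  have fm [measurable]: "f \<in> borel_measurable m" using f by (simp add: square_integrable_def)
  obtain s where "\<forall>i. simple_function m (s i)" "\<forall>x\<in>space m. (\<lambda>i. s i x) \<longlonglongrightarrow> f x"
    "\<forall>i. \<forall>x\<in>space m. dist (s i x) 0 \<le> 2 * dist (f x) 0"
    using borel_measurable_implies_sequence_metric[OF fm, of 0] by blast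
  then have s: "\<And>i. simple_function m (s i)" "\<And>x. (\<lambda>i. s i x) \<longlonglongrightarrow> f x"
    "\<And>i x. cmod (s i x) \<le> 2 * cmod (f x)"
    by auto
  have sm [measurable]: "s i \<in> borel_measurable m" for i using s(1) by (rule borel_measurable_simple_function)
  have "(\<lambda>i. LINT x|m. (cmod (f x - s i x))\<^sup>2) \<longlonglongrightarrow> (LINT x|m. 0)"
  proof (rule integral_dominated_convergence)
    \<comment> \<open>The bound \<open>cmod (s i x) \<le> 2 * cmod (f x)\<close> makes the
      difference at most \<open>3 * cmod (f x)\<close>; the majorant is the square of this.\<close>
    show "integrable m (\<lambda>x. 9 * (cmod (f x))\<^sup>2)" using f by (simp add: square_integrable_def)
    show "AE x in m. (\<lambda>i. (cmod (f x - s i x))\<^sup>2) \<longlonglongrightarrow> 0"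
    proof (rule AE_I2)
      fix x
      have "(\<lambda>i. (cmod (f x - s i x))\<^sup>2) \<longlonglongrightarrow> (cmod (f x - f x))\<^sup>2" by (intro tendsto_intros s)
      then show "(\<lambda>i. (cmod (f x - s i x))\<^sup>2) \<longlonglongrightarrow> 0" by simp
    qed
    fix i
    show "AE x in m. norm ((cmod (f x - s i x))\<^sup>2) \<le> 9 * (cmod (f x))\<^sup>2"
    proof (rule AE_I2)
      fix x
      have "cmod (f x - s i x) \<le> 3 * cmod (f x)"
        using norm_triangle_ineq4[of "f x" "s i x"] s(3)[of i x] by linarith
      then have "(cmod (f x - s i x))\<^sup>2 \<le> (3 * cmod (f x))\<^sup>2" by (intro power_mono) auto
      then show "norm ((cmod (f x - s i x))\<^sup>2) \<le> 9 * (cmod (f x))\<^sup>2" by (simp add: power_mult_distrib)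
    qed
  qed auto
  then have "(\<lambda>i. L2_norm m (\<lambda>x. f x - s i x)) \<longlonglongrightarrow> 0"
    unfolding L2_norm_def using tendsto_real_sqrt by fastforce
  then have "eventually (\<lambda>i. L2_norm m (\<lambda>x. f x - s i x) < e / 2) sequentially"
    using e by (intro order_tendstoD) auto
  then obtain i where i: "L2_norm m (\<lambda>x. f x - s i x) < e / 2" by (auto simp: eventually_sequentially)
  obtain g where g: "continuous_on UNIV g" "L2_norm m (\<lambda>x. s i x - g x) < e / 2"
    and si: "square_integrable m (s i)"
    using C_approximable_simple[OF s(1)[of i]] e unfolding C_approximable_def by (meson half_gt_zero)
  have "L2_norm m (\<lambda>x. f x - g x) < e"
    using L2_norm_diff_triangle[OF f si square_integrable_continuous[OF g(1)]] i g by linarith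
  then show ?thesis using g that by blast
qed

text \<open>Uniform continuity without a metric: the tube lemma at the identity, where compactness
  in \<open>x\<close> makes the neighbourhood independent of \<open>x\<close>.\<close>

lemma uniform_continuity_right:
  fixes g :: "'g \<Rightarrow> complex"
  assumes g: "continuous_on UNIV g" and e: "e > 0"
  obtains V where "open V" "0 \<in> V" "\<And>x y. y \<in> V \<Longrightarrow> cmod (g (x + y) - g x) \<le> e"
proof -
  define F where "F = (\<lambda>p. g (snd p + fst p))"
  have "continuous_on (UNIV \<times> UNIV) F"
    unfolding F_def by (intro continuous_on_compose2[OF g] continuous_intros) auto
  from continuous_on_prod_compactE[OF this compact UNIV_I[of 0] e]
  obtain V where "0 \<in> V" "open V" "\<forall>y\<in>V \<inter> UNIV. \<forall>x\<in>UNIV. dist (F (y, x)) (F (0, x)) \<le> e"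
    by blast
  then show ?thesis by (intro that[of V]) (auto simp: dist_norm F_def)
qed

text \<open>Right translation is an isometry, so a continuous \<open>g\<close> near \<open>f\<close>
  stays near after translation, and \<open>g\<close> itself is uniformly continuous.\<close>

theorem translation_continuous:
  assumes f: "square_integrable m f" and e: "e > 0"
  obtains V where "open V" "0 \<in> V" "\<And>y. y \<in> V \<Longrightarrow> L2_norm m (\<lambda>x. f (x + y) - f x) < e"
proof -
  have e4: "e / 4 > 0" using e by simp
  obtain g where g: "continuous_on UNIV g" "L2_norm m (\<lambda>x. f x - g x) < e / 4"
    using continuous_dense[OF f e4] by blast
  obtain V where V: "open V" "0 \<in> V" "\<And>x y. y \<in> V \<Longrightarrow> cmod (g (x + y) - g x) \<le> e / 4"
    using uniform_continuity_right[OF g(1) e4] by blast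
  have gs: "square_integrable m g" by (rule square_integrable_continuous[OF g(1)])
  show ?thesis
  proof (rule that[OF V(1,2)])
    fix y assume y: "y \<in> V"
    have fg: "square_integrable m (\<lambda>x. f x - g x)" using f gs by (rule square_integrable_diff)
    have "L2_norm m (\<lambda>x. f (x + y) - f x) \<le> L2_norm m (\<lambda>x. f (x + y) - g (x + y)) + L2_norm m (\<lambda>x. g (x + y) - f x)"
      by (intro L2_norm_diff_triangle square_integrable_translate f gs)
    also have "L2_norm m (\<lambda>x. f (x + y) - g (x + y)) = L2_norm m (\<lambda>x. f x - g x)"
      using fg by (intro L2_norm_translate[of "\<lambda>x. f x - g x"]) (simp add: square_integrable_def)
    also have "L2_norm m (\<lambda>x. g (x + y) - f x) \<le> L2_norm m (\<lambda>x. g (x + y) - g x) + L2_norm m (\<lambda>x. g x - f x)"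
      by (intro L2_norm_diff_triangle square_integrable_translate f gs)
    also have "L2_norm m (\<lambda>x. g (x + y) - g x) \<le> e / 4"
      using square_integrable_diff[OF square_integrable_translate(1)[OF gs, of y] gs] V(3)[OF y] e
      by (intro L2_norm_le_sup) (auto simp: square_integrable_def)
    finally show "L2_norm m (\<lambda>x. f (x + y) - f x) < e"
      using g(2) e by (simp add: L2_norm_minus_commute[of m g])
  qed
qed

section \<open>Full support of the Haar measure and bump functions\<close>

lemma emeasure_open_pos:
  assumes U: "open U" "U \<noteq> {}"
  shows "emeasure m U > 0"
proof (rule ccontr)
  assume "\<not> emeasure m U > 0"
  then have 0: "emeasure m U = 0" by simp
  have op: "open ((\<lambda>x. - a + x) -` U)" for a
    using open_vimage[OF U(1) continuous_translate(1)] .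
  obtain u where u: "u \<in> U" using U by blast
  have "x \<in> (\<lambda>x'. - (x + - u) + x') -` U" for x
    using u by (simp add: minus_add add.assoc del: add_uminus_conv_diff)
  \<comment> \<open>By compactness finitely many translates of \<open>U\<close> cover the group. All
    have the measure of \<open>U\<close>, so a null \<open>U\<close> would make the whole group
    null.\<close>
  then have "UNIV \<subseteq> (\<Union>a\<in>UNIV. (\<lambda>x. - a + x) -` U)" by blast
  then obtain C where C: "finite C" "UNIV \<subseteq> (\<Union>a\<in>C. (\<lambda>x. - a + x) -` U)"
    using compactE_image[OF compact, of UNIV "\<lambda>a. (\<lambda>x. - a + x) -` U"] op by metis
  have "emeasure m ((\<lambda>x. - a + x) -` U) = emeasure m U" for a
    using emeasure_distr[OF measurable_translate(1)[of "- a"], of U] U by (simp add: distr_left)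
  then have "(\<Union>a\<in>C. (\<lambda>x. - a + x) -` U) \<in> null_sets m"
    using C(1) op 0 by (intro null_sets_UN' countable_finite) (auto simp: null_sets_def)
  moreover have "(\<Union>a\<in>C. (\<lambda>x. - a + x) -` U) = UNIV" using C by auto
  ultimately show False using emeasure_UNIV by (simp add: null_sets_def)
qed

lemma continuous_AE_zero:
  fixes f :: "'g \<Rightarrow> 'b::{real_normed_vector}"
  assumes f: "continuous_on UNIV f" and ae: "AE x in m. f x = 0"
  shows "f x = 0"
proof (rule ccontr)
  assume "f x \<noteq> 0"
  have "f -` (- {0}) = {x. f x \<noteq> 0}" by auto
  moreover have "open (f -` (- {0}))" using f by (intro open_vimage) auto
  ultimately have op: "open {x. f x \<noteq> 0}" by simp
  then have "emeasure m {x. f x \<noteq> 0} > 0" using \<open>f x \<noteq> 0\<close> by (intro emeasure_open_pos) auto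
  moreover have "emeasure m {x. f x \<noteq> 0} = 0" 
    using ae op by (subst (asm) AE_iff_measurable[of "{x. f x \<noteq> 0}"]) auto
  ultimately show False by simp
qed

lemma continuous_L2_norm_zero:
  assumes "continuous_on UNIV f" "L2_norm m f = 0"
  shows "f x = 0"
  using assms L2_norm_eq_0_iff[OF square_integrable_continuous] by (intro continuous_AE_zero) auto

text \<open>The symmetry is what makes convolution self-adjoint. The Urysohn function lives inside
  \<open>V\<close> and the set of inverses of \<open>V\<close>, so that both summands of its
  symmetrization vanish off \<open>V\<close>; full support makes the normalizing constant
  nonzero.\<close>

lemma bump:
  fixes V :: "'g set"
  assumes V: "open V" "0 \<in> V"
  obtains \<phi> :: "'g \<Rightarrow> real" where "continuous_on UNIV \<phi>" "\<And>x. 0 \<le> \<phi> x" "\<And>x. \<phi> (- x) = \<phi> x"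
    "\<And>x. x \<notin> V \<Longrightarrow> \<phi> x = 0" "(LINT x|m. \<phi> x) = 1"
proof -
  have o: "open (V \<inter> uminus -` V)" using V by (intro open_Int open_vimage continuous_translate)
  obtain h :: "'g \<Rightarrow> real" where h: "continuous_on UNIV h" "\<And>x. 0 \<le> h x" "\<And>x. h x \<le> 1"
    "\<And>x. x \<in> {0} \<Longrightarrow> h x = 1" "\<And>x. x \<notin> V \<inter> uminus -` V \<Longrightarrow> h x = 0"
    using Urysohn[OF closed_singleton[of 0] o] V by auto
  define k where "k x = h x + h (- x)" for x
  have k: "continuous_on UNIV k" unfolding k_def
    by (intro continuous_intros h continuous_on_compose2[OF h(1)]) auto
  have k0: "k x \<ge> 0" for x using h(2) by (simp add: k_def)
  define c where "c = (LINT x|m. k x)"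
  have "c \<noteq> 0"
  proof
    assume "c = 0"
    then have "AE x in m. k x = 0"
      unfolding c_def using integrable_continuous[OF k] k0 by (simp add: integral_nonneg_eq_0_iff_AE)
    then have "k 0 = 0" by (rule continuous_AE_zero[OF k])
    then show False using h(4)[of 0] by (simp add: k_def)
  qed
  moreover have "c \<ge> 0" unfolding c_def using k0 by simp
  ultimately have c: "c > 0" by simp
  show ?thesis
  proof (rule that[of "\<lambda>x. k x / c"])
    show "continuous_on UNIV (\<lambda>x. k x / c)" using c by (intro continuous_intros k) auto
    show "k (- x) / c = k x / c" for x by (simp add: k_def)
    show "x \<notin> V \<Longrightarrow> k x / c = 0" for x using h(5)[of x] h(5)[of "- x"] by (simp add: k_def)
    show "(LINT x|m. k x / c) = 1" using c by (simp flip: c_def)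
  qed (use k0 c in auto)
qed

end

section \<open>Convolution operators\<close>

text \<open>Quantization: real and imaginary parts are rounded to a grid of mesh
  \<open>\<delta> / 2\<close>, boundedness leaves finitely many cells, and one element of
  \<open>H\<close> is kept for every cell that occurs. The functionals will be point evaluations of
  convolutions in one use and Fourier coefficients in the other.\<close>

lemma finite_net_of_functionals:
  fixes c :: "'h \<Rightarrow> 'i \<Rightarrow> complex"
  assumes I: "finite I" and B: "\<And>h i. h \<in> H \<Longrightarrow> i \<in> I \<Longrightarrow> cmod (c h i) \<le> B" and \<delta>: "\<delta> > 0"
  obtains S where "finite S" "S \<subseteq> H" "\<And>h. h \<in> H \<Longrightarrow> \<exists>h'\<in>S. \<forall>i\<in>I. cmod (c h i - c h' i) < \<delta>"
proof -
  define d where "d = \<delta> / 2"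
  have d: "d > 0" using \<delta> by (simp add: d_def)
  define k where "k h = (\<lambda>i\<in>I. (\<lfloor>Re (c h i) / d\<rfloor>, \<lfloor>Im (c h i) / d\<rfloor>))" for h
  define M where "M = \<lceil>B / d\<rceil> + 1"
  have fl: "\<lfloor>x / d\<rfloor> \<in> {-M..M}" if "\<bar>x\<bar> \<le> B" for x
  proof -
    have "x / d \<le> B / d" "- (B / d) \<le> x / d" using that d by (auto simp: field_simps)
    then show ?thesis unfolding M_def by (simp add: floor_le_iff le_floor_iff) linarith
  qed
  have "k ` H \<subseteq> (\<Pi>\<^sub>E i\<in>I. {-M..M} \<times> {-M..M})"
  proof (intro image_subsetI PiE_I)
    fix h i assume h: "h \<in> H"
    show "k h i = undefined" if "i \<notin> I" using that by (simp add: k_def)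
    assume i: "i \<in> I"
    have "\<bar>Re (c h i)\<bar> \<le> B" "\<bar>Im (c h i)\<bar> \<le> B"
      using B[OF h i] abs_Re_le_cmod[of "c h i"] abs_Im_le_cmod[of "c h i"] by linarith+
    then show "k h i \<in> {-M..M} \<times> {-M..M}" using i fl by (simp add: k_def del: atLeastAtMost_iff)
  qed
  then have "finite (k ` H)" by (rule finite_subset) (intro finite_PiE I finite_cartesian_product, auto)
  then obtain S where S: "S \<subseteq> H" "finite S" "k ` H = k ` S" by (metis finite_subset_image order_refl)
  have fd: "\<bar>x - y\<bar> < d" if "\<lfloor>x / d\<rfloor> = \<lfloor>y / d\<rfloor>" for x y
  proof -
    have "\<bar>x / d - y / d\<bar> < 1" using that by linarith
    then show ?thesis using d by (simp add: field_simps flip: diff_divide_distrib)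
  qed
  show ?thesis
  proof (rule that[OF S(2,1)])
    fix h assume "h \<in> H"
    then obtain h' where h': "h' \<in> S" "k h = k h'" using S(3) by (metis imageE imageI)
    have "cmod (c h i - c h' i) < \<delta>" if "i \<in> I" for i
    proof -
      have "k h i = k h' i" using h' by simp
      then have "\<bar>Re (c h i) - Re (c h' i)\<bar> < d" "\<bar>Im (c h i) - Im (c h' i)\<bar> < d"
        using that fd by (auto simp: k_def)
      then show ?thesis using cmod_le[of "c h i - c h' i"] by (simp add: d_def)
    qed
    then show "\<exists>h'\<in>S. \<forall>i\<in>I. cmod (c h i - c h' i) < \<delta>" using h' by blast
  qed
qed

lemma L2_dist_classes:
  assumes "square_integrable m f" "square_integrable m g"
  shows "L2_dist m (L2_rel m `` {f}) (L2_rel m `` {g}) = L2_norm m (\<lambda>x. f x - g x)"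
proof -
  have "square_integrable m (class_rep (L2_rel m `` {f}))"
    using assms by (auto intro: class_rep_L2 L2_class_mem)
  then show ?thesis
    unfolding L2_dist_class_right[OF L2_class_mem[OF assms(1)] assms(2)]
    using class_rep_L2_class[OF assms(1)] assms
    by (intro L2_norm_cong_AE) (auto simp: square_integrable_def)
qed

text \<open>Passing to classes gives access to the sequential form of total boundedness;
  completeness then turns the Cauchy subsequence into a convergent one, with a limit that may lie
  outside \<open>R\<close>.\<close>

lemma L2_totally_bounded_convergent_subseq:
  assumes tb: "L2_totally_bounded m R" and R: "\<And>f. f \<in> R \<Longrightarrow> square_integrable m f"
    and \<sigma>: "\<And>n::nat. \<sigma> n \<in> R"
  obtains r g where "strict_mono r" "square_integrable m g"
    "(\<lambda>n. L2_norm m (\<lambda>x. \<sigma> (r n) x - g x)) \<longlonglongrightarrow> 0"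
proof -
  interpret Metric_space "L2 m" "L2_dist m" by (rule Metric_space_L2)
  define cl where "cl f = L2_rel m `` {f}" for f
  have cl: "cl f \<in> L2 m" if "f \<in> R" for f using R[OF that] by (simp add: cl_def L2_class_mem)
  have d: "L2_dist m (cl f) (cl g) = L2_norm m (\<lambda>x. f x - g x)" if "f \<in> R" "g \<in> R" for f g
    using R that by (simp add: cl_def L2_dist_classes)
  have "mtotally_bounded (cl ` R)"
    unfolding mtotally_bounded_def
  proof (intro allI impI)
    fix e :: real assume "e > 0"
    then have "\<exists>S. finite S \<and> S \<subseteq> R \<and> (\<forall>f\<in>R. \<exists>g\<in>S. L2_norm m (\<lambda>x. f x - g x) < e)"
      using tb by (simp add: L2_totally_bounded_def)
    then obtain S where S: "finite S" "S \<subseteq> R" "\<forall>f\<in>R. \<exists>g\<in>S. L2_norm m (\<lambda>x. f x - g x) < e"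
      by (elim exE conjE)
    have "cl ` R \<subseteq> (\<Union>F\<in>cl ` S. mball F e)"
    proof clarify
      fix f assume f: "f \<in> R"
      then obtain g where g: "g \<in> S" "L2_norm m (\<lambda>x. f x - g x) < e" using S by blast
      then have "cl f \<in> mball (cl g) e" using f S cl d[of f g] by (auto simp: commute)
      then show "cl f \<in> (\<Union>F\<in>cl ` S. mball F e)" using g by blast
    qed
    then show "\<exists>K. finite K \<and> K \<subseteq> cl ` R \<and> cl ` R \<subseteq> (\<Union>x\<in>K. mball x e)"
      using S by (intro exI[of _ "cl ` S"]) auto
  qed
  then have "\<exists>r. strict_mono r \<and> MCauchy ((\<lambda>n. cl (\<sigma> n)) \<circ> r)"
    unfolding mtotally_bounded_sequentially using \<sigma> by (auto simp: image_subset_iff)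
  then obtain r where r: "strict_mono r" "MCauchy (\<lambda>n. cl (\<sigma> (r n)))" by (auto simp: comp_def)
  have "\<exists>N. \<forall>n\<ge>N. \<forall>k\<ge>N. L2_norm m (\<lambda>x. \<sigma> (r n) x - \<sigma> (r k) x) < \<epsilon>" if "\<epsilon> > 0" for \<epsilon>
    using r(2) that \<sigma> unfolding MCauchy_def by (simp add: d)
  with L2_complete[of m "\<lambda>n. \<sigma> (r n)"] R[OF \<sigma>]
  obtain g where "square_integrable m g" "(\<lambda>n. L2_norm m (\<lambda>x. \<sigma> (r n) x - g x)) \<longlonglongrightarrow> 0"
    by blast
  then show ?thesis using r that by blast
qed

text \<open>Convolution of \<open>f\<close> with \<open>\<phi>\<close> on the right. The kernel
  depends only on \<open>- y + x\<close>, which is unchanged when \<open>x\<close> and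
  \<open>y\<close> are translated on the left by the same element, so the operator commutes with
  left translations. Substituting \<open>y = x + z\<close> shows an average of right translates of
  \<open>f\<close> when \<open>\<phi>\<close> is symmetric.\<close>

definition conv :: "'g::topological_group_add measure \<Rightarrow> ('g \<Rightarrow> real) \<Rightarrow> ('g \<Rightarrow> complex) \<Rightarrow> 'g \<Rightarrow> complex" where
  "conv m \<phi> f x = (LINT y|m. f y * complex_of_real (\<phi> (- y + x)))"

lemma conv_scale: "conv m \<phi> (\<lambda>x. c * f x) = (\<lambda>x. c * conv m \<phi> f x)"
  by (rule ext) (simp add: conv_def mult.assoc)

context compact_group
begin

section \<open>Convolution with a continuous kernel\<close>

lemma continuous_kernel_section:
  fixes \<phi> :: "'g \<Rightarrow> real"
  assumes "continuous_on UNIV \<phi>"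
  shows "continuous_on UNIV (\<lambda>y. complex_of_real (\<phi> (- y + x)))"
  by (intro continuous_intros continuous_on_compose2[OF assms]) auto

lemma square_integrable_kernel_section:
  fixes \<phi> :: "'g \<Rightarrow> real"
  assumes "continuous_on UNIV \<phi>"
  shows "square_integrable m (\<lambda>y. complex_of_real (\<phi> (- y + x)))"
  by (intro square_integrable_continuous continuous_kernel_section assms)

lemma conv_eq_ip: "conv m \<phi> f x = ip m f (\<lambda>y. complex_of_real (\<phi> (- y + x)))"
  by (simp add: conv_def ip_def)

lemma conv_diff:
  assumes \<phi>: "continuous_on UNIV \<phi>" and "square_integrable m f" "square_integrable m g"
  shows "conv m \<phi> (\<lambda>x. f x - g x) = (\<lambda>x. conv m \<phi> f x - conv m \<phi> g x)"
  using assms by (intro ext) (simp add: conv_eq_ip ip_diff_left square_integrable_kernel_section)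

lemma conv_add:
  assumes \<phi>: "continuous_on UNIV \<phi>" and "square_integrable m f" "square_integrable m g"
  shows "conv m \<phi> (\<lambda>x. f x + g x) = (\<lambda>x. conv m \<phi> f x + conv m \<phi> g x)"
  using assms by (intro ext) (simp add: conv_eq_ip ip_add_left square_integrable_kernel_section)

lemma conv_cong_AE:
  assumes \<phi>: "continuous_on UNIV \<phi>" and "AE x in m. f x = g x"
    and "f \<in> borel_measurable m" "g \<in> borel_measurable m"
  shows "conv m \<phi> f = conv m \<phi> g"
  using assms square_integrable_kernel_section[OF \<phi>]
  by (intro ext) (auto simp: conv_eq_ip square_integrable_def intro!: ip_cong_AE)

lemma conv_bound:
  assumes \<phi>: "continuous_on UNIV \<phi>" and B: "\<And>x. \<bar>\<phi> x\<bar> \<le> B" and f: "square_integrable m f"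
  shows "cmod (conv m \<phi> f x) \<le> L2_norm m f * B"
proof -
  have "0 \<le> B" using B[of 0] by linarith
  then have "L2_norm m (\<lambda>y. complex_of_real (\<phi> (- y + x))) \<le> B"
    using B by (intro L2_norm_le_sup measurable_continuous continuous_kernel_section \<phi>) auto
  then show ?thesis unfolding conv_eq_ip
    by (intro order_trans[OF Cauchy_Schwarz_ip] f square_integrable_kernel_section \<phi> mult_left_mono) auto
qed

text \<open>One neighbourhood serves all \<open>f\<close>, with the norm of \<open>f\<close> as a
  factor; this is the equicontinuity for the Arzela-Ascoli argument.\<close>

lemma conv_equicontinuous:
  assumes \<phi>: "continuous_on UNIV \<phi>" and e: "e > 0"
  obtains V where "open V" "x0 \<in> V"
    "\<And>x f. x \<in> V \<Longrightarrow> square_integrable m f \<Longrightarrow> cmod (conv m \<phi> f x - conv m \<phi> f x0) \<le> L2_norm m f * e"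
proof -
  define F where "F = (\<lambda>p. \<phi> (- snd p + fst p))"
  have "continuous_on (UNIV \<times> UNIV) F"
    unfolding F_def by (intro continuous_on_compose2[OF \<phi>] continuous_intros) auto
  from continuous_on_prod_compactE[OF this compact UNIV_I[of x0] e]
  obtain V where V: "x0 \<in> V" "open V" "\<forall>x\<in>V \<inter> UNIV. \<forall>y\<in>UNIV. dist (F (x, y)) (F (x0, y)) \<le> e"
    by blast
  show ?thesis
  proof (rule that[OF V(2,1)])
    fix x f assume x: "x \<in> V" and f: "square_integrable m f"
    let ?k = "\<lambda>x y. complex_of_real (\<phi> (- y + x))"
    have "conv m \<phi> f x - conv m \<phi> f x0 = ip m f (\<lambda>y. ?k x y - ?k x0 y)"
      unfolding conv_eq_ip by (intro ip_diff_right[symmetric] f square_integrable_kernel_section \<phi>)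
    moreover have "cmod (ip m f (\<lambda>y. ?k x y - ?k x0 y)) \<le> L2_norm m f * L2_norm m (\<lambda>y. ?k x y - ?k x0 y)"
      by (intro Cauchy_Schwarz_ip f square_integrable_diff square_integrable_kernel_section \<phi>)
    moreover have "L2_norm m (\<lambda>y. ?k x y - ?k x0 y) \<le> e"
    proof (rule L2_norm_le_sup)
      show "(\<lambda>y. ?k x y - ?k x0 y) \<in> borel_measurable m"
        by (intro measurable_continuous continuous_on_diff continuous_kernel_section \<phi>)
      fix y
      have "dist (F (x, y)) (F (x0, y)) \<le> e" using V(3) x by blast
      then show "cmod (?k x y - ?k x0 y) \<le> e"
        by (simp add: F_def dist_real_def flip: of_real_diff)
    qed (use e in simp)
    ultimately show "cmod (conv m \<phi> f x - conv m \<phi> f x0) \<le> L2_norm m f * e"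
      by (metis (no_types, lifting) L2_norm_nonneg mult_left_mono order_trans)
  qed
qed

text \<open>Over a compact second variable, joint continuity makes the sections of \<open>F\<close>
  vary continuously in the supremum norm. This supplies the continuity of convolutions and of the
  representation built from left translates.\<close>

lemma continuous_integral_kernel:
  fixes F :: "'g \<times> 'g \<Rightarrow> complex"
  assumes F: "continuous_on UNIV F" and f: "square_integrable m f"
  shows "continuous_on UNIV (\<lambda>a. ip m (\<lambda>x. F (a, x)) f)"
  unfolding continuous_on_def
proof (intro ballI tendstoI)
  fix a0 :: 'g and e :: real assume e: "e > 0"
  \<comment> \<open>Adding 1 avoids division by a vanishing norm.\<close>
  define d where "d = e / (L2_norm m f + 1)"
  have d: "d > 0" using e by (simp add: d_def add_nonneg_pos)
  have "L2_norm m f * d < (L2_norm m f + 1) * d" using d by simp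
  also have "\<dots> = e" using add_nonneg_pos[of "L2_norm m f" 1] by (simp add: d_def)
  finally have de: "d * L2_norm m f < e" by (simp add: mult.commute)
  have F': "continuous_on (UNIV \<times> UNIV) F" using F by simp
  obtain V where V: "a0 \<in> V" "open V" "\<forall>a\<in>V \<inter> UNIV. \<forall>x\<in>UNIV. dist (F (a, x)) (F (a0, x)) \<le> d"
    using continuous_on_prod_compactE[OF F' compact UNIV_I d] by blast
  have Fa: "continuous_on UNIV (\<lambda>x. F (a, x))" for a
    by (intro continuous_on_compose2[OF F] continuous_intros) auto
  have "dist (ip m (\<lambda>x. F (a, x)) f) (ip m (\<lambda>x. F (a0, x)) f) < e" if "a \<in> V" for a
  proof -
    have "ip m (\<lambda>x. F (a, x)) f - ip m (\<lambda>x. F (a0, x)) f = ip m (\<lambda>x. F (a, x) - F (a0, x)) f"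
      by (intro ip_diff_left[symmetric] square_integrable_continuous Fa f)
    moreover have "cmod (ip m (\<lambda>x. F (a, x) - F (a0, x)) f) \<le> L2_norm m (\<lambda>x. F (a, x) - F (a0, x)) * L2_norm m f"
      by (intro Cauchy_Schwarz_ip square_integrable_diff square_integrable_continuous Fa f)
    moreover have "L2_norm m (\<lambda>x. F (a, x) - F (a0, x)) \<le> d"
      using V(3) that d by (intro L2_norm_le_sup measurable_continuous continuous_on_diff Fa) (auto simp: dist_norm)
    then have "L2_norm m (\<lambda>x. F (a, x) - F (a0, x)) * L2_norm m f \<le> d * L2_norm m f"
      by (intro mult_right_mono) auto
    ultimately show ?thesis using de by (simp add: dist_norm)
  qed
  then show "\<forall>\<^sub>F a in at a0 within UNIV. dist (ip m (\<lambda>x. F (a, x)) f) (ip m (\<lambda>x. F (a0, x)) f) < e"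
    unfolding eventually_at_topological using V by blast
qed

lemma conv_continuous:
  assumes \<phi>: "continuous_on UNIV \<phi>" and f: "square_integrable m f"
  shows "continuous_on UNIV (conv m \<phi> f)"
proof -
  have "continuous_on UNIV (\<lambda>p. complex_of_real (\<phi> (- snd p + fst p)))"
    by (intro continuous_intros continuous_on_compose2[OF \<phi>]) auto
  from continuous_integral_kernel[OF this f]
  have "continuous_on UNIV (\<lambda>x. cnj (ip m (\<lambda>y. complex_of_real (\<phi> (- y + x))) f))"
    by (simp add: continuous_intros)
  then show ?thesis by (simp add: ip_cnj flip: conv_eq_ip)
qed

lemma square_integrable_conv:
  "continuous_on UNIV \<phi> \<Longrightarrow> square_integrable m f \<Longrightarrow> square_integrable m (conv m \<phi> f)"
  by (rule square_integrable_continuous, rule conv_continuous)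

lemma L2_norm_conv:
  assumes \<phi>: "continuous_on UNIV \<phi>" and B: "\<And>x. \<bar>\<phi> x\<bar> \<le> B" and f: "square_integrable m f"
  shows "L2_norm m (conv m \<phi> f) \<le> L2_norm m f * B"
proof (rule L2_norm_le_sup)
  show "conv m \<phi> f \<in> borel_measurable m" by (intro measurable_continuous conv_continuous \<phi> f)
  show "0 \<le> L2_norm m f * B" using B[of 0] by (intro mult_nonneg_nonneg) auto
qed (rule conv_bound[OF \<phi> B f])

lemma conv_left_translate:
  assumes \<phi>: "continuous_on UNIV \<phi>" and f: "f \<in> borel_measurable m"
  shows "conv m \<phi> (\<lambda>y. f (a + y)) x = conv m \<phi> f (a + x)"
proof -
  have [measurable]: "f \<in> borel_measurable m" "(\<lambda>y. complex_of_real (\<phi> (- y + (a + x)))) \<in> borel_measurable m"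
    using f by (auto intro!: measurable_continuous continuous_kernel_section \<phi> simp del: sets_haar)
  have "conv m \<phi> f (a + x) = (LINT y|m. f (a + y) * complex_of_real (\<phi> (- (a + y) + (a + x))))"
    unfolding conv_def
    by (rule integral_left[of "\<lambda>y. f y * complex_of_real (\<phi> (- y + (a + x)))", symmetric]) measurable
  moreover have "- (a + y) + (a + x) = - y + x" for y
    by (simp only: minus_add add.assoc minus_add_cancel add_minus_cancel)
  ultimately show ?thesis by (simp add: conv_def)
qed

lemma conv_shift:
  assumes \<phi>: "continuous_on UNIV \<phi>" and sym: "\<And>x. \<phi> (- x) = \<phi> x" and f: "f \<in> borel_measurable m"
  shows "conv m \<phi> f x = (LINT z|m. f (x + z) * complex_of_real (\<phi> z))"
proof -
  have [measurable]: "f \<in> borel_measurable m" "(\<lambda>y. complex_of_real (\<phi> (- y + x))) \<in> borel_measurable m"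
    using f by (auto intro!: measurable_continuous continuous_kernel_section \<phi> simp del: sets_haar)
  have "conv m \<phi> f x = (LINT z|m. f (x + z) * complex_of_real (\<phi> (- (x + z) + x)))"
    unfolding conv_def
    by (rule integral_left[of "\<lambda>y. f y * complex_of_real (\<phi> (- y + x))", symmetric]) measurable
  then show ?thesis by (simp add: minus_add add.assoc sym)
qed

text \<open>The kernel is real, and symmetric because
  \<open>\<phi> (- x + y) = \<phi> (- y + x)\<close>. Since it is also continuous, the integrals may
  be interchanged although \<open>f\<close> and \<open>g\<close> are merely square
  integrable.\<close>

lemma conv_self_adjoint:
  assumes \<phi>: "continuous_on UNIV \<phi>" and sym: "\<And>x. \<phi> (- x) = \<phi> x"
    and f: "square_integrable m f" and g: "square_integrable m g"
  shows "ip m (conv m \<phi> f) g = ip m f (conv m \<phi> g)"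
proof -
  define F where "F = (\<lambda>p. complex_of_real (\<phi> (- snd p + fst p)))"
  have F: "continuous_on UNIV F"
    unfolding F_def by (intro continuous_intros continuous_on_compose2[OF \<phi>]) auto
  have "ip m (conv m \<phi> f) g = (LINT x|m. LINT y|m. cnj (g x) * F (x, y) * f y)"
    unfolding ip_def conv_def F_def by (simp add: mult_ac flip: integral_mult_right_zero integral_mult_left_zero)
  also have "\<dots> = (LINT y|m. LINT x|m. cnj (g x) * F (x, y) * f y)"
    using integrable_square_integrable[OF square_integrable_cnj[OF g]] integrable_square_integrable[OF f]
    by (intro Fubini_kernel[OF F])
  also have "\<dots> = (LINT y|m. f y * cnj (conv m \<phi> g y))"
  proof (rule Bochner_Integration.integral_cong[OF refl])
    fix y
    have "\<phi> (- x + y) = \<phi> (- y + x)" for x using sym[of "- y + x"] by (simp add: minus_add)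
    then have "cnj (conv m \<phi> g y) = (LINT x|m. cnj (g x) * F (x, y))"
      unfolding conv_def F_def by (subst Bochner_Integration.integral_cnj[symmetric]) simp
    then show "(LINT x|m. cnj (g x) * F (x, y) * f y) = f y * cnj (conv m \<phi> g y)"
      by (simp add: mult.commute)
  qed
  finally show ?thesis by (simp add: ip_def)
qed

text \<open>Arzela-Ascoli by hand: equicontinuity reduces the supremum norm to the values at
  finitely many points, and these are bounded scalars, for which a finite net exists.\<close>

lemma conv_totally_bounded:
  assumes \<phi>: "continuous_on UNIV \<phi>" and R: "\<And>f. f \<in> R \<Longrightarrow> square_integrable m f"
    and C: "\<And>f. f \<in> R \<Longrightarrow> L2_norm m f \<le> C" and e: "e > 0"
  obtains S where "finite S" "S \<subseteq> R"
    "\<And>f. f \<in> R \<Longrightarrow> \<exists>g\<in>S. \<forall>x. cmod (conv m \<phi> f x - conv m \<phi> g x) < e"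
proof (cases "R = {}")
  case False
  then have C0: "C \<ge> 0" using C L2_norm_nonneg by (meson all_not_in_conv order_trans)
  \<comment> \<open>With this \<open>d\<close> every convolution of a member of \<open>R\<close>
    oscillates by at most \<open>e / 4\<close> near each point; \<open>C + 1\<close> avoids division
    by 0.\<close>
  define d where "d = e / (4 * (C + 1))"
  have d: "d > 0" using e C0 by (simp add: d_def)
  have Cd: "C * d \<le> e / 4" using e C0 by (simp add: d_def field_simps)
  have "\<exists>V. open V \<and> x0 \<in> V \<and> (\<forall>x\<in>V. \<forall>f\<in>R. cmod (conv m \<phi> f x - conv m \<phi> f x0) \<le> e / 4)" for x0
  proof -
    obtain V where V: "open V" "x0 \<in> V"
      "\<And>x f. x \<in> V \<Longrightarrow> square_integrable m f \<Longrightarrow> cmod (conv m \<phi> f x - conv m \<phi> f x0) \<le> L2_norm m f * d"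
      using conv_equicontinuous[OF \<phi> d] by blast
    have "cmod (conv m \<phi> f x - conv m \<phi> f x0) \<le> e / 4" if "x \<in> V" "f \<in> R" for x f
      using V(3)[OF that(1) R[OF that(2)]] mult_right_mono[OF C[OF that(2)], of d] d Cd by linarith
    then show ?thesis using V by blast
  qed
  then obtain V where V: "\<And>x0. open (V x0)" "\<And>x0. x0 \<in> V x0"
    "\<And>x0 x f. x \<in> V x0 \<Longrightarrow> f \<in> R \<Longrightarrow> cmod (conv m \<phi> f x - conv m \<phi> f x0) \<le> e / 4" by metis
  obtain X where X: "finite X" "UNIV \<subseteq> (\<Union>x\<in>X. V x)"
    by (rule compactE_image[OF compact, of UNIV V]) (use V in auto)
  obtain B where B: "B > 0" "\<And>x. norm (\<phi> x) \<le> B" using continuous_bounded[OF \<phi>] by blast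
  have bd: "cmod (conv m \<phi> f x) \<le> C * B" if "f \<in> R" for f x
    using conv_bound[OF \<phi>, of B f x] R[OF that] C[OF that] B
    by (auto intro: order_trans mult_right_mono)
  have e4: "e / 4 > 0" using e by simp
  obtain S where S: "finite S" "S \<subseteq> R"
      "\<And>f. f \<in> R \<Longrightarrow> \<exists>g\<in>S. \<forall>x\<in>X. cmod (conv m \<phi> f x - conv m \<phi> g x) < e / 4"
    using finite_net_of_functionals[OF X(1), of R "conv m \<phi>" "C * B", OF bd e4] by blast
  show ?thesis
  proof (rule that[OF S(1,2)])
    fix f assume f: "f \<in> R"
    obtain g where g: "g \<in> S" "\<forall>x\<in>X. cmod (conv m \<phi> f x - conv m \<phi> g x) < e / 4" using S(3)[OF f] by blast
    have "cmod (conv m \<phi> f x - conv m \<phi> g x) < e" for x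
    proof -
      obtain x0 where x0: "x0 \<in> X" "x \<in> V x0" using X by blast
      have "cmod (conv m \<phi> f x - conv m \<phi> f x0) \<le> e / 4" "cmod (conv m \<phi> g x - conv m \<phi> g x0) \<le> e / 4"
        "cmod (conv m \<phi> f x0 - conv m \<phi> g x0) < e / 4"
        using V(3)[OF x0(2)] f g S(2) x0 by auto
      moreover have tri: "cmod (a - d) \<le> cmod (a - b) + cmod (b - c) + cmod (d - c)" for a b c d :: complex
        using norm_triangle_ineq[of "a - b" "b - c"] norm_triangle_ineq4[of "a - b + (b - c)" "d - c"] by simp
      ultimately show ?thesis
        using e tri[where a = "conv m \<phi> f x" and b = "conv m \<phi> f x0" and c = "conv m \<phi> g x0" and d = "conv m \<phi> g x"]
        by linarith
    qed
    then show "\<exists>g\<in>S. \<forall>x. cmod (conv m \<phi> f x - conv m \<phi> g x) < e" using g by blast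
  qed
qed (use that in auto)

section \<open>Convolution as an approximate identity\<close>

lemma conv_approx_continuous:
  assumes \<phi>: "continuous_on UNIV \<phi>" "\<And>x. 0 \<le> \<phi> x" "\<And>x. \<phi> (- x) = \<phi> x"
    "\<And>x. x \<notin> V \<Longrightarrow> \<phi> x = 0" "(LINT x|m. \<phi> x) = 1"
    and f: "continuous_on UNIV f" and e: "e \<ge> 0"
    and V: "\<And>y. y \<in> V \<Longrightarrow> L2_norm m (\<lambda>x. f (x + y) - f x) \<le> e"
  shows "L2_norm m (\<lambda>x. conv m \<phi> f x - f x) \<le> e"
proof -
  have fxz: "continuous_on UNIV (\<lambda>z. f (x + z))" "continuous_on UNIV (\<lambda>z. f (z + x))" for x
    by (intro continuous_on_compose2[OF f] continuous_intros; simp)+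
  define P where "P x z = (cmod (f (x + z) - f x))\<^sup>2 * \<phi> z" for x z
  have Pc: "continuous_on UNIV (P x)" "continuous_on UNIV (\<lambda>x. P x z)" for x z
    unfolding P_def by (intro continuous_intros fxz f \<phi>)+
  \<comment> \<open>\<open>\<phi>\<close> is a probability density, so Cauchy-Schwarz with the
    factor \<open>sqrt (\<phi> z)\<close> split off gives Jensen's inequality for the square.
    Continuity of \<open>f\<close> makes \<open>P\<close> jointly continuous, which permits the
    interchange of integrals that follows.\<close>
  have pw: "(cmod (conv m \<phi> f x - f x))\<^sup>2 \<le> (LINT z|m. P x z)" for x
  proof -
    let ?h = "\<lambda>z. (f (x + z) - f x) * complex_of_real (sqrt (\<phi> z))"
    let ?k = "\<lambda>z. complex_of_real (sqrt (\<phi> z))"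
    have c: "continuous_on UNIV ?h" "continuous_on UNIV ?k"
      by (intro continuous_intros fxz \<phi>)+
    have i: "integrable m (\<lambda>z. f (x + z) * complex_of_real (\<phi> z))" "integrable m (\<lambda>z. f x * complex_of_real (\<phi> z))"
      by (intro integrable_continuous continuous_intros fxz \<phi>)+
    have "f x = (LINT z|m. f x * complex_of_real (\<phi> z))" using \<phi>(5) by simp
    then have "conv m \<phi> f x - f x = (LINT z|m. f (x + z) * complex_of_real (\<phi> z)) - (LINT z|m. f x * complex_of_real (\<phi> z))"
      using conv_shift[OF \<phi>(1,3) measurable_continuous[OF f], of x] by simp
    also have "\<dots> = (LINT z|m. (f (x + z) - f x) * complex_of_real (\<phi> z))"
      using i by (subst Bochner_Integration.integral_diff[symmetric]) (auto simp: left_diff_distrib)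
    also have "\<dots> = ip m ?h ?k"
      unfolding ip_def using \<phi>(2) by (simp add: mult.assoc flip: of_real_mult)
    finally have "cmod (conv m \<phi> f x - f x) \<le> L2_norm m ?h * L2_norm m ?k"
      using Cauchy_Schwarz_ip[OF square_integrable_continuous[OF c(1)] square_integrable_continuous[OF c(2)]] by simp
    also have "L2_norm m ?k = 1" using \<phi>(2,5) by (simp add: L2_norm_def)
    finally have "(cmod (conv m \<phi> f x - f x))\<^sup>2 \<le> (L2_norm m ?h)\<^sup>2" by (intro power_mono) auto
    also have "\<dots> = (LINT z|m. P x z)"
      unfolding L2_norm_power2 P_def using \<phi>(2) by (simp add: norm_mult power_mult_distrib)
    finally show ?thesis .
  qed
  have F: "continuous_on UNIV (\<lambda>p. complex_of_real (P (fst p) (snd p)))"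
    unfolding P_def
    by (intro continuous_intros continuous_on_compose2[OF f] continuous_on_compose2[OF \<phi>(1)]) auto
  have "complex_of_real (LINT x|m. LINT z|m. P x z) = (LINT x|m. LINT z|m. complex_of_real (P x z))" by simp
  also have "\<dots> = (LINT z|m. LINT x|m. complex_of_real (P x z))" using Fubini_continuous[OF F] by simp
  also have "\<dots> = complex_of_real (LINT z|m. LINT x|m. P x z)" by simp
  finally have sw: "(LINT x|m. LINT z|m. P x z) = (LINT z|m. LINT x|m. P x z)" by (simp only: of_real_eq_iff)
  \<comment> \<open>The support condition enters here: the translation error is bounded only for
    \<open>z \<in> V\<close>, and elsewhere the weight is 0.\<close>
  have inner: "(LINT x|m. P x z) \<le> e\<^sup>2 * \<phi> z" for z
  proof (cases "z \<in> V")
    case True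
    have "(LINT x|m. P x z) = (L2_norm m (\<lambda>x. f (x + z) - f x))\<^sup>2 * \<phi> z"
      by (simp add: P_def L2_norm_power2)
    also have "\<dots> \<le> e\<^sup>2 * \<phi> z" using V[OF True] \<phi>(2) by (intro mult_right_mono power_mono) auto
    finally show ?thesis .
  qed (use \<phi>(4) in \<open>simp add: P_def\<close>)
  have sq: "square_integrable m (\<lambda>x. conv m \<phi> f x - f x)"
    by (intro square_integrable_diff square_integrable_conv square_integrable_continuous f \<phi>(1))
  have Fm: "(\<lambda>p. P (fst p) (snd p)) \<in> borel_measurable (m \<Otimes>\<^sub>M m)"
    using measurable_compose[OF measurable_kernel[OF F] borel_measurable_Re] by simp
  have "(LINT x|m. (cmod (conv m \<phi> f x - f x))\<^sup>2) \<le> (LINT x|m. LINT z|m. P x z)"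
  proof (rule integral_mono)
    show "integrable m (\<lambda>x. LINT z|m. P x z)"
    proof -
      obtain C where C: "\<And>p. norm (complex_of_real (P (fst p) (snd p))) \<le> C"
      proof -
        have "compact (UNIV :: ('g \<times> 'g) set)" using compact_Times[OF compact compact] by simp
        then have "bounded (range (\<lambda>p. complex_of_real (P (fst p) (snd p))))"
          using F by (intro compact_imp_bounded compact_continuous_image)
        then show ?thesis using that by (auto simp: bounded_iff)
      qed
      have "integrable (m \<Otimes>\<^sub>M m) (\<lambda>p. P (fst p) (snd p))"
      proof -
        interpret P: pair_sigma_finite m m ..
        interpret Q: finite_measure "m \<Otimes>\<^sub>M m"
          by standard (simp add: space_pair_measure emeasure_pair_measure_Times flip: UNIV_Times_UNIV)
        show ?thesis using C Fm by (intro Q.integrable_const_bound[of _ C]) auto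
      qed
      then show ?thesis using pair_sigma_finite.integrable_fst'[of m m "\<lambda>p. P (fst p) (snd p)"]
        by (simp add: pair_sigma_finite_def sigma_finite_measure_axioms)
    qed
  qed (use pw sq in \<open>auto simp: square_integrable_def\<close>)
  also have "\<dots> = (LINT z|m. LINT x|m. P x z)" by (rule sw)
  also have "\<dots> \<le> (LINT z|m. e\<^sup>2 * \<phi> z)"
    by (rule integral_mono_AE') (use inner \<phi> in \<open>auto intro!: integrable_continuous continuous_intros simp: P_def\<close>)
  also have "\<dots> = e\<^sup>2" using \<phi>(5) by simp
  finally have "(L2_norm m (\<lambda>x. conv m \<phi> f x - f x))\<^sup>2 \<le> e\<^sup>2" by (simp add: L2_norm_power2)
  then show ?thesis using e by (rule power2_le_imp_le)
qed

theorem conv_approx: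
  assumes \<phi>: "continuous_on UNIV \<phi>" "\<And>x. 0 \<le> \<phi> x" "\<And>x. \<phi> (- x) = \<phi> x"
    "\<And>x. x \<notin> V \<Longrightarrow> \<phi> x = 0" "(LINT x|m. \<phi> x) = 1"
    and f: "square_integrable m f" and e: "e \<ge> 0"
    and V: "\<And>y. y \<in> V \<Longrightarrow> L2_norm m (\<lambda>x. f (x + y) - f x) \<le> e"
  shows "L2_norm m (\<lambda>x. conv m \<phi> f x - f x) \<le> e"
proof (rule field_le_epsilon)
  fix \<eta> :: real assume \<eta>: "\<eta> > 0"
  obtain B where B: "B > 0" "\<And>x. norm (\<phi> x) \<le> B" using continuous_bounded[OF \<phi>(1)] by blast
  \<comment> \<open>Replacing \<open>f\<close> by \<open>g\<close> costs \<open>d * B\<close> under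
    convolution, \<open>2 * d\<close> in the translation error of \<open>g\<close>, and
    \<open>d\<close> in the final comparison: altogether \<open>\<eta>\<close>.\<close>
  define d where "d = \<eta> / (B + 3)"
  have d: "d > 0" using B \<eta> by (simp add: d_def)
  obtain g where g: "continuous_on UNIV g" and fg: "L2_norm m (\<lambda>x. f x - g x) < d"
    using continuous_dense[OF f d] by blast
  have gs: "square_integrable m g" by (rule square_integrable_continuous[OF g])
  have fgs: "square_integrable m (\<lambda>x. f x - g x)" by (rule square_integrable_diff[OF f gs])
  have "L2_norm m (\<lambda>x. conv m \<phi> g x - g x) \<le> e + 2 * d"
  proof (rule conv_approx_continuous[OF \<phi> g])
    fix y assume y: "y \<in> V"
    have "L2_norm m (\<lambda>x. g (x + y) - g x) \<le> L2_norm m (\<lambda>x. g (x + y) - f (x + y)) + L2_norm m (\<lambda>x. f (x + y) - g x)"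
      by (intro L2_norm_diff_triangle square_integrable_translate f gs)
    also have "L2_norm m (\<lambda>x. g (x + y) - f (x + y)) = L2_norm m (\<lambda>x. f (x + y) - g (x + y))"
      by (rule L2_norm_minus_commute)
    also have "L2_norm m (\<lambda>x. f (x + y) - g (x + y)) = L2_norm m (\<lambda>x. f x - g x)"
      using fgs by (intro L2_norm_translate[of "\<lambda>x. f x - g x"]) (simp add: square_integrable_def)
    also have "L2_norm m (\<lambda>x. f (x + y) - g x) \<le> L2_norm m (\<lambda>x. f (x + y) - f x) + L2_norm m (\<lambda>x. f x - g x)"
      by (intro L2_norm_diff_triangle square_integrable_translate f gs)
    finally show "L2_norm m (\<lambda>x. g (x + y) - g x) \<le> e + 2 * d" using V[OF y] fg by linarith
  qed (use e d in auto)
  moreover have "L2_norm m (\<lambda>x. conv m \<phi> f x - f x)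
      \<le> L2_norm m (\<lambda>x. conv m \<phi> f x - conv m \<phi> g x) + L2_norm m (\<lambda>x. conv m \<phi> g x - f x)"
    by (intro L2_norm_diff_triangle square_integrable_conv f gs \<phi>(1))
  moreover have "L2_norm m (\<lambda>x. conv m \<phi> g x - f x)
      \<le> L2_norm m (\<lambda>x. conv m \<phi> g x - g x) + L2_norm m (\<lambda>x. g x - f x)"
    by (intro L2_norm_diff_triangle square_integrable_conv f gs \<phi>(1))
  moreover have "L2_norm m (\<lambda>x. conv m \<phi> f x - conv m \<phi> g x) \<le> L2_norm m (\<lambda>x. f x - g x) * B"
    using L2_norm_conv[OF \<phi>(1) _ fgs, of B] B by (simp add: conv_diff[OF \<phi>(1) f gs])
  moreover have "L2_norm m (\<lambda>x. f x - g x) * B \<le> d * B"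
    using fg B(1) by (intro mult_right_mono) auto
  moreover have "d * (B + 3) = \<eta>" using B(1) by (simp add: d_def)
  then have "d * B + 3 * d = \<eta>" by (simp add: algebra_simps)
  ultimately show "L2_norm m (\<lambda>x. conv m \<phi> f x - f x) \<le> e + \<eta>"
    using fg by (simp add: L2_norm_minus_commute[of m g])
qed

end

section \<open>Schur orthogonality\<close>

lemma index_mat_adjoint:
  "i < dim_col A \<Longrightarrow> j < dim_row A \<Longrightarrow> mat_adjoint A $$ (i, j) = conjugate (A $$ (j, i))"
  by (simp add: mat_adjoint_def mat_of_rows_index)

lemma mat_adjoint_carrier: "A \<in> carrier_mat n k \<Longrightarrow> mat_adjoint A \<in> carrier_mat k n"
  unfolding mat_adjoint_def carrier_mat_def by auto

lemma index_mult_mat_sum: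
  "A \<in> carrier_mat n k \<Longrightarrow> B \<in> carrier_mat k l \<Longrightarrow> i < n \<Longrightarrow> j < l \<Longrightarrow>
    (A * B) $$ (i, j) = (\<Sum>a<k. A $$ (i, a) * B $$ (a, j))"
  by (auto simp: scalar_prod_def lessThan_atLeast0 intro!: sum.cong)

lemma subspace_vecI:
  assumes "W \<subseteq> carrier_vec n" "0\<^sub>v n \<in> W" "\<And>v w. v \<in> W \<Longrightarrow> w \<in> W \<Longrightarrow> v + w \<in> W"
    "\<And>c v. v \<in> W \<Longrightarrow> c \<cdot>\<^sub>v v \<in> W"
  shows "VectorSpace.subspace class_ring W (module_vec TYPE(complex) n)"
  unfolding VectorSpace.subspace_def LinearCombinations.submodule_def
  using assms vec_vs[of n] vec_module[of n] by (auto simp: module_vec_simps)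

lemma subspace_vecD:
  assumes "VectorSpace.subspace class_ring W (module_vec TYPE(complex) n)"
  shows "W \<subseteq> carrier_vec n" "0\<^sub>v n \<in> W" "\<And>v w. v \<in> W \<Longrightarrow> w \<in> W \<Longrightarrow> v + w \<in> W"
    "\<And>c v. v \<in> W \<Longrightarrow> c \<cdot>\<^sub>v v \<in> W"
  using assms unfolding VectorSpace.subspace_def LinearCombinations.submodule_def
  by (auto simp: module_vec_simps)

lemma unitary_repD:
  assumes "unitary_rep U"
  shows "U x \<in> carrier_mat (rep_dim U) (rep_dim U)" "U (x + y) = U x * U y"
    "mat_adjoint (U x) * U x = 1\<^sub>m (rep_dim U)"
    "i < rep_dim U \<Longrightarrow> j < rep_dim U \<Longrightarrow> continuous_on UNIV (\<lambda>x. U x $$ (i, j))"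
  using assms by (auto simp: unitary_rep_def unitary_mat_def)

text \<open>\<open>U 0\<close> is idempotent and has a left inverse, hence is the identity.\<close>

lemma unitary_rep_zero:
  assumes U: "unitary_rep U"
  shows "U 0 = 1\<^sub>m (rep_dim U)"
proof -
  note c = unitary_repD(1)[OF U, of 0]
  have "U 0 = (mat_adjoint (U 0) * U 0) * U 0"
    using c by (simp add: unitary_repD(3)[OF U])
  also have "\<dots> = mat_adjoint (U 0) * (U 0 * U 0)"
    by (rule assoc_mult_mat[OF mat_adjoint_carrier[OF c] c c])
  also have "U 0 * U 0 = U 0" using unitary_repD(2)[OF U, of 0 0] by simp
  finally show ?thesis by (simp add: unitary_repD(3)[OF U])
qed

lemma unitary_rep_uminus:
  assumes U: "unitary_rep U"
  shows "U (- x) = mat_adjoint (U x)"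
proof -
  note c = unitary_repD(1)[OF U]
  have "U (- x) = (mat_adjoint (U x) * U x) * U (- x)"
    using c[of "- x"] by (simp add: unitary_repD(3)[OF U])
  also have "\<dots> = mat_adjoint (U x) * (U x * U (- x))"
    by (rule assoc_mult_mat[OF mat_adjoint_carrier[OF c] c c])
  also have "U x * U (- x) = 1\<^sub>m (rep_dim U)"
    using unitary_repD(2)[OF U, of x "- x"] unitary_rep_zero[OF U] by simp
  finally show ?thesis using mat_adjoint_carrier[OF c[of x]] by simp
qed

lemma unitary_rep_uminus_index:
  assumes U: "unitary_rep U" and "i < rep_dim U" "j < rep_dim U"
  shows "U (- x) $$ (i, j) = cnj (U x $$ (j, i))"
  using assms unitary_repD(1)[OF U, of x] by (simp add: unitary_rep_uminus index_mat_adjoint)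

lemma unitary_rep_add_index:
  assumes U: "unitary_rep U" and "i < rep_dim U" "j < rep_dim U"
  shows "U (x + y) $$ (i, j) = (\<Sum>k<rep_dim U. U x $$ (i, k) * U y $$ (k, j))"
  unfolding unitary_repD(2)[OF U]
  by (rule index_mult_mat_sum[OF unitary_repD(1)[OF U] unitary_repD(1)[OF U] assms(2,3)])

lemma unitary_rep_orthonormal_columns:
  assumes U: "unitary_rep U" and ij: "i < rep_dim U" "j < rep_dim U"
  shows "(\<Sum>k<rep_dim U. U x $$ (k, i) * cnj (U x $$ (k, j))) = (if i = j then 1 else 0)"
proof -
  note c = unitary_repD(1)[OF U, of x]
  have "(mat_adjoint (U x) * U x) $$ (j, i) = (\<Sum>k<rep_dim U. mat_adjoint (U x) $$ (j, k) * U x $$ (k, i))"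
    by (rule index_mult_mat_sum[OF mat_adjoint_carrier[OF c] c ij(2,1)])
  also have "\<dots> = (\<Sum>k<rep_dim U. U x $$ (k, i) * cnj (U x $$ (k, j)))"
    using c ij by (intro sum.cong) (auto simp: index_mat_adjoint)
  finally show ?thesis using ij by (cases "i = j") (simp_all add: unitary_repD(3)[OF U])
qed

lemma irreducible_unitary_repD:
  assumes "irreducible_unitary_rep U"
  shows "unitary_rep U" "rep_dim U > 0"
    "\<And>W. VectorSpace.subspace class_ring W (module_vec TYPE(complex) (rep_dim U)) \<Longrightarrow>
       (\<And>x v. v \<in> W \<Longrightarrow> U x *\<^sub>v v \<in> W) \<Longrightarrow> W = {0\<^sub>v (rep_dim U)} \<or> W = carrier_vec (rep_dim U)"
proof -
  show "unitary_rep U" "rep_dim U > 0" using assms by (auto simp: irreducible_unitary_rep_def)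
  fix W assume "VectorSpace.subspace class_ring W (module_vec TYPE(complex) (rep_dim U))"
    "\<And>x v. v \<in> W \<Longrightarrow> U x *\<^sub>v v \<in> W"
  then show "W = {0\<^sub>v (rep_dim U)} \<or> W = carrier_vec (rep_dim U)"
    using assms by (simp add: irreducible_unitary_rep_def)
qed

text \<open>Over the complex numbers \<open>A\<close> has an eigenvalue. Its eigenspace is invariant
  because \<open>A\<close> commutes with every \<open>U x\<close>, and nonzero, hence
  everything.\<close>

lemma Schur_scalar:
  assumes U: "irreducible_unitary_rep U" and A: "A \<in> carrier_mat (rep_dim U) (rep_dim U)"
    and comm: "\<And>x. U x * A = A * U x"
  obtains c where "A = c \<cdot>\<^sub>m 1\<^sub>m (rep_dim U)"
proof -
  define d where "d = rep_dim U"
  note irr = irreducible_unitary_repD[OF U, folded d_def]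
  note Uc = unitary_repD(1)[OF irr(1), folded d_def]
  have A: "A \<in> carrier_mat d d" using A by (simp add: d_def)
  obtain c where "eigenvalue A c" using spectrum_non_empty[OF A irr(2)] by (auto simp: spectrum_def)
  then obtain v where v: "v \<in> carrier_vec d" "v \<noteq> 0\<^sub>v d" "A *\<^sub>v v = c \<cdot>\<^sub>v v"
    using A by (auto simp: eigenvalue_def eigenvector_def)
  define W where "W = {v \<in> carrier_vec d. A *\<^sub>v v = c \<cdot>\<^sub>v v}"
  have "VectorSpace.subspace class_ring W (module_vec TYPE(complex) d)"
  proof (rule subspace_vecI)
    show "v + w \<in> W" if "v \<in> W" "w \<in> W" for v w
      using that A by (auto simp: W_def mult_add_distrib_mat_vec smult_add_distrib_vec)
    show "a \<cdot>\<^sub>v v \<in> W" if "v \<in> W" for a v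
      using that A by (auto simp: W_def mult_mat_vec smult_smult_assoc mult.commute)
  qed (use A in \<open>auto simp: W_def\<close>)
  moreover have "U x *\<^sub>v v \<in> W" if "v \<in> W" for x v
  proof -
    have v: "v \<in> carrier_vec d" "A *\<^sub>v v = c \<cdot>\<^sub>v v" using that by (auto simp: W_def)
    have "A *\<^sub>v (U x *\<^sub>v v) = (A * U x) *\<^sub>v v" by (rule assoc_mult_mat_vec[OF A Uc v(1), symmetric])
    also have "\<dots> = U x *\<^sub>v (A *\<^sub>v v)" unfolding comm[symmetric] by (rule assoc_mult_mat_vec[OF Uc A v(1)])
    also have "\<dots> = c \<cdot>\<^sub>v (U x *\<^sub>v v)" unfolding v(2) by (rule mult_mat_vec[OF Uc v(1)])
    finally show ?thesis using mult_mat_vec_carrier[OF Uc v(1)] by (simp add: W_def)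
  qed
  ultimately have "W = {0\<^sub>v d} \<or> W = carrier_vec d" by (rule irr(3))
  moreover have "v \<in> W" using v by (simp add: W_def)
  ultimately have W: "W = carrier_vec d" using v by auto
  have "A = c \<cdot>\<^sub>m 1\<^sub>m d"
  proof (rule eq_matI)
    fix i j assume "i < dim_row (c \<cdot>\<^sub>m 1\<^sub>m d :: complex mat)" "j < dim_col (c \<cdot>\<^sub>m 1\<^sub>m d :: complex mat)"
    then have ij: "i < d" "j < d" by auto
    have "unit_vec d j \<in> W" using W ij by simp
    then have "A *\<^sub>v unit_vec d j = c \<cdot>\<^sub>v unit_vec d j" by (simp add: W_def)
    then have "vec_index (A *\<^sub>v unit_vec d j) i = c * vec_index (unit_vec d j) i" using ij by simp
    then show "A $$ (i, j) = (c \<cdot>\<^sub>m 1\<^sub>m d) $$ (i, j)" using ij A by simp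
  qed (use A in auto)
  then show ?thesis using that d_def by blast
qed

section \<open>The orthogonality relations for matrix coefficients\<close>

context compact_group
begin

lemma continuous_coefficient:
  assumes "irreducible_unitary_rep U" "i < rep_dim U" "j < rep_dim U"
  shows "continuous_on UNIV (\<lambda>x::'g. U x $$ (i, j))"
  using unitary_repD(4)[OF irreducible_unitary_repD(1)[OF assms(1)] assms(2,3)] .

lemma square_integrable_coefficient:
  assumes "irreducible_unitary_rep U" "i < rep_dim U" "j < rep_dim U"
  shows "square_integrable m (\<lambda>x. U x $$ (i, j))"
  by (intro square_integrable_continuous continuous_coefficient assms)

text \<open>\<open>A\<close> is the integral over \<open>x\<close> of
  \<open>U x * E * mat_adjoint (V x)\<close>, where \<open>E\<close> is the matrix unit at
  \<open>(a, b)\<close>; left invariance makes such an average an intertwiner.\<close>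

lemma coefficient_intertwines:
  fixes U V :: "'g \<Rightarrow> complex mat"
  assumes U: "irreducible_unitary_rep U" and V: "irreducible_unitary_rep V"
    and a: "a < rep_dim U" and b: "b < rep_dim V"
  defines "A \<equiv> mat (rep_dim U) (rep_dim V) (\<lambda>(i, j). ip m (\<lambda>x. U x $$ (i, a)) (\<lambda>x. V x $$ (j, b)))"
  shows "U y * A = A * V y"
proof (rule eq_matI)
  note u = irreducible_unitary_repD(1)[OF U] and v = irreducible_unitary_repD(1)[OF V]
  note uc = unitary_repD(1)[OF u] and vc = unitary_repD(1)[OF v]
  have A: "A \<in> carrier_mat (rep_dim U) (rep_dim V)" by (simp add: A_def)
  fix i j assume "i < dim_row (A * V y)" "j < dim_col (A * V y)"
  then have i: "i < rep_dim U" and j: "j < rep_dim V" using A vc[of y] by auto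
  have "(U y * A) $$ (i, j) = (\<Sum>k<rep_dim U. U y $$ (i, k) * ip m (\<lambda>x. U x $$ (k, a)) (\<lambda>x. V x $$ (j, b)))"
    using index_mult_mat_sum[OF uc A i j] j by (simp add: A_def)
  also have "\<dots> = ip m (\<lambda>x. \<Sum>k<rep_dim U. U y $$ (i, k) * U x $$ (k, a)) (\<lambda>x. V x $$ (j, b))"
    using a b j U V
    by (subst ip_sum_left) (auto intro!: square_integrable_scale square_integrable_coefficient simp: ip_scale_left)
  also have "\<dots> = ip m (\<lambda>x. U (y + x) $$ (i, a)) (\<lambda>x. V x $$ (j, b))"
    using i a by (simp add: unitary_rep_add_index[OF u])
  also have "\<dots> = ip m (\<lambda>x. U (y + (- y + x)) $$ (i, a)) (\<lambda>x. V (- y + x) $$ (j, b))"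
  proof -
    have [measurable]: "(\<lambda>x. V x $$ (j, b)) \<in> borel_measurable m" "(\<lambda>x. U (y + x) $$ (i, a)) \<in> borel_measurable m"
      using continuous_coefficient[OF V j b] continuous_on_compose2[OF continuous_coefficient[OF U i a] continuous_translate(1)]
      by (auto intro: measurable_continuous simp del: sets_haar)
    show ?thesis unfolding ip_def
      by (rule integral_left[of "\<lambda>x. U (y + x) $$ (i, a) * cnj (V x $$ (j, b))" "- y", symmetric]) measurable
  qed
  also have "\<dots> = ip m (\<lambda>x. U x $$ (i, a)) (\<lambda>x. \<Sum>k<rep_dim V. V (- y) $$ (j, k) * V x $$ (k, b))"
    using j b by (simp add: unitary_rep_add_index[OF v] minus_add_cancel add_minus_cancel)
  also have "\<dots> = (\<Sum>k<rep_dim V. cnj (V (- y) $$ (j, k)) * ip m (\<lambda>x. U x $$ (i, a)) (\<lambda>x. V x $$ (k, b)))"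
    using a b i U V
    by (subst ip_sum_right) (auto intro!: square_integrable_scale square_integrable_coefficient simp: ip_scale_right)
  also have "\<dots> = (\<Sum>k<rep_dim V. A $$ (i, k) * V y $$ (k, j))"
    using i j by (intro sum.cong) (auto simp: A_def unitary_rep_uminus_index[OF v])
  also have "\<dots> = (A * V y) $$ (i, j)" using index_mult_mat_sum[OF A vc i j] by simp
  finally show "(U y * A) $$ (i, j) = (A * V y) $$ (i, j)" .
qed (use unitary_repD(1)[OF irreducible_unitary_repD(1)[OF U], of y] unitary_repD(1)[OF irreducible_unitary_repD(1)[OF V], of y] in \<open>auto simp: A_def\<close>)

text \<open>Schur's lemma makes the intertwiner a scalar multiple of the identity; its trace is the
  integral of the inner product of two columns of a unitary matrix.\<close>

lemma Schur_orthogonality_same: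
  fixes U :: "'g \<Rightarrow> complex mat"
  assumes U: "irreducible_unitary_rep U"
    and ij: "i < rep_dim U" "j < rep_dim U" and ab: "a < rep_dim U" "b < rep_dim U"
  shows "ip m (\<lambda>x. U x $$ (i, a)) (\<lambda>x. U x $$ (j, b))
       = (if i = j \<and> a = b then 1 / of_nat (rep_dim U) else 0)"
proof -
  define d where "d = rep_dim U"
  note u = irreducible_unitary_repD(1)[OF U]
  define A where "A = mat d d (\<lambda>(i, j). ip m (\<lambda>x. U x $$ (i, a)) (\<lambda>x. U x $$ (j, b)))"
  obtain c where c: "A = c \<cdot>\<^sub>m 1\<^sub>m d"
    using Schur_scalar[OF U, of A] coefficient_intertwines[OF U U ab] by (auto simp: A_def d_def)
  have e: "ip m (\<lambda>x. U x $$ (k, a)) (\<lambda>x. U x $$ (l, b)) = (if k = l then c else 0)" if "k < d" "l < d" for k l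
    using arg_cong[OF c, of "\<lambda>A. A $$ (k, l)"] that by (simp add: A_def)
  have "of_nat d * c = (\<Sum>k<d. ip m (\<lambda>x. U x $$ (k, a)) (\<lambda>x. U x $$ (k, b)))"
    by (simp add: e)
  also have "\<dots> = (LINT x|m. (\<Sum>k<d. U x $$ (k, a) * cnj (U x $$ (k, b))))"
    unfolding ip_def using U ab
    by (intro Bochner_Integration.integral_sum[symmetric] integrable_ip square_integrable_coefficient) (auto simp: d_def)
  also have "\<dots> = (if a = b then 1 else 0)"
    unfolding d_def unitary_rep_orthonormal_columns[OF u ab] by simp
  finally have "c = (if a = b then 1 / of_nat d else 0)"
    using irreducible_unitary_repD(2)[OF U] by (auto simp: d_def field_simps)
  then show ?thesis using e[of i j] ij by (simp add: d_def)
qed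

text \<open>If the intertwiner \<open>A\<close> were nonzero, a positive multiple of its adjoint
  would be unitary and make the representations equivalent. Schur's lemma is applied to the two
  products of \<open>A\<close> with its adjoint \<open>B\<close>, each of which commutes with one of
  the representations.\<close>

lemma Schur_orthogonality_inequivalent:
  fixes U V :: "'g \<Rightarrow> complex mat"
  assumes U: "irreducible_unitary_rep U" and V: "irreducible_unitary_rep V"
    and ne: "(U, V) \<notin> unitary_equiv"
    and i: "i < rep_dim U" and j: "j < rep_dim V" and a: "a < rep_dim U" and b: "b < rep_dim V"
  shows "ip m (\<lambda>x. U x $$ (i, a)) (\<lambda>x. V x $$ (j, b)) = 0"
proof -
  define d e where "d = rep_dim U" and "e = rep_dim V"
  note u = irreducible_unitary_repD(1)[OF U] and v = irreducible_unitary_repD(1)[OF V]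
  note uc = unitary_repD(1)[OF u, folded d_def] and vc = unitary_repD(1)[OF v, folded e_def]
  define A where "A = mat d e (\<lambda>(i, j). ip m (\<lambda>x. U x $$ (i, a)) (\<lambda>x. V x $$ (j, b)))"
  define B where "B = mat e d (\<lambda>(j, i). ip m (\<lambda>x. V x $$ (j, b)) (\<lambda>x. U x $$ (i, a)))"
  have Ac: "A \<in> carrier_mat d e" and Bc: "B \<in> carrier_mat e d" by (auto simp: A_def B_def)
  have UA: "U y * A = A * V y" for y
    using coefficient_intertwines[OF U V a b] by (simp add: A_def d_def e_def)
  have VB: "V y * B = B * U y" for y
    using coefficient_intertwines[OF V U b a] by (simp add: B_def d_def e_def)
  have BA_index: "B $$ (l, k) = cnj (A $$ (k, l))" if "k < d" "l < e" for k l
    using that by (simp add: A_def B_def ip_cnj)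
  have "V y * (B * A) = B * A * V y" for y
    unfolding assoc_mult_mat[OF vc Bc Ac, symmetric] VB assoc_mult_mat[OF Bc uc Ac] UA
    by (rule assoc_mult_mat[OF Bc Ac vc, symmetric])
  then obtain c where c: "B * A = c \<cdot>\<^sub>m 1\<^sub>m e"
    using Schur_scalar[OF V, of "B * A"] Ac Bc by (auto simp: e_def)
  have "U y * (A * B) = A * B * U y" for y
    unfolding assoc_mult_mat[OF uc Ac Bc, symmetric] UA assoc_mult_mat[OF Ac vc Bc] VB
    by (rule assoc_mult_mat[OF Ac Bc uc, symmetric])
  then obtain c' where c': "A * B = c' \<cdot>\<^sub>m 1\<^sub>m d"
    using Schur_scalar[OF U, of "A * B"] Ac Bc by (auto simp: d_def)
  \<comment> \<open>The squared Hilbert-Schmidt norm of \<open>A\<close>. It is the trace of both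
    products and so ties the two scalars to the dimensions.\<close>
  define s where "s = (\<Sum>k<d. \<Sum>l<e. (cmod (A $$ (k, l)))\<^sup>2)"
  have s1: "of_nat d * c' = of_real s"
  proof -
    have "of_nat d * c' = (\<Sum>k<d. (A * B) $$ (k, k))" by (simp add: c')
    also have "\<dots> = (\<Sum>k<d. \<Sum>l<e. A $$ (k, l) * B $$ (l, k))"
      using index_mult_mat_sum[OF Ac Bc] by simp
    also have "\<dots> = of_real s" unfolding s_def of_real_sum
      by (intro sum.cong refl) (simp add: BA_index complex_norm_square flip: of_real_power)
    finally show ?thesis .
  qed
  have s2: "of_nat e * c = of_real s"
  proof -
    have "of_nat e * c = (\<Sum>l<e. (B * A) $$ (l, l))" by (simp add: c)
    also have "\<dots> = (\<Sum>l<e. \<Sum>k<d. B $$ (l, k) * A $$ (k, l))"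
      using index_mult_mat_sum[OF Bc Ac] by simp
    also have "\<dots> = (\<Sum>k<d. \<Sum>l<e. B $$ (l, k) * A $$ (k, l))" by (rule sum.swap)
    also have "\<dots> = of_real s" unfolding s_def of_real_sum
      by (intro sum.cong refl) (simp add: BA_index cnj_mult_self flip: of_real_power)
    finally show ?thesis .
  qed
  have "s = 0"
  proof (rule ccontr)
    assume "s \<noteq> 0"
    moreover have "s \<ge> 0" unfolding s_def by (intro sum_nonneg) auto
    ultimately have s: "s > 0" by simp
    \<comment> \<open>Computing \<open>A * B * A\<close> in two ways shows that the scalars agree;
      comparing traces then shows that the dimensions agree.\<close>
    have "c \<cdot>\<^sub>m A = A * (B * A)"
      using Ac mult_smult_distrib[OF Ac one_carrier_mat, of c] by (simp add: c)
    also have "\<dots> = (A * B) * A" by (rule assoc_mult_mat[OF Ac Bc Ac, symmetric])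
    also have "\<dots> = c' \<cdot>\<^sub>m A"
      using Ac mult_smult_assoc_mat[OF one_carrier_mat Ac, of c'] by (simp add: c')
    finally have eq: "c \<cdot>\<^sub>m A = c' \<cdot>\<^sub>m A" .
    obtain k l where kl: "k < d" "l < e" "A $$ (k, l) \<noteq> 0"
      using \<open>s \<noteq> 0\<close> unfolding s_def by (metis (no_types, lifting) lessThan_iff norm_zero power_zero_numeral sum.neutral)
    have "c = c'" using arg_cong[OF eq, of "\<lambda>A. A $$ (k, l)"] kl Ac by simp
    moreover have "c \<noteq> 0" using s2 s by auto
    ultimately have de: "d = e" using s1 s2 by (metis mult_cancel_right of_nat_eq_iff)
    have e0: "e > 0" using irreducible_unitary_repD(2)[OF V] by (simp add: e_def)
    define t where "t = s / real e"
    have t: "t > 0" using s e0 by (simp add: t_def)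
    have ct: "c = of_real t" using s2 e0 by (simp add: t_def field_simps)
    \<comment> \<open>\<open>B\<close> maps the space of \<open>U\<close> to that of
      \<open>V\<close>, as \<open>unitary_equiv\<close> demands. The scalar of \<open>B * A\<close>
      is \<open>t\<close>, so dividing by its square root makes the matrix unitary.\<close>
    define T where "T = complex_of_real (1 / sqrt t) \<cdot>\<^sub>m B"
    have T: "T \<in> carrier_mat d d" using Bc de by (simp add: T_def)
    have Tadj: "mat_adjoint T = complex_of_real (1 / sqrt t) \<cdot>\<^sub>m A"
    proof (rule eq_matI)
      fix k l assume "k < dim_row (complex_of_real (1 / sqrt t) \<cdot>\<^sub>m A)" "l < dim_col (complex_of_real (1 / sqrt t) \<cdot>\<^sub>m A)"
      then have kl: "k < d" "l < e" using Ac by auto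
      then show "mat_adjoint T $$ (k, l) = (complex_of_real (1 / sqrt t) \<cdot>\<^sub>m A) $$ (k, l)"
        using Ac Bc by (subst index_mat_adjoint) (auto simp: T_def BA_index)
    qed (use mat_adjoint_carrier[OF T] Ac de in auto)
    have tt: "complex_of_real (1 / sqrt t) * complex_of_real (1 / sqrt t) = 1 / of_real t"
      using t by (simp flip: of_real_mult)
    have ss: "complex_of_real (1 / sqrt t) \<cdot>\<^sub>m (complex_of_real (1 / sqrt t) \<cdot>\<^sub>m X) = (1 / of_real t) \<cdot>\<^sub>m X" for X
      unfolding tt[symmetric] by (rule eq_matI) (auto simp: mult.assoc)
    have TT: "T * X * mat_adjoint T = (1 / of_real t) \<cdot>\<^sub>m (B * X * A)" if X: "X \<in> carrier_mat d d" for X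
      unfolding Tadj unfolding T_def mult_smult_assoc_mat[OF Bc X]
        mult_smult_assoc_mat[OF mult_carrier_mat[OF Bc X] smult_carrier_mat[OF Ac]]
        mult_smult_distrib[OF mult_carrier_mat[OF Bc X] Ac] ss ..
    have one: "(1 / complex_of_real t) \<cdot>\<^sub>m (c \<cdot>\<^sub>m X) = X" for X
      using t unfolding ct by (intro eq_matI) auto
    have "mat_adjoint T * T = 1\<^sub>m d"
      unfolding Tadj unfolding T_def mult_smult_assoc_mat[OF Ac smult_carrier_mat[OF Bc]]
        mult_smult_distrib[OF Ac Bc] ss c' using one \<open>c = c'\<close> by simp
    moreover have "T * mat_adjoint T = 1\<^sub>m d"
      unfolding Tadj unfolding T_def mult_smult_assoc_mat[OF Bc smult_carrier_mat[OF Ac]]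
        mult_smult_distrib[OF Bc Ac] ss c using one de by simp
    ultimately have "unitary_mat (rep_dim U) T" using T by (simp add: unitary_mat_def d_def)
    moreover have "V x = T * U x * mat_adjoint T" for x
    proof -
      have "B * U x * A = V x * (B * A)"
        using VB[of x] assoc_mult_mat[OF vc Bc Ac, of x] by simp
      also have "\<dots> = c \<cdot>\<^sub>m V x"
        using vc[of x] mult_smult_distrib[OF vc one_carrier_mat, of x c] by (simp add: c)
      finally show ?thesis using TT[OF uc] one by simp
    qed
    ultimately have "(U, V) \<in> unitary_equiv"
      using U V de unfolding unitary_equiv_def by (auto simp: d_def e_def)
    then show False using ne by simp
  qed
  then have "(cmod (A $$ (i, j)))\<^sup>2 = 0"
    using i j unfolding s_def d_def e_def
    by (subst (asm) sum_nonneg_eq_0_iff) (auto intro!: sum_nonneg simp: sum_nonneg_eq_0_iff)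
  then show ?thesis using i j by (simp add: A_def d_def e_def)
qed

end

section \<open>Unitary equivalence as an equivalence relation\<close>

lemma mat_adjoint_adjoint: "A \<in> carrier_mat n k \<Longrightarrow> mat_adjoint (mat_adjoint A) = (A :: complex mat)"
  using mat_adjoint_carrier[of A n k] mat_adjoint_carrier[of "mat_adjoint A" k n]
  by (intro eq_matI) (auto simp: index_mat_adjoint)

lemma mat_adjoint_mult:
  fixes A B :: "complex mat"
  assumes A: "A \<in> carrier_mat n k" and B: "B \<in> carrier_mat k l"
  shows "mat_adjoint (A * B) = mat_adjoint B * mat_adjoint A"
proof (rule eq_matI)
  note As = mat_adjoint_carrier[OF A] and Bs = mat_adjoint_carrier[OF B]
  have AB: "A * B \<in> carrier_mat n l" using A B by simp
  fix i j assume "i < dim_row (mat_adjoint B * mat_adjoint A)" "j < dim_col (mat_adjoint B * mat_adjoint A)"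
  then have ij: "i < l" "j < n" using As Bs by auto
  have "mat_adjoint (A * B) $$ (i, j) = cnj (\<Sum>a<k. A $$ (j, a) * B $$ (a, i))"
    using AB ij by (simp add: index_mat_adjoint index_mult_mat_sum[OF A B] del: index_mult_mat)
  also have "\<dots> = (\<Sum>a<k. mat_adjoint B $$ (i, a) * mat_adjoint A $$ (a, j))"
    using A B ij by (simp add: index_mat_adjoint mult.commute)
  also have "\<dots> = (mat_adjoint B * mat_adjoint A) $$ (i, j)"
    by (rule index_mult_mat_sum[OF Bs As ij, symmetric])
  finally show "mat_adjoint (A * B) $$ (i, j) = (mat_adjoint B * mat_adjoint A) $$ (i, j)" .
qed (use mat_adjoint_carrier[of "A * B" n l] mat_adjoint_carrier[OF A] mat_adjoint_carrier[OF B] A B in auto)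

lemma mat_adjoint_one: "mat_adjoint (1\<^sub>m n) = (1\<^sub>m n :: complex mat)"
  using mat_adjoint_carrier[of "1\<^sub>m n :: complex mat" n n]
  by (intro eq_matI) (auto simp: index_mat_adjoint)

lemma unitary_matD:
  assumes "unitary_mat d T"
  shows "T \<in> carrier_mat d d" "mat_adjoint T \<in> carrier_mat d d"
    "mat_adjoint T * T = 1\<^sub>m d" "T * mat_adjoint T = 1\<^sub>m d"
  using assms mat_adjoint_carrier[of T d d] by (auto simp: unitary_mat_def)

lemma unitary_mat_adjoint: "unitary_mat d T \<Longrightarrow> unitary_mat d (mat_adjoint T)"
  using mat_adjoint_adjoint[of T d d] mat_adjoint_carrier[of T d d] by (auto simp: unitary_mat_def)

lemma unitary_mat_mult:
  assumes S: "unitary_mat d S" and T: "unitary_mat d T"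
  shows "unitary_mat d (S * T)"
proof -
  note s = unitary_matD[OF S] and t = unitary_matD[OF T]
  have "mat_adjoint (S * T) * (S * T) = mat_adjoint T * ((mat_adjoint S * S) * T)"
    unfolding mat_adjoint_mult[OF s(1) t(1)] using s(1,2) t(1,2)
    by (simp add: assoc_mult_mat[of _ d d _ d _ d])
  moreover have "(S * T) * mat_adjoint (S * T) = S * ((T * mat_adjoint T) * mat_adjoint S)"
    unfolding mat_adjoint_mult[OF s(1) t(1)] using s(1,2) t(1,2)
    by (simp add: assoc_mult_mat[of _ d d _ d _ d])
  ultimately show ?thesis using s t by (simp add: unitary_mat_def)
qed

lemma equiv_unitary_equiv:
  "equiv {U :: 'g::topological_group_add \<Rightarrow> complex mat. irreducible_unitary_rep U} unitary_equiv"
proof (rule equivI)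
  show "unitary_equiv \<subseteq> {U :: 'g \<Rightarrow> complex mat. irreducible_unitary_rep U} \<times> {U. irreducible_unitary_rep U}"
    by (auto simp: unitary_equiv_def)
  show "refl_on {U :: 'g \<Rightarrow> complex mat. irreducible_unitary_rep U} unitary_equiv"
  proof (rule refl_onI)
    fix U :: "'g \<Rightarrow> complex mat" assume U: "U \<in> {U. irreducible_unitary_rep U}"
    then have c: "U x \<in> carrier_mat (rep_dim U) (rep_dim U)" for x
      using unitary_repD(1)[OF irreducible_unitary_repD(1)] by auto
    have "unitary_mat (rep_dim U) (1\<^sub>m (rep_dim U))"
      by (simp add: unitary_mat_def mat_adjoint_one)
    moreover have "U x = 1\<^sub>m (rep_dim U) * U x * mat_adjoint (1\<^sub>m (rep_dim U))" for x
      using c[of x] by (simp add: mat_adjoint_one)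
    ultimately show "(U, U) \<in> unitary_equiv" using U by (auto simp: unitary_equiv_def)
  qed
  show "sym (unitary_equiv :: (('g \<Rightarrow> complex mat) \<times> _) set)"
  proof (rule symI)
    fix U V :: "'g \<Rightarrow> complex mat" assume "(U, V) \<in> unitary_equiv"
    then obtain T where U: "irreducible_unitary_rep U" and V: "irreducible_unitary_rep V"
      and d: "rep_dim U = rep_dim V" and T: "unitary_mat (rep_dim U) T"
      and eq: "\<And>x. V x = T * U x * mat_adjoint T" by (auto simp: unitary_equiv_def)
    define n where "n = rep_dim U"
    note t = unitary_matD[OF T, folded n_def]
    have c: "U x \<in> carrier_mat n n" for x
      using unitary_repD(1)[OF irreducible_unitary_repD(1)[OF U]] by (simp add: n_def)
    have "U x = mat_adjoint T * V x * mat_adjoint (mat_adjoint T)" for x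
    proof -
      have "mat_adjoint T * V x * T = (mat_adjoint T * T) * U x * (mat_adjoint T * T)"
        unfolding eq using t(1,2) c[of x] by (simp add: assoc_mult_mat[of _ n n _ n _ n] del: t(3))
      then show ?thesis using t c[of x] by (simp add: mat_adjoint_adjoint[OF t(1)])
    qed
    then show "(V, U) \<in> unitary_equiv"
      using U V d unitary_mat_adjoint[OF T] unfolding unitary_equiv_def by auto
  qed
  show "trans (unitary_equiv :: (('g \<Rightarrow> complex mat) \<times> _) set)"
  proof (rule transI)
    fix U V W :: "'g \<Rightarrow> complex mat" assume "(U, V) \<in> unitary_equiv" "(V, W) \<in> unitary_equiv"
    then obtain T S where U: "irreducible_unitary_rep U" and W: "irreducible_unitary_rep W"
      and d: "rep_dim U = rep_dim V" "rep_dim V = rep_dim W"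
      and T: "unitary_mat (rep_dim U) T" and S: "unitary_mat (rep_dim U) S"
      and eq: "\<And>x. V x = T * U x * mat_adjoint T" "\<And>x. W x = S * V x * mat_adjoint S"
      by (auto simp: unitary_equiv_def)
    define n where "n = rep_dim U"
    note t = unitary_matD[OF T, folded n_def] and s = unitary_matD[OF S, folded n_def]
    have c: "U x \<in> carrier_mat n n" for x
      using unitary_repD(1)[OF irreducible_unitary_repD(1)[OF U]] by (simp add: n_def)
    have "W x = (S * T) * U x * mat_adjoint (S * T)" for x
      unfolding eq mat_adjoint_mult[OF s(1) t(1)] using t(1,2) s(1,2) c[of x]
      by (simp add: assoc_mult_mat[of _ n n _ n _ n])
    then show "(U, W) \<in> unitary_equiv"
      using U W d unitary_mat_mult[OF S T] unfolding unitary_equiv_def by auto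
  qed
qed

section \<open>Representatives of the dual and their normalized coefficients\<close>

lemma class_rep_unitary_dual:
  assumes "\<pi> \<in> unitary_dual"
  shows "irreducible_unitary_rep (class_rep \<pi>)" "\<pi> = unitary_equiv `` {class_rep \<pi>}"
proof -
  obtain U where U: "irreducible_unitary_rep U" "\<pi> = unitary_equiv `` {U}"
    using assms unfolding unitary_dual_def by (auto elim!: quotientE)
  have "U \<in> \<pi>" unfolding U(2) using equiv_class_self[OF equiv_unitary_equiv] U(1) by blast
  then have "class_rep \<pi> \<in> \<pi>" unfolding class_rep_def by (rule someI[where P = "\<lambda>c. c \<in> \<pi>"])
  then have r: "(U, class_rep \<pi>) \<in> unitary_equiv" unfolding U(2) by simp
  then show "irreducible_unitary_rep (class_rep \<pi>)" by (simp add: unitary_equiv_def)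
  show "\<pi> = unitary_equiv `` {class_rep \<pi>}"
    using equiv_class_eq[OF equiv_unitary_equiv r] U(2) by simp
qed

lemma class_rep_inequivalent:
  assumes "\<pi> \<in> unitary_dual" "\<rho> \<in> unitary_dual" "\<pi> \<noteq> \<rho>"
  shows "(class_rep \<pi>, class_rep \<rho>) \<notin> unitary_equiv"
  using assms class_rep_unitary_dual(2) equiv_class_eq[OF equiv_unitary_equiv] by metis

lemma unitary_dual_representative:
  assumes "irreducible_unitary_rep V"
  obtains \<pi> where "\<pi> \<in> unitary_dual" "(class_rep \<pi>, V) \<in> unitary_equiv"
proof -
  define \<pi> where "\<pi> = unitary_equiv `` {V}"
  have \<pi>: "\<pi> \<in> unitary_dual" using assms unfolding unitary_dual_def \<pi>_def by (intro quotientI) simp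
  have "V \<in> \<pi>" unfolding \<pi>_def using equiv_class_self[OF equiv_unitary_equiv] assms by blast
  then have "(class_rep \<pi>, V) \<in> unitary_equiv" using class_rep_unitary_dual(2)[OF \<pi>] by blast
  then show ?thesis using that \<pi> by blast
qed

text \<open>By Schur orthogonality an entry has squared norm 1 over the dimension; the square root
  normalizes it.\<close>

definition dual_coefficient ::
  "('g::topological_group_add \<Rightarrow> complex mat) set \<times> nat \<times> nat \<Rightarrow> 'g \<Rightarrow> complex" where
  "dual_coefficient = (\<lambda>(\<pi>, i, j) x. complex_of_real (sqrt (real (dual_dim \<pi>))) * class_rep \<pi> x $$ (i, j))"

definition dual_index ::
  "('g::topological_group_add \<Rightarrow> complex mat) set set \<Rightarrow> (('g \<Rightarrow> complex mat) set \<times> nat \<times> nat) set" where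
  "dual_index A = Sigma A (\<lambda>\<pi>. {..<dual_dim \<pi>} \<times> {..<dual_dim \<pi>})"

lemma finite_dual_index: "finite A \<Longrightarrow> finite (dual_index A)"
  by (simp add: dual_index_def)

theorem (in compact_group) orthonormal_dual_coefficient:
  "orthonormal m (dual_index unitary_dual) (dual_coefficient :: _ \<Rightarrow> 'g \<Rightarrow> complex)"
  unfolding orthonormal_def
proof (intro conjI ballI)
  fix p :: "('g \<Rightarrow> complex mat) set \<times> nat \<times> nat" assume p: "p \<in> dual_index unitary_dual"
  obtain \<pi> i j where pe: "p = (\<pi>, i, j)" by (cases p)
  have \<pi>: "\<pi> \<in> unitary_dual" "i < rep_dim (class_rep \<pi>)" "j < rep_dim (class_rep \<pi>)"
    using p by (auto simp: pe dual_index_def dual_dim_def)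
  note irr = class_rep_unitary_dual(1)[OF \<pi>(1)]
  show "square_integrable m (dual_coefficient p)"
    using square_integrable_coefficient[OF irr \<pi>(2,3)]
    by (simp add: pe dual_coefficient_def square_integrable_scale)
  fix q :: "('g \<Rightarrow> complex mat) set \<times> nat \<times> nat" assume q: "q \<in> dual_index unitary_dual"
  obtain \<rho> k l where qe: "q = (\<rho>, k, l)" by (cases q)
  have \<rho>: "\<rho> \<in> unitary_dual" "k < rep_dim (class_rep \<rho>)" "l < rep_dim (class_rep \<rho>)"
    using q by (auto simp: qe dual_index_def dual_dim_def)
  note irr' = class_rep_unitary_dual(1)[OF \<rho>(1)]
  have ip: "ip m (dual_coefficient p) (dual_coefficient q)
      = complex_of_real (sqrt (dual_dim \<pi>)) * complex_of_real (sqrt (dual_dim \<rho>)) *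
        ip m (\<lambda>x. class_rep \<pi> x $$ (i, j)) (\<lambda>x. class_rep \<rho> x $$ (k, l))"
    by (simp add: pe qe dual_coefficient_def ip_scale_left ip_scale_right)
  show "ip m (dual_coefficient p) (dual_coefficient q) = (if p = q then 1 else 0)"
  proof (cases "\<pi> = \<rho>")
    case True
    have "complex_of_real (sqrt (dual_dim \<pi>)) * complex_of_real (sqrt (dual_dim \<pi>)) = of_nat (dual_dim \<pi>)"
      by (simp flip: of_real_mult)
    moreover have "dual_dim \<pi> \<noteq> 0" using irreducible_unitary_repD(2)[OF irr] by (simp add: dual_dim_def)
    ultimately show ?thesis
      unfolding ip using Schur_orthogonality_same[OF irr \<pi>(2) _ \<pi>(3), of k l] \<rho> True
      by (auto simp: pe qe dual_dim_def)
  next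
    case False
    then show ?thesis
      unfolding ip using Schur_orthogonality_inequivalent[OF irr irr' class_rep_inequivalent[OF \<pi>(1) \<rho>(1) False] \<pi>(2) \<rho>(2) \<pi>(3) \<rho>(3)]
      by (simp add: pe qe)
  qed
qed

text \<open>The index set may be uncountable, so finite sets \<open>F n\<close> whose sums approach
  the total \<open>s\<close> replace an enumeration. The remainders of \<open>f\<close> are Cauchy
  along them, and their limit is orthogonal to every \<open>e i\<close>, hence of norm 0.\<close>

theorem orthonormal_Parseval:
  assumes e: "orthonormal m I e" and f: "square_integrable m f"
    and complete: "\<And>r. square_integrable m r \<Longrightarrow> (\<And>i. i \<in> I \<Longrightarrow> ip m r (e i) = 0) \<Longrightarrow> L2_norm m r = 0"
  shows "((\<lambda>i. (cmod (ip m f (e i)))\<^sup>2) has_sum (L2_norm m f)\<^sup>2) I"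
proof -
  define a where "a i = (cmod (ip m f (e i)))\<^sup>2" for i
  have sq: "square_integrable m (e i)" if "i \<in> I" for i using e that by (auto simp: orthonormal_def)
  have fin: "orthonormal m F e" if "F \<subseteq> I" for F using orthonormal_subset[OF e that] .
  define h where "h F x = f x - (\<Sum>i\<in>F. ip m f (e i) * e i x)" for F x
  have hsq: "square_integrable m (h F)" if "F \<subseteq> I" for F
    unfolding h_def using that
    by (intro square_integrable_diff f square_integrable_sum square_integrable_scale sq) auto
  have hnorm: "(L2_norm m (h F))\<^sup>2 = (L2_norm m f)\<^sup>2 - sum a F" if "finite F" "F \<subseteq> I" for F
    unfolding h_def a_def using fin that f by (intro orthonormal_norm_projection) auto
  have "sum a F \<le> (L2_norm m f)\<^sup>2" if "finite F" "F \<subseteq> I" for F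
    using hnorm[OF that] zero_le_power2[of "L2_norm m (h F)"] by linarith
  then have summ: "a summable_on I"
    by (intro nonneg_bdd_above_summable_on bdd_aboveI2) (auto simp: a_def)
  define s where "s = infsum a I"
  have le_s: "sum a F \<le> s" if "finite F" "F \<subseteq> I" for F
    unfolding s_def using that summ by (intro finite_sum_le_infsum) (auto simp: a_def)
  have "\<exists>F. finite F \<and> F \<subseteq> I \<and> s - inverse (real (Suc n)) < sum a F" for n
  proof (rule ccontr)
    assume *: "\<not> ?thesis"
    have "s \<le> s - inverse (real (Suc n))"
      unfolding s_def
      by (rule infsum_le_finite_sums[OF summ]) (use * in \<open>auto simp: s_def not_less\<close>)
    then show False by simp
  qed
  then obtain F where F: "\<And>n. finite (F n)" "\<And>n. F n \<subseteq> I" "\<And>n. s - inverse (real (Suc n)) < sum a (F n)"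
    by metis
  have diff: "(L2_norm m (\<lambda>x. h A x - h B x))\<^sup>2 = sum a B - sum a A" if "A \<subseteq> B" "finite B" "B \<subseteq> I" for A B
  proof -
    have "h A x - h B x = (\<Sum>i\<in>B - A. ip m f (e i) * e i x)" for x
      using that by (simp add: h_def sum_diff)
    then have "(L2_norm m (\<lambda>x. h A x - h B x))\<^sup>2 = sum a (B - A)"
      using orthonormal_norm_sum[OF fin, of "B - A" "\<lambda>i. ip m f (e i)"] that
      by (auto simp: a_def)
    then show ?thesis using that by (simp add: sum_diff)
  qed
  have near: "L2_norm m (\<lambda>x. h (F n) x - h B x) \<le> sqrt (inverse (real (Suc n)))"
    if "F n \<subseteq> B" "finite B" "B \<subseteq> I" for n B
    using diff[OF that] le_s[OF that(2,3)] F(3)[of n] by (intro real_le_rsqrt) linarith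
  have tend: "(\<lambda>n. sqrt (inverse (real (Suc n)))) \<longlonglongrightarrow> 0"
    using tendsto_real_sqrt[OF LIMSEQ_inverse_real_of_nat] by simp
  have cau: "\<exists>N. \<forall>n\<ge>N. \<forall>k\<ge>N. L2_norm m (\<lambda>x. h (F n) x - h (F k) x) < \<epsilon>" if "\<epsilon> > 0" for \<epsilon>
  proof -
    obtain N where N: "\<And>n. n \<ge> N \<Longrightarrow> sqrt (inverse (real (Suc n))) < \<epsilon> / 2"
      using order_tendstoD(2)[OF tend, of "\<epsilon> / 2"] \<open>\<epsilon> > 0\<close> by (auto simp: eventually_sequentially)
    have "L2_norm m (\<lambda>x. h (F n) x - h (F k) x) < \<epsilon>" if "n \<ge> N" "k \<ge> N" for n k
    proof -
      \<comment> \<open>The sets \<open>F n\<close> are not nested in general; both remainders are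
        compared with the remainder of the union.\<close>
      have u: "finite (F n \<union> F k)" "F n \<union> F k \<subseteq> I" using F by auto
      have "L2_norm m (\<lambda>x. h (F n) x - h (F k) x)
          \<le> L2_norm m (\<lambda>x. h (F n) x - h (F n \<union> F k) x) + L2_norm m (\<lambda>x. h (F n \<union> F k) x - h (F k) x)"
        by (rule L2_norm_diff_triangle) (intro hsq F u)+
      also have "L2_norm m (\<lambda>x. h (F n \<union> F k) x - h (F k) x) = L2_norm m (\<lambda>x. h (F k) x - h (F n \<union> F k) x)"
        by (rule L2_norm_minus_commute)
      finally show ?thesis
        using near[OF _ u, of n] near[OF _ u, of k] N[OF that(1)] N[OF that(2)] by simp
    qed
    then show ?thesis by blast
  qed
  obtain r where r: "square_integrable m r" "(\<lambda>n. L2_norm m (\<lambda>x. h (F n) x - r x)) \<longlonglongrightarrow> 0"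
    using L2_complete[of m "\<lambda>n. h (F n)", OF hsq[OF F(2)] cau] by blast
  have "ip m r (e i) = 0" if i: "i \<in> I" for i
  proof -
    have ei: "L2_norm m (e i) = 1"
      using ip_self[of m "e i"] e i by (simp add: orthonormal_def flip: of_real_power)
         (metis L2_norm_nonneg abs_of_nonneg of_real_eq_1_iff power2_eq_1_iff abs_1 abs_minus_cancel)
    have b: "cmod (ip m (h (F n)) (e i)) \<le> sqrt (inverse (real (Suc n)))" for n
    proof (cases "i \<in> F n")
      case True
      have "ip m (h (F n)) (e i) = ip m f (e i) - ip m f (e i)"
        unfolding h_def using F(2)[of n] i
        by (subst ip_diff_left) (auto intro!: f square_integrable_sum square_integrable_scale sq
            simp: orthonormal_ip_sum[OF fin[OF F(2)] F(1) True])
      then show ?thesis by simp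
    next
      case False
      \<comment> \<open>The sum over \<open>insert i (F n)\<close> still cannot exceed
        \<open>s\<close>, so the gap left by \<open>F n\<close> bounds the coefficient at
        \<open>i\<close>. This covers indices that belong to no \<open>F n\<close>.\<close>
      have B: "finite (insert i (F n))" "insert i (F n) \<subseteq> I" using F i by auto
      have "ip m (\<lambda>x. \<Sum>j\<in>F n. ip m f (e j) * e j x) (e i) = (\<Sum>j\<in>F n. ip m f (e j) * ip m (e j) (e i))"
        using F(2)[of n] i by (subst ip_sum_left) (auto intro!: square_integrable_scale sq simp: ip_scale_left)
      also have "\<dots> = 0"
        using False e i F(2)[of n] by (intro sum.neutral) (auto simp: orthonormal_def subset_iff)
      finally have "ip m (h (F n)) (e i) = ip m f (e i)"
        unfolding h_def using F(2)[of n] i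
        by (subst ip_diff_left) (auto intro!: f square_integrable_sum square_integrable_scale sq)
      moreover have "a i \<le> inverse (real (Suc n))"
        using le_s[OF B] F(3)[of n] False F(1)[of n] by simp
      ultimately show ?thesis by (intro real_le_rsqrt) (simp add: a_def)
    qed
    have "cmod (ip m r (e i)) \<le> sqrt (inverse (real (Suc n))) + L2_norm m (\<lambda>x. h (F n) x - r x)" for n
    proof -
      have "ip m (h (F n)) (e i) - ip m r (e i) = ip m (\<lambda>x. h (F n) x - r x) (e i)"
        by (intro ip_diff_left[symmetric] hsq F r sq i)
      then have "cmod (ip m (h (F n)) (e i) - ip m r (e i)) \<le> L2_norm m (\<lambda>x. h (F n) x - r x)"
        using Cauchy_Schwarz_ip[OF square_integrable_diff[OF hsq[OF F(2)] r(1)] sq[OF i], of n] ei by simp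
      then show ?thesis
        using b[of n] norm_triangle_ineq4[of "ip m (h (F n)) (e i)" "ip m (h (F n)) (e i) - ip m r (e i)"] by simp
    qed
    moreover have "(\<lambda>n. sqrt (inverse (real (Suc n))) + L2_norm m (\<lambda>x. h (F n) x - r x)) \<longlonglongrightarrow> 0 + 0"
      by (intro tendsto_add tend r)
    ultimately have "cmod (ip m r (e i)) \<le> 0 + 0" by (intro LIMSEQ_le_const) auto
    then show ?thesis by simp
  qed
  then have r0: "L2_norm m r = 0" using complete r(1) by blast
  have "L2_norm m (h (F n)) \<le> L2_norm m (\<lambda>x. h (F n) x - r x)" for n
    using L2_norm_triangle[OF square_integrable_diff[OF hsq[OF F(2)] r(1)] r(1), of n] r0 by simp
  then have "(\<lambda>n. L2_norm m (h (F n))) \<longlonglongrightarrow> 0"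
    by (intro tendsto_sandwich[OF _ _ tendsto_const r(2)]) auto
  then have lim: "(\<lambda>n. (L2_norm m (h (F n)))\<^sup>2) \<longlonglongrightarrow> 0\<^sup>2" by (intro tendsto_power)
  have "(L2_norm m f)\<^sup>2 - s \<le> (L2_norm m (h (F n)))\<^sup>2" for n
    using hnorm[OF F(1,2), of n] le_s[OF F(1,2), of n] by simp
  then have "(L2_norm m f)\<^sup>2 - s \<le> 0\<^sup>2" by (intro LIMSEQ_le_const[OF lim]) blast
  moreover have "s \<le> (L2_norm m f)\<^sup>2"
    unfolding s_def
    by (rule infsum_le_finite_sums[OF summ]) (use hnorm zero_le_power2 in \<open>metis diff_ge_0_iff_ge\<close>)
  ultimately have "s = (L2_norm m f)\<^sup>2" by simp
  then show ?thesis using has_sum_infsum[OF summ] unfolding s_def a_def by simp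
qed

section \<open>The Peter--Weyl theorem\<close>

context compact_group
begin

definition perp :: "('g \<Rightarrow> complex) \<Rightarrow> bool" where
  "perp r \<longleftrightarrow> square_integrable m r \<and>
     (\<forall>U :: 'g \<Rightarrow> complex mat. \<forall>i j. irreducible_unitary_rep U \<longrightarrow> i < rep_dim U \<longrightarrow> j < rep_dim U \<longrightarrow>
        ip m r (\<lambda>x. U x $$ (i, j)) = 0)"

lemma perpD:
  assumes "perp r"
  shows "square_integrable m r"
    "irreducible_unitary_rep U \<Longrightarrow> i < rep_dim U \<Longrightarrow> j < rep_dim U \<Longrightarrow> ip m r (\<lambda>x. U x $$ (i, j)) = 0"
  using assms by (auto simp: perp_def)

lemma perp_scale: "perp r \<Longrightarrow> perp (\<lambda>x. c * r x)"
  by (auto simp: perp_def ip_scale_left square_integrable_scale)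

lemma perp_add: "perp r \<Longrightarrow> perp s \<Longrightarrow> perp (\<lambda>x. r x + s x)"
  by (auto simp: perp_def ip_add_left square_integrable_add square_integrable_coefficient)

lemma perp_limit:
  assumes f: "\<And>n::nat. perp (f n)" and g: "square_integrable m g"
    and lim: "(\<lambda>n. L2_norm m (\<lambda>x. f n x - g x)) \<longlonglongrightarrow> 0"
  shows "perp g"
  unfolding perp_def
proof (intro conjI allI impI g)
  fix U :: "'g \<Rightarrow> complex mat" and i j
  assume U: "irreducible_unitary_rep U" "i < rep_dim U" "j < rep_dim U"
  let ?u = "\<lambda>x. U x $$ (i, j)"
  note sq = square_integrable_coefficient[OF U]
  have "cmod (ip m g ?u) \<le> L2_norm m (\<lambda>x. f n x - g x) * L2_norm m ?u" for n
  proof -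
    have "ip m (\<lambda>x. f n x - g x) ?u = - ip m g ?u"
      using perpD[OF f] U by (subst ip_diff_left) (auto intro: g sq)
    then show ?thesis
      using Cauchy_Schwarz_ip[OF square_integrable_diff[OF perpD(1)[OF f] g] sq, of n] by simp
  qed
  moreover have "(\<lambda>n. L2_norm m (\<lambda>x. f n x - g x) * L2_norm m ?u) \<longlonglongrightarrow> 0 * L2_norm m ?u"
    by (intro tendsto_mult lim tendsto_const)
  ultimately have "cmod (ip m g ?u) \<le> 0 * L2_norm m ?u" by (intro LIMSEQ_le_const) auto
  then show "ip m g ?u = 0" by simp
qed

text \<open>Left invariance moves the translation from \<open>r\<close> to the coefficient, where it
  only mixes the coefficients of one column.\<close>

lemma perp_left_translate:
  assumes r: "perp r"
  shows "perp (\<lambda>x. r (a + x))"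
  unfolding perp_def
proof (intro conjI allI impI square_integrable_translate perpD(1)[OF r])
  fix U :: "'g \<Rightarrow> complex mat" and i j
  assume U: "irreducible_unitary_rep U" "i < rep_dim U" "j < rep_dim U"
  note u = irreducible_unitary_repD(1)[OF U(1)]
  have [measurable]: "r \<in> borel_measurable m" using perpD(1)[OF r] by (simp add: square_integrable_def)
  have [measurable]: "(\<lambda>x. U (- a + x) $$ (i, j)) \<in> borel_measurable m"
    using continuous_on_compose2[OF continuous_coefficient[OF U] continuous_translate(1)]
    by (auto intro: measurable_continuous simp del: sets_haar)
  have "ip m (\<lambda>x. r (a + x)) (\<lambda>x. U x $$ (i, j)) = ip m (\<lambda>x. r (a + x)) (\<lambda>x. U (- a + (a + x)) $$ (i, j))"
    by (simp add: minus_add_cancel add_minus_cancel)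
  also have "\<dots> = ip m r (\<lambda>x. U (- a + x) $$ (i, j))"
    unfolding ip_def by (rule integral_left[of "\<lambda>x. r x * cnj (U (- a + x) $$ (i, j))"]) measurable
  also have "\<dots> = (\<Sum>k<rep_dim U. cnj (U (- a) $$ (i, k)) * ip m r (\<lambda>x. U x $$ (k, j)))"
    unfolding unitary_rep_add_index[OF u U(2,3)] using U perpD(1)[OF r]
    by (subst ip_sum_right) (auto simp: ip_scale_right intro!: square_integrable_scale square_integrable_coefficient)
  also have "\<dots> = 0" using perpD(2)[OF r U(1)] U by (intro sum.neutral) auto
  finally show "ip m (\<lambda>x. r (a + x)) (\<lambda>x. U x $$ (i, j)) = 0" .
qed

text \<open>Self-adjointness moves the convolution to the coefficient, where it only mixes the
  coefficients of one row.\<close>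

lemma perp_conv:
  assumes \<phi>: "continuous_on UNIV \<phi>" and sym: "\<And>x. \<phi> (- x) = \<phi> x" and r: "perp r"
  shows "perp (conv m \<phi> r)"
  unfolding perp_def
proof (intro conjI allI impI square_integrable_conv perpD(1)[OF r] \<phi>)
  fix U :: "'g \<Rightarrow> complex mat" and i j
  assume U: "irreducible_unitary_rep U" "i < rep_dim U" "j < rep_dim U"
  note u = irreducible_unitary_repD(1)[OF U(1)] and sq = square_integrable_coefficient[OF U]
  define c where "c k = (LINT z|m. U z $$ (k, j) * complex_of_real (\<phi> z))" for k
  have "conv m \<phi> (\<lambda>x. U x $$ (i, j)) x = (\<Sum>k<rep_dim U. c k * U x $$ (i, k))" for x
  proof -
    have "conv m \<phi> (\<lambda>x. U x $$ (i, j)) x = (LINT z|m. (\<Sum>k<rep_dim U. U x $$ (i, k) * (U z $$ (k, j) * complex_of_real (\<phi> z))))"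
      using sq by (subst conv_shift[OF \<phi> sym])
        (auto simp: square_integrable_def unitary_rep_add_index[OF u U(2,3)] sum_distrib_right mult.assoc)
    also have "\<dots> = (\<Sum>k<rep_dim U. U x $$ (i, k) * c k)"
      unfolding c_def using U \<phi>
      by (subst Bochner_Integration.integral_sum)
         (auto intro!: integrable_continuous continuous_intros continuous_coefficient)
    finally show ?thesis by (simp add: mult.commute)
  qed
  then have e: "conv m \<phi> (\<lambda>x. U x $$ (i, j)) = (\<lambda>x. \<Sum>k<rep_dim U. c k * U x $$ (i, k))" by (rule ext)
  have "ip m (conv m \<phi> r) (\<lambda>x. U x $$ (i, j)) = ip m r (\<lambda>x. \<Sum>k<rep_dim U. c k * U x $$ (i, k))"
    unfolding conv_self_adjoint[OF \<phi> sym perpD(1)[OF r] sq] e ..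
  also have "\<dots> = (\<Sum>k<rep_dim U. cnj (c k) * ip m r (\<lambda>x. U x $$ (i, k)))"
    using U perpD(1)[OF r]
    by (subst ip_sum_right) (auto simp: ip_scale_right intro!: square_integrable_scale square_integrable_coefficient)
  also have "\<dots> = 0" using perpD(2)[OF r U(1)] U by (intro sum.neutral) auto
  finally show "ip m (conv m \<phi> r) (\<lambda>x. U x $$ (i, j)) = 0" .
qed

text \<open>Maximizing the norm of the convolution over the unit ball of \<open>perp\<close>
  functions gives information on the squared operator, whence the eigenvalue
  \<open>\<kappa>\<^sup>2\<close>. The maximizing sequence consists of approximate eigenvectors, and
  compactness extracts a limit \<open>w\<close>. Its image under the squared operator is continuous
  and satisfies the equation at every point.\<close>

lemma perp_square_eigenfunction:
  assumes \<phi>: "continuous_on UNIV \<phi>" and sym: "\<And>x. \<phi> (- x) = \<phi> x"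
    and r: "perp r" and nz: "L2_norm m (conv m \<phi> r) \<noteq> 0"
  obtains v \<kappa> where "perp v" "continuous_on UNIV v" "L2_norm m v \<noteq> 0" "\<kappa> > 0"
    "conv m \<phi> (conv m \<phi> v) = (\<lambda>x. complex_of_real (\<kappa>\<^sup>2) * v x)"
proof -
  let ?N = "L2_norm m" and ?T = "conv m \<phi>"
  obtain B where B: "B > 0" "\<And>x. norm (\<phi> x) \<le> B" using continuous_bounded[OF \<phi>] by blast
  have TB: "?N (?T f) \<le> ?N f * B" if "square_integrable m f" for f
    using L2_norm_conv[OF \<phi> _ that, of B] B(2) by simp
  define S where "S = {?N (?T f) | f. perp f \<and> ?N f \<le> 1}"
  define \<kappa> where "\<kappa> = Sup S"
  have bdd: "bdd_above S"
  proof (rule bdd_aboveI[of _ B])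
    fix s assume "s \<in> S"
    then obtain f where f: "perp f" "?N f \<le> 1" "s = ?N (?T f)" by (auto simp: S_def)
    have "s \<le> ?N f * B" using f TB perpD(1) by simp
    also have "\<dots> \<le> 1 * B" using f B by (intro mult_right_mono) auto
    finally show "s \<le> B" by simp
  qed
  have T\<kappa>: "?N (?T f) \<le> \<kappa> * ?N f" if f: "perp f" for f
  proof (cases "?N f = 0")
    case True
    then show ?thesis using TB[OF perpD(1)[OF f]] by simp
  next
    case False
    then have pos: "?N f > 0" by (simp add: less_le)
    let ?c = "complex_of_real (inverse (?N f))"
    have "?N (\<lambda>x. ?c * f x) = 1" using pos by (simp add: L2_norm_scale norm_inverse)
    then have "?N (?T (\<lambda>x. ?c * f x)) \<in> S"
      unfolding S_def using perp_scale[OF f] by (intro CollectI exI[of _ "\<lambda>x. ?c * f x"]) auto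
    then have "?N (?T (\<lambda>x. ?c * f x)) \<le> \<kappa>" unfolding \<kappa>_def by (rule cSup_upper[OF _ bdd])
    then have "inverse (?N f) * ?N (?T f) \<le> \<kappa>" using pos by (simp add: conv_scale L2_norm_scale norm_inverse)
    then show ?thesis using pos by (simp add: field_simps)
  qed
  have \<kappa>: "\<kappa> > 0"
  proof (rule ccontr)
    assume "\<not> \<kappa> > 0"
    then have "\<kappa> * ?N r \<le> 0" by (simp add: mult_nonpos_nonneg)
    then show False using T\<kappa>[OF r] nz L2_norm_nonneg[of m "?T r"] by linarith
  qed
  have "S \<noteq> {}" using perp_scale[OF r, of 0] unfolding S_def by (auto intro!: exI[of _ "\<lambda>x. 0"] simp: L2_norm_def)
  then have "\<exists>f. perp f \<and> ?N f \<le> 1 \<and> \<kappa> - inverse (real (Suc n)) < ?N (?T f)" for n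
    using less_cSupD[of S "\<kappa> - inverse (real (Suc n))"] by (auto simp: \<kappa>_def S_def)
  then obtain f where f: "\<And>n. perp (f n)" "\<And>n. ?N (f n) \<le> 1"
      "\<And>n. \<kappa> - inverse (real (Suc n)) < ?N (?T (f n))" by metis
  note fs = perpD(1)[OF f(1)]
  define g where "g n = ?T (f n)" for n
  have gp: "perp (g n)" for n unfolding g_def by (intro perp_conv \<phi> sym f)
  note gs = perpD(1)[OF gp]
  have Tg: "perp (?T (g n))" for n by (intro perp_conv \<phi> sym gp)
  have gle: "?N (g n) \<le> \<kappa>" for n
  proof -
    have "?N (g n) \<le> \<kappa> * ?N (f n)" unfolding g_def by (rule T\<kappa>[OF f(1)])
    also have "\<dots> \<le> \<kappa> * 1" using \<kappa> by (intro mult_left_mono f(2)) simp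
    finally show ?thesis by simp
  qed
  have glim: "(\<lambda>n. ?N (g n)) \<longlonglongrightarrow> \<kappa>"
  proof (rule tendsto_sandwich)
    show "(\<lambda>n. \<kappa> - inverse (real (Suc n))) \<longlonglongrightarrow> \<kappa>"
      using tendsto_diff[OF tendsto_const LIMSEQ_inverse_real_of_nat, of \<kappa>] by simp
    show "\<forall>\<^sub>F n in sequentially. \<kappa> - inverse (real (Suc n)) \<le> ?N (g n)"
      using f(3) by (intro always_eventually allI) (simp add: g_def less_imp_le)
    show "\<forall>\<^sub>F n in sequentially. ?N (g n) \<le> \<kappa>" using gle by simp
  qed (rule tendsto_const)
  define F where "F = (\<lambda>n x. complex_of_real (\<kappa>\<^sup>2) * f n x)"
  have Fs: "square_integrable m (F n)" for n unfolding F_def by (intro square_integrable_scale fs)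
  \<comment> \<open>On expanding the square, self-adjointness makes the cross term
    \<open>2 * \<kappa>\<^sup>2\<close> times the squared norm of \<open>g n\<close>; the other two
    terms are at most \<open>\<kappa>\<^sup>2\<close> times that squared norm and
    \<open>\<kappa> ^ 4\<close>. The bound tends to 0 because the norms of \<open>g n\<close> tend
    to \<open>\<kappa>\<close>.\<close>
  have close: "(?N (\<lambda>x. ?T (g n) x - F n x))\<^sup>2 \<le> \<kappa>\<^sup>2 * (\<kappa>\<^sup>2 - (?N (g n))\<^sup>2)" for n
  proof -
    have "ip m (?T (g n)) (f n) = ip m (g n) (g n)"
      unfolding g_def by (intro conv_self_adjoint \<phi> sym square_integrable_conv fs)
    then have i: "Re (ip m (?T (g n)) (F n)) = \<kappa>\<^sup>2 * (?N (g n))\<^sup>2"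
      unfolding F_def by (simp add: ip_scale_right ip_self flip: of_real_power of_real_mult)
    have "(?N (?T (g n)))\<^sup>2 \<le> (\<kappa> * ?N (g n))\<^sup>2" using T\<kappa>[OF gp] by (intro power_mono) auto
    moreover have "(?N (F n))\<^sup>2 \<le> (\<kappa>\<^sup>2)\<^sup>2"
    proof (rule power_mono)
      show "?N (F n) \<le> \<kappa>\<^sup>2" using mult_left_mono[OF f(2)[of n], of "\<kappa>\<^sup>2"]
        by (simp add: F_def L2_norm_scale norm_power)
    qed simp
    ultimately show ?thesis
      using L2_norm_diff_power2[OF perpD(1)[OF Tg[of n]] Fs[of n]] i
      by (simp add: power2_eq_square algebra_simps)
  qed
  have close0: "(\<lambda>n. ?N (\<lambda>x. ?T (g n) x - F n x)) \<longlonglongrightarrow> 0"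
  proof -
    have "(\<lambda>n. sqrt (\<kappa>\<^sup>2 * (\<kappa>\<^sup>2 - (?N (g n))\<^sup>2))) \<longlonglongrightarrow> sqrt (\<kappa>\<^sup>2 * (\<kappa>\<^sup>2 - \<kappa>\<^sup>2))"
      by (intro tendsto_intros glim)
    then have z: "(\<lambda>n. sqrt (\<kappa>\<^sup>2 * (\<kappa>\<^sup>2 - (?N (g n))\<^sup>2))) \<longlonglongrightarrow> 0" by simp
    show ?thesis
      by (rule tendsto_sandwich[OF _ _ tendsto_const z])
         (auto intro!: always_eventually real_le_rsqrt close)
  qed
  \<comment> \<open>Compactness is used for the second application of the operator, on the bounded
    set of all \<open>g n\<close>.\<close>
  define R where "R = range g"
  have Rs: "square_integrable m h" "?N h \<le> \<kappa>" if "h \<in> R" for h using that gs gle by (auto simp: R_def)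
  have tb: "L2_totally_bounded m (?T ` R)"
    unfolding L2_totally_bounded_def
  proof (intro allI impI)
    fix e :: real assume "e > 0"
    then have e2: "e / 2 > 0" by simp
    obtain A where A: "finite A" "A \<subseteq> R" "\<And>h. h \<in> R \<Longrightarrow> \<exists>k\<in>A. \<forall>x. cmod (?T h x - ?T k x) < e / 2"
      using conv_totally_bounded[OF \<phi> Rs e2] by blast
    have "\<exists>k\<in>A. ?N (\<lambda>x. ?T h x - ?T k x) < e" if h: "h \<in> R" for h
    proof -
      obtain k where k: "k \<in> A" "\<And>x. cmod (?T h x - ?T k x) < e / 2" using A(3)[OF h] by blast
      have "?N (\<lambda>x. ?T h x - ?T k x) \<le> e / 2"
      proof (rule L2_norm_le_sup)
        have "square_integrable m (\<lambda>x. ?T h x - ?T k x)"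
          using h k A by (intro square_integrable_diff square_integrable_conv \<phi> Rs(1)) auto
        then show "(\<lambda>x. ?T h x - ?T k x) \<in> borel_measurable m" by (simp add: square_integrable_def)
        show "cmod (?T h x - ?T k x) \<le> e / 2" for x using k(2)[of x] by simp
      qed (use e2 in simp)
      then show ?thesis using k e2 by (intro bexI[of _ k]) auto
    qed
    then show "\<exists>S. finite S \<and> S \<subseteq> ?T ` R \<and> (\<forall>f\<in>?T ` R. \<exists>g\<in>S. ?N (\<lambda>x. f x - g x) < e)"
      using A by (intro exI[of _ "?T ` A"]) auto
  qed
  obtain q w where q: "strict_mono q" and w: "square_integrable m w"
    and qw: "(\<lambda>n. ?N (\<lambda>x. ?T (g (q n)) x - w x)) \<longlonglongrightarrow> 0"
    by (rule L2_totally_bounded_convergent_subseq[OF tb, of "\<lambda>n. ?T (g n)"])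
       (auto simp: R_def intro: square_integrable_conv \<phi> gs)
  have wp: "perp w" by (rule perp_limit[OF Tg w qw])
  \<comment> \<open>Thus the maximizing sequence itself, scaled by \<open>\<kappa>\<^sup>2\<close>,
    converges along \<open>q\<close>.\<close>
  have wF: "(\<lambda>n. ?N (\<lambda>x. w x - F (q n) x)) \<longlonglongrightarrow> 0"
  proof (rule tendsto_sandwich[OF _ _ tendsto_const])
    have "(\<lambda>n. ?N (\<lambda>x. ?T (g (q n)) x - w x) + ?N (\<lambda>x. ?T (g (q n)) x - F (q n) x)) \<longlonglongrightarrow> 0 + 0"
      using LIMSEQ_subseq_LIMSEQ[OF close0 q] by (intro tendsto_add qw) (simp add: comp_def)
    then show "(\<lambda>n. ?N (\<lambda>x. ?T (g (q n)) x - w x) + ?N (\<lambda>x. ?T (g (q n)) x - F (q n) x)) \<longlonglongrightarrow> 0" by simp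
    show "\<forall>\<^sub>F n in sequentially. ?N (\<lambda>x. w x - F (q n) x) \<le>
        ?N (\<lambda>x. ?T (g (q n)) x - w x) + ?N (\<lambda>x. ?T (g (q n)) x - F (q n) x)"
    proof (intro always_eventually allI)
      fix n
      show "?N (\<lambda>x. w x - F (q n) x) \<le>
        ?N (\<lambda>x. ?T (g (q n)) x - w x) + ?N (\<lambda>x. ?T (g (q n)) x - F (q n) x)"
        using L2_norm_diff_triangle[OF w perpD(1)[OF Tg] Fs, of "q n" "q n"]
          L2_norm_minus_commute[of m w "?T (g (q n))"] by simp
    qed
  qed simp
  define v where "v = ?T (?T w)"
  have vp: "perp v" unfolding v_def by (intro perp_conv \<phi> sym wp)
  have TTF: "?T (?T (F n)) = (\<lambda>x. complex_of_real (\<kappa>\<^sup>2) * ?T (g n) x)" for n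
    unfolding F_def g_def by (simp only: conv_scale)
  \<comment> \<open>Both \<open>v\<close> and \<open>\<kappa>\<^sup>2\<close> times \<open>w\<close>
    are limits of \<open>?T (?T (F (q n)))\<close>, hence agree almost everywhere.\<close>
  have "?N (\<lambda>x. v x - complex_of_real (\<kappa>\<^sup>2) * w x) \<le>
      ?N (\<lambda>x. w x - F (q n) x) * B * B + \<kappa>\<^sup>2 * ?N (\<lambda>x. ?T (g (q n)) x - w x)" for n
  proof -
    have "?N (\<lambda>x. v x - ?T (?T (F (q n))) x) = ?N (?T (?T (\<lambda>x. w x - F (q n) x)))"
      unfolding v_def by (simp add: conv_diff[OF \<phi>] w Fs square_integrable_conv \<phi>)
    also have "\<dots> \<le> ?N (?T (\<lambda>x. w x - F (q n) x)) * B"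
      by (intro TB square_integrable_conv \<phi> square_integrable_diff w Fs)
    also have "\<dots> \<le> ?N (\<lambda>x. w x - F (q n) x) * B * B"
      using B by (intro mult_right_mono TB square_integrable_diff w Fs) auto
    finally have 1: "?N (\<lambda>x. v x - ?T (?T (F (q n))) x) \<le> ?N (\<lambda>x. w x - F (q n) x) * B * B" .
    have 2: "?N (\<lambda>x. ?T (?T (F (q n))) x - complex_of_real (\<kappa>\<^sup>2) * w x) = \<kappa>\<^sup>2 * ?N (\<lambda>x. ?T (g (q n)) x - w x)"
      unfolding TTF by (simp add: L2_norm_scale norm_power flip: right_diff_distrib)
    have "?N (\<lambda>x. v x - complex_of_real (\<kappa>\<^sup>2) * w x) \<le>
      ?N (\<lambda>x. v x - ?T (?T (F (q n))) x) + ?N (\<lambda>x. ?T (?T (F (q n))) x - complex_of_real (\<kappa>\<^sup>2) * w x)"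
      by (intro L2_norm_diff_triangle perpD(1)[OF vp] square_integrable_conv \<phi> Fs square_integrable_scale w)
    then show ?thesis using 1 2 by simp
  qed
  moreover have "(\<lambda>n. ?N (\<lambda>x. w x - F (q n) x) * B * B + \<kappa>\<^sup>2 * ?N (\<lambda>x. ?T (g (q n)) x - w x))
      \<longlonglongrightarrow> 0 * B * B + \<kappa>\<^sup>2 * 0"
    by (intro tendsto_intros wF qw)
  ultimately have "?N (\<lambda>x. v x - complex_of_real (\<kappa>\<^sup>2) * w x) \<le> 0 * B * B + \<kappa>\<^sup>2 * 0"
    by (intro LIMSEQ_le_const) auto
  then have "?N (\<lambda>x. v x - complex_of_real (\<kappa>\<^sup>2) * w x) \<le> 0" by (simp only: mult_zero_left mult_zero_right add_0)
  then have z: "?N (\<lambda>x. v x - complex_of_real (\<kappa>\<^sup>2) * w x) = 0" by (rule antisym[OF _ L2_norm_nonneg])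
  have "square_integrable m (\<lambda>x. v x - complex_of_real (\<kappa>\<^sup>2) * w x)"
    by (intro square_integrable_diff perpD(1)[OF vp] square_integrable_scale w)
  then have ae: "AE x in m. v x = complex_of_real (\<kappa>\<^sup>2) * w x" using z L2_norm_eq_0_iff by fastforce
  have vm: "v \<in> borel_measurable m" "(\<lambda>x. complex_of_real (\<kappa>\<^sup>2) * w x) \<in> borel_measurable m"
    using perpD(1)[OF vp] w by (auto simp: square_integrable_def)
  \<comment> \<open>Convolution sees only the almost-everywhere class, so this equation and the next
    hold at every point.\<close>
  have Tv: "?T v = (\<lambda>x. complex_of_real (\<kappa>\<^sup>2) * ?T w x)"
    using conv_cong_AE[OF \<phi> ae vm] by (simp only: conv_scale)
  have eig: "?T (?T v) = (\<lambda>x. complex_of_real (\<kappa>\<^sup>2) * v x)"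
    unfolding Tv by (simp only: conv_scale v_def)
  \<comment> \<open>If \<open>w\<close> vanished, \<open>f (q n)\<close> would tend to 0, and so
    would \<open>g (q n)\<close>, whose norms tend to \<open>\<kappa> > 0\<close>.\<close>
  have wnz: "?N w \<noteq> 0"
  proof
    assume w0: "?N w = 0"
    have "?N (g (q n)) \<le> \<kappa> * (?N (\<lambda>x. w x - F (q n) x) / \<kappa>\<^sup>2)" for n
    proof -
      have "?N (F (q n)) \<le> ?N (\<lambda>x. F (q n) x - w x) + ?N w"
        using L2_norm_triangle[OF square_integrable_diff[OF Fs w] w, of "q n"] by simp
      then have "\<kappa>\<^sup>2 * ?N (f (q n)) \<le> ?N (\<lambda>x. w x - F (q n) x)"
        using w0 L2_norm_minus_commute[of m w "F (q n)"] by (simp add: F_def L2_norm_scale norm_power)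
      then have "?N (f (q n)) \<le> ?N (\<lambda>x. w x - F (q n) x) / \<kappa>\<^sup>2" using \<kappa> by (simp add: field_simps)
      then show ?thesis using T\<kappa>[OF f(1), of "q n"] mult_left_mono[of "?N (f (q n))" _ \<kappa>] \<kappa>
        unfolding g_def by (meson less_imp_le order_trans)
    qed
    moreover have "(\<lambda>n. \<kappa> * (?N (\<lambda>x. w x - F (q n) x) / \<kappa>\<^sup>2)) \<longlonglongrightarrow> \<kappa> * (0 / \<kappa>\<^sup>2)"
      using \<kappa> by (intro tendsto_intros wF) auto
    moreover have "(\<lambda>n. ?N (g (q n))) \<longlonglongrightarrow> \<kappa>" using LIMSEQ_subseq_LIMSEQ[OF glim q] by (simp add: comp_def)
    ultimately have "\<kappa> \<le> \<kappa> * (0 / \<kappa>\<^sup>2)" by (intro LIMSEQ_le) auto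
    then show False using \<kappa> by simp
  qed
  have "?N v = \<kappa>\<^sup>2 * ?N w"
    using L2_norm_cong_AE[OF ae vm] by (simp add: L2_norm_scale norm_power)
  then have vnz: "?N v \<noteq> 0" using wnz \<kappa> by simp
  have vc: "continuous_on UNIV v" unfolding v_def by (intro conv_continuous \<phi> square_integrable_conv w)
  show ?thesis using that[OF vp vc vnz \<kappa> eig] .
qed

text \<open>With \<open>T\<close> the convolution operator, the equation for its square factors as
  \<open>(T - \<kappa>) (T + \<kappa>) v = 0\<close>. Either \<open>p = (T + \<kappa>) v\<close> is
  a nonzero eigenfunction for \<open>\<kappa>\<close>, or it vanishes and \<open>v\<close> is one
  for \<open>- \<kappa>\<close>.\<close>

lemma perp_eigenfunction:
  assumes \<phi>: "continuous_on UNIV \<phi>" and sym: "\<And>x. \<phi> (- x) = \<phi> x"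
    and r: "perp r" and nz: "L2_norm m (conv m \<phi> r) \<noteq> 0"
  obtains u \<mu> where "perp u" "continuous_on UNIV u" "L2_norm m u \<noteq> 0" "\<mu> \<noteq> 0"
    "conv m \<phi> u = (\<lambda>x. complex_of_real \<mu> * u x)"
proof -
  obtain v \<kappa> where v: "perp v" "continuous_on UNIV v" "L2_norm m v \<noteq> 0" "\<kappa> > 0"
    and eig: "conv m \<phi> (conv m \<phi> v) = (\<lambda>x. complex_of_real (\<kappa>\<^sup>2) * v x)"
    using perp_square_eigenfunction[OF \<phi> sym r nz] by blast
  define p where "p x = conv m \<phi> v x + complex_of_real \<kappa> * v x" for x
  have pp: "perp p" unfolding p_def by (intro perp_add perp_scale perp_conv \<phi> sym v)
  have pc: "continuous_on UNIV p"
    unfolding p_def by (intro continuous_intros conv_continuous \<phi> perpD(1) v)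
  show ?thesis
  proof (cases "L2_norm m p = 0")
    case True
    then have "p x = 0" for x by (rule continuous_L2_norm_zero[OF pc])
    then have "conv m \<phi> v = (\<lambda>x. complex_of_real (- \<kappa>) * v x)"
      by (auto simp: p_def eq_neg_iff_add_eq_0)
    then show ?thesis using that[of v "- \<kappa>"] v by auto
  next
    case False
    have "conv m \<phi> p = (\<lambda>x. conv m \<phi> (conv m \<phi> v) x + complex_of_real \<kappa> * conv m \<phi> v x)"
      unfolding p_def using v
      by (subst conv_add[OF \<phi>]) (auto intro: square_integrable_conv \<phi> perpD(1) square_integrable_scale simp: conv_scale)
    also have "\<dots> = (\<lambda>x. complex_of_real \<kappa> * p x)"
      unfolding eig p_def by (auto simp: algebra_simps power2_eq_square)
    finally show ?thesis using that[OF pp pc False, of \<kappa>] v by auto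
  qed
qed

section \<open>Invariant spaces of continuous functions\<close>

definition function_space :: "('g \<Rightarrow> complex) set \<Rightarrow> bool" where
  "function_space X \<longleftrightarrow> (\<forall>f\<in>X. continuous_on UNIV f) \<and> (\<lambda>x. 0) \<in> X \<and>
     (\<forall>f\<in>X. \<forall>g\<in>X. (\<lambda>x. f x + g x) \<in> X) \<and> (\<forall>f\<in>X. \<forall>c. (\<lambda>x. c * f x) \<in> X)"

lemma function_spaceD:
  assumes "function_space X"
  shows "f \<in> X \<Longrightarrow> continuous_on UNIV f" "(\<lambda>x. 0) \<in> X"
    "f \<in> X \<Longrightarrow> g \<in> X \<Longrightarrow> (\<lambda>x. f x + g x) \<in> X" "f \<in> X \<Longrightarrow> (\<lambda>x. c * f x) \<in> X"
    "f \<in> X \<Longrightarrow> square_integrable m f"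
  using assms square_integrable_continuous unfolding function_space_def by blast+

lemma function_space_sum:
  assumes X: "function_space X" and "\<And>i. i \<in> I \<Longrightarrow> f i \<in> X"
  shows "(\<lambda>x. \<Sum>i\<in>I. c i * f i x) \<in> X"
  using assms(2)
  by (induction I rule: infinite_finite_induct)
     (auto intro!: function_spaceD(2-4)[OF X])

definition orthonormal_in :: "('g \<Rightarrow> complex) set \<Rightarrow> nat \<Rightarrow> (nat \<Rightarrow> 'g \<Rightarrow> complex) \<Rightarrow> bool" where
  "orthonormal_in X n e \<longleftrightarrow> orthonormal m {..<n} e \<and> (\<forall>i<n. e i \<in> X)"

text \<open>A family that no orthonormal family in \<open>X\<close> exceeds in size is a basis: a nonzero remainder
  could be normalized and appended.\<close>

lemma orthonormal_maximal_spans: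
  assumes X: "function_space X" and e: "orthonormal_in X n e"
    and max: "\<And>k e'. orthonormal_in X k e' \<Longrightarrow> k \<le> n" and f: "f \<in> X"
  shows "f x = (\<Sum>i<n. ip m f (e i) * e i x)"
proof -
  have on: "orthonormal m {..<n} e" and eX: "\<And>i. i < n \<Longrightarrow> e i \<in> X"
    using e by (auto simp: orthonormal_in_def)
  note sq = function_spaceD(5)[OF X]
  define g where "g x = f x - (\<Sum>i<n. ip m f (e i) * e i x)" for x
  have "(\<lambda>x. f x + (- 1) * (\<Sum>i<n. ip m f (e i) * e i x)) \<in> X"
    by (rule function_spaceD(3)[OF X f function_spaceD(4)[OF X]])
       (use function_space_sum[OF X, of "{..<n}" e "\<lambda>i. ip m f (e i)"] eX in auto)
  then have gX: "g \<in> X" by (simp add: g_def[abs_def])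
  have ss: "square_integrable m (\<lambda>x. \<Sum>i<n. ip m f (e i) * e i x)"
    by (intro square_integrable_sum square_integrable_scale sq eX) auto
  have ge: "ip m g (e i) = 0" if "i < n" for i
    unfolding g_def using that sq[OF f] sq[OF eX] ss
    by (subst ip_diff_left) (auto simp: orthonormal_ip_sum[OF on])
  have "L2_norm m g = 0"
  proof (rule ccontr)
    assume nz: "L2_norm m g \<noteq> 0"
    define c where "c = complex_of_real (inverse (L2_norm m g))"
    define e' where "e' = e(n := (\<lambda>x. c * g x))"
    have cg: "(\<lambda>x. c * g x) \<in> X" by (rule function_spaceD(4)[OF X gX])
    have n1: "ip m (\<lambda>x. c * g x) (\<lambda>x. c * g x) = 1"
    proof -
      have "ip m (\<lambda>x. c * g x) (\<lambda>x. c * g x) = complex_of_real ((inverse (L2_norm m g) * L2_norm m g)\<^sup>2)"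
        by (subst ip_scale_left, subst ip_scale_right, subst ip_self) (simp add: c_def power2_eq_square mult_ac)
      then show ?thesis using nz by simp
    qed
    have n2: "ip m (\<lambda>x. c * g x) (e i) = 0" if "i < n" for i using ge[OF that] by (simp add: ip_scale_left)
    have n3: "ip m (e i) (\<lambda>x. c * g x) = 0" if "i < n" for i
      using n2[OF that] ip_cnj[of m "\<lambda>x. c * g x" "e i"] by simp
    have "orthonormal_in X (Suc n) e'"
      unfolding orthonormal_in_def orthonormal_def
      using on eX cg n1 n2 n3 sq[OF cg] by (auto simp: e'_def less_Suc_eq orthonormal_def)
    from max[OF this] show False by simp
  qed
  \<comment> \<open>Members of a function space are continuous and the measure has full support, so
    the expansion holds at every point.\<close>
  then have "g x = 0" by (rule continuous_L2_norm_zero[OF function_spaceD(1)[OF X gX]])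
  then show ?thesis by (simp add: g_def)
qed

definition invariant_space :: "('g \<Rightarrow> complex) set \<Rightarrow> bool" where
  "invariant_space X \<longleftrightarrow> function_space X \<and> (\<forall>f\<in>X. \<forall>a. (\<lambda>x. f (a + x)) \<in> X)"

text \<open>\<open>n\<close> plays the role of the dimension of \<open>X\<close>: minimal invariant
  spaces are selected by comparing these numbers.\<close>

definition max_orthonormal_in :: "('g \<Rightarrow> complex) set \<Rightarrow> nat \<Rightarrow> (nat \<Rightarrow> 'g \<Rightarrow> complex) \<Rightarrow> bool" where
  "max_orthonormal_in X n e \<longleftrightarrow> orthonormal_in X n e \<and> (\<forall>k e'. orthonormal_in X k e' \<longrightarrow> k \<le> n)"

lemma max_orthonormal_exists:
  assumes "\<And>k e. orthonormal_in X k e \<Longrightarrow> k \<le> B"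
  shows "\<exists>n e. max_orthonormal_in X n e"
proof -
  have "\<exists>e. orthonormal_in X 0 e" by (simp add: orthonormal_in_def orthonormal_def)
  then obtain n where n: "\<exists>e. orthonormal_in X n e" "\<And>k. \<exists>e. orthonormal_in X k e \<Longrightarrow> k \<le> n"
    using ex_has_greatest_nat[of "\<lambda>k. \<exists>e. orthonormal_in X k e" 0 "\<lambda>k. k" "Suc B"] assms
    by (auto simp: less_Suc_eq_le)
  then obtain e where "orthonormal_in X n e" by blast
  then show ?thesis using n(2) unfolding max_orthonormal_in_def by blast
qed

lemma max_orthonormal_spans:
  assumes "function_space X" "max_orthonormal_in X n e" "f \<in> X"
  shows "f x = (\<Sum>i<n. ip m f (e i) * e i x)"
  using assms orthonormal_maximal_spans[of X n e f] unfolding max_orthonormal_in_def by blast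

lemma orthonormal_coefficients_unique:
  fixes n :: nat
  assumes on: "orthonormal m {..<n} e" and eq: "\<And>x. (\<Sum>i<n. c i * e i x) = (\<Sum>i<n. d i * e i x)" and k: "k < n"
  shows "c k = d k"
proof -
  have "ip m (\<lambda>x. \<Sum>i<n. c i * e i x) (e k) = ip m (\<lambda>x. \<Sum>i<n. d i * e i x) (e k)"
    using eq by simp
  then show ?thesis
    using orthonormal_ip_sum[OF on, of k c] orthonormal_ip_sum[OF on, of k d] k by simp
qed

text \<open>The complex conjugate in the definition of \<open>V\<close> makes the functions \<open>e j\<close> themselves (not their
  conjugates) linear combinations of matrix coefficients of \<open>V\<close>.\<close>

lemma minimal_invariant_space_not_perp:
  assumes X: "invariant_space X" and e: "max_orthonormal_in X n e" and n: "n > 0"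
    and min: "\<And>Y k e'. invariant_space Y \<Longrightarrow> Y \<subseteq> X \<Longrightarrow> max_orthonormal_in Y k e' \<Longrightarrow> k > 0 \<Longrightarrow> n \<le> k"
  shows "\<not> perp (e 0)"
proof
  assume perp: "perp (e 0)"
  have Xf: "function_space X" and Xi: "\<And>f a. f \<in> X \<Longrightarrow> (\<lambda>x. f (a + x)) \<in> X"
    using X by (auto simp: invariant_space_def)
  have on: "orthonormal m {..<n} e" and eX: "\<And>i. i < n \<Longrightarrow> e i \<in> X"
    and emax: "\<And>k e'. orthonormal_in X k e' \<Longrightarrow> k \<le> n"
    using e by (auto simp: max_orthonormal_in_def orthonormal_in_def)
  note span = max_orthonormal_spans[OF Xf e] and ec = function_spaceD(1)[OF Xf eX] and es = function_spaceD(5)[OF Xf eX]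
  define V where "V a = mat n n (\<lambda>(i, j). cnj (ip m (\<lambda>x. e j (- a + x)) (e i)))" for a
  have Vc: "V a \<in> carrier_mat n n" for a by (simp add: V_def)
  have Vd: "rep_dim V = n" by (simp add: rep_dim_def V_def)
  have tr: "e j (- a + x) = (\<Sum>i<n. cnj (V a $$ (i, j)) * e i x)" if "j < n" for a x j
    using span[OF Xi[OF eX[OF that]], of "- a" x] that by (simp add: V_def)
  have add: "V (a + b) = V a * V b" for a b
  proof (rule eq_matI)
    fix i j assume "i < dim_row (V a * V b)" "j < dim_col (V a * V b)"
    then have ij: "i < n" "j < n" by (auto simp: V_def)
    have "(\<Sum>l<n. cnj (V (a + b) $$ (l, j)) * e l x) = (\<Sum>l<n. (\<Sum>k<n. cnj (V b $$ (k, j)) * cnj (V a $$ (l, k))) * e l x)" for x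
    proof -
      have "(\<Sum>l<n. cnj (V (a + b) $$ (l, j)) * e l x) = e j (- b + (- a + x))"
        using tr[OF ij(2), of "a + b" x] by (simp only: minus_add add.assoc)
      also have "\<dots> = (\<Sum>k<n. cnj (V b $$ (k, j)) * (\<Sum>l<n. cnj (V a $$ (l, k)) * e l x))"
        unfolding tr[OF ij(2)] by (intro sum.cong refl) (simp add: tr)
      also have "\<dots> = (\<Sum>l<n. \<Sum>k<n. cnj (V b $$ (k, j)) * cnj (V a $$ (l, k)) * e l x)"
        unfolding sum_distrib_left by (subst sum.swap) (simp add: mult.assoc)
      finally show ?thesis by (simp add: sum_distrib_right)
    qed
    then have "cnj (V (a + b) $$ (i, j)) = (\<Sum>k<n. cnj (V b $$ (k, j)) * cnj (V a $$ (i, k)))"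
      by (rule orthonormal_coefficients_unique[OF on _ ij(1)])
    also have "\<dots> = cnj (\<Sum>k<n. V a $$ (i, k) * V b $$ (k, j))" by (simp add: mult.commute)
    also have "\<dots> = cnj ((V a * V b) $$ (i, j))" by (simp add: index_mult_mat_sum[OF Vc Vc ij] del: index_mult_mat)
    finally show "V (a + b) $$ (i, j) = (V a * V b) $$ (i, j)" by simp
  qed (auto simp: V_def)
  \<comment> \<open>The columns are the conjugated coordinates of the translates of an orthonormal
    family, and left translation preserves inner products.\<close>
  have uni: "mat_adjoint (V a) * V a = 1\<^sub>m n" for a
  proof (rule eq_matI)
    note Va = mat_adjoint_carrier[OF Vc[of a]]
    fix i j assume "i < dim_row (1\<^sub>m n :: complex mat)" "j < dim_col (1\<^sub>m n :: complex mat)"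
    then have ij: "i < n" "j < n" by auto
    have em: "(\<lambda>x. e i x * cnj (e j x)) \<in> borel_measurable m"
      using ec ij by (intro measurable_continuous continuous_intros) auto
    have "(\<Sum>k<n. cnj (V a $$ (k, i)) * V a $$ (k, j)) = ip m (\<lambda>x. \<Sum>k<n. cnj (V a $$ (k, i)) * e k x) (\<lambda>x. \<Sum>l<n. cnj (V a $$ (l, j)) * e l x)"
    proof -
      have "ip m (\<lambda>x. \<Sum>k<n. cnj (V a $$ (k, i)) * e k x) (\<lambda>x. \<Sum>l<n. cnj (V a $$ (l, j)) * e l x)
        = (\<Sum>l<n. V a $$ (l, j) * ip m (\<lambda>x. \<Sum>k<n. cnj (V a $$ (k, i)) * e k x) (e l))"
        by (subst ip_sum_right) (auto simp: ip_scale_right intro!: square_integrable_scale square_integrable_sum es)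
      also have "\<dots> = (\<Sum>l<n. V a $$ (l, j) * cnj (V a $$ (l, i)))"
        by (intro sum.cong refl) (simp add: orthonormal_ip_sum[OF on])
      finally show ?thesis by (simp add: mult.commute)
    qed
    also have "\<dots> = ip m (\<lambda>x. e i (- a + x)) (\<lambda>x. e j (- a + x))"
      by (simp add: tr ij)
    also have "\<dots> = ip m (e i) (e j)"
      unfolding ip_def by (rule integral_left[OF em])
    also have "\<dots> = (if i = j then 1 else 0)" using on ij by (simp add: orthonormal_def)
    finally have "(\<Sum>k<n. cnj (V a $$ (k, i)) * V a $$ (k, j)) = (if i = j then 1 else 0)" .
    then show "(mat_adjoint (V a) * V a) $$ (i, j) = 1\<^sub>m n $$ (i, j)"
      using ij Vc[of a] by (simp add: index_mult_mat_sum[OF Va Vc ij] index_mat_adjoint del: index_mult_mat)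
  qed (use mat_adjoint_carrier[OF Vc[of a]] in \<open>auto simp: V_def\<close>)
  have cont: "continuous_on UNIV (\<lambda>a. V a $$ (i, j))" if "i < n" "j < n" for i j
  proof -
    have "continuous_on UNIV (\<lambda>p. e j (- fst p + snd p))"
      using that by (intro continuous_on_compose2[OF ec] continuous_intros) auto
    from continuous_integral_kernel[OF this es[OF that(1)]]
    show ?thesis using that by (auto simp: V_def intro: continuous_intros)
  qed
  have V: "unitary_rep V"
    unfolding unitary_rep_def Vd unitary_mat_def
    using Vc add uni cont mat_mult_left_right_inverse[OF mat_adjoint_carrier[OF Vc] Vc uni] by auto
  have "irreducible_unitary_rep V"
    unfolding irreducible_unitary_rep_def Vd
  proof (intro conjI allI impI V n)
    fix W assume W: "VectorSpace.subspace class_ring W (module_vec TYPE(complex) n) \<and> (\<forall>x. \<forall>v\<in>W. V x *\<^sub>v v \<in> W)"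
    note Ws = subspace_vecD[OF conjunct1[OF W]]
    \<comment> \<open>The conjugate matches the one in \<open>V\<close>: left translation of
      \<open>fn v\<close> by \<open>a\<close> corresponds to applying \<open>V (- a)\<close> to
      \<open>v\<close>. Invariant subspaces of vectors thus become invariant subspaces of
      \<open>X\<close>.\<close>
    define fn where "fn v x = (\<Sum>i<n. cnj (vec_index v i) * e i x)" for v x
    have fnX: "fn v \<in> X" for v
      using function_space_sum[OF Xf, of "{..<n}" e "\<lambda>i. cnj (vec_index v i)"] eX unfolding fn_def[abs_def] by auto
    have fn_inj: "v = w" if vw: "v \<in> carrier_vec n" "w \<in> carrier_vec n" "fn v = fn w" for v w
    proof (rule eq_vecI)
      fix i assume "i < dim_vec w"
      then have i: "i < n" using vw by auto
      have "cnj (vec_index v i) = cnj (vec_index w i)"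
        by (rule orthonormal_coefficients_unique[OF on _ i]) (use fun_cong[OF vw(3)] in \<open>simp add: fn_def\<close>)
      then show "vec_index v i = vec_index w i" by simp
    qed (use vw in auto)
    define Y where "Y = fn ` W"
    have fn0: "fn (0\<^sub>v n) = (\<lambda>x. 0)" by (auto simp: fn_def)
    have Yf: "function_space Y"
      unfolding function_space_def
    proof (intro conjI ballI allI)
      show "continuous_on UNIV f" if "f \<in> Y" for f
        using that fnX function_spaceD(1)[OF Xf] by (auto simp: Y_def)
      show "(\<lambda>x. 0) \<in> Y" unfolding Y_def fn0[symmetric] by (rule imageI[OF Ws(2)])
      fix f assume "f \<in> Y"
      then obtain v where v: "v \<in> W" "f = fn v" by (auto simp: Y_def)
      then have vc: "v \<in> carrier_vec n" using Ws(1) by blast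
      have "(\<lambda>x. c * f x) = fn (cnj c \<cdot>\<^sub>v v)" for c
        using vc by (auto simp: v fn_def sum_distrib_left mult.assoc intro!: sum.cong)
      then show "(\<lambda>x. c * f x) \<in> Y" for c using Ws(4)[OF v(1)] by (simp add: Y_def)
      fix g assume "g \<in> Y"
      then obtain w where w: "w \<in> W" "g = fn w" by (auto simp: Y_def)
      then have wc: "w \<in> carrier_vec n" using Ws(1) by blast
      have "(\<lambda>x. f x + g x) = fn (v + w)"
        by (rule ext) (use vc wc in \<open>simp add: v w fn_def distrib_right sum.distrib\<close>)
      then show "(\<lambda>x. f x + g x) \<in> Y" using Ws(3)[OF v(1) w(1)] by (simp add: Y_def)
    qed
    have Yi: "invariant_space Y"
      unfolding invariant_space_def
    proof (intro conjI ballI allI Yf)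
      fix f a assume "f \<in> Y"
      then obtain v where v: "v \<in> W" "f = fn v" by (auto simp: Y_def)
      then have vc: "v \<in> carrier_vec n" using Ws(1) by blast
      have "f (a + x) = fn (V (- a) *\<^sub>v v) x" for x
      proof -
        have "f (a + x) = (\<Sum>j<n. cnj (vec_index v j) * (\<Sum>i<n. cnj (V (- a) $$ (i, j)) * e i x))"
          unfolding v(2) fn_def by (intro sum.cong refl) (use tr[of _ "- a" x] in simp)
        also have "\<dots> = (\<Sum>i<n. (\<Sum>j<n. cnj (vec_index v j) * cnj (V (- a) $$ (i, j))) * e i x)"
          unfolding sum_distrib_left sum_distrib_right by (subst sum.swap) (simp add: mult.assoc)
        also have "\<dots> = fn (V (- a) *\<^sub>v v) x"
          unfolding fn_def
        proof (intro sum.cong refl)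
          fix i assume "i \<in> {..<n}"
          then have i: "i < n" by simp
          have "vec_index (V (- a) *\<^sub>v v) i = (\<Sum>j<n. V (- a) $$ (i, j) * vec_index v j)"
            using i vc Vc[of "- a"] by (auto simp: scalar_prod_def lessThan_atLeast0 intro!: sum.cong)
          then show "(\<Sum>j<n. cnj (vec_index v j) * cnj (V (- a) $$ (i, j))) * e i x = cnj (vec_index (V (- a) *\<^sub>v v) i) * e i x"
            by (simp add: mult.commute)
        qed
        finally show ?thesis .
      qed
      then have "(\<lambda>x. f (a + x)) = fn (V (- a) *\<^sub>v v)" by blast
      then show "(\<lambda>x. f (a + x)) \<in> Y" using W v(1) by (simp add: Y_def)
    qed
    have YX: "Y \<subseteq> X" using fnX by (auto simp: Y_def)
    have Yb: "k \<le> n" if "orthonormal_in Y k e'" for k e'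
      using that YX by (intro emax[of k e']) (auto simp: orthonormal_in_def)
    obtain k e' where e': "max_orthonormal_in Y k e'" using max_orthonormal_exists[of Y n] Yb by blast
    show "W = {0\<^sub>v n} \<or> W = carrier_vec n"
    proof (cases "k = 0")
      case True
      have "v = 0\<^sub>v n" if v: "v \<in> W" for v
      proof (rule fn_inj)
        show "fn v = fn (0\<^sub>v n)"
        proof
          fix x
          have "fn v \<in> Y" using v by (simp add: Y_def)
          from max_orthonormal_spans[OF Yf e' this, of x] show "fn v x = fn (0\<^sub>v n) x"
            using True unfolding fn0 by simp
        qed
      qed (use v Ws(1) in auto)
      then show ?thesis using Ws(2) by blast
    next
      case False
      \<comment> \<open>Minimality makes an orthonormal family of \<open>Y\<close> as large as one
        of \<open>X\<close>, so it spans \<open>X\<close>; then \<open>Y = X\<close> and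
        \<open>W\<close> is the full space.\<close>
      then have "n \<le> k" using min[OF Yi YX e'] by simp
      then have kn: "k = n" using e' Yb by (auto simp: max_orthonormal_in_def intro: antisym)
      have oX: "orthonormal_in X n e'"
        using e' YX kn by (auto simp: max_orthonormal_in_def orthonormal_in_def)
      have "v \<in> W" if v: "v \<in> carrier_vec n" for v
      proof -
        have "fn v x = (\<Sum>i<n. ip m (fn v) (e' i) * e' i x)" for x
          by (rule orthonormal_maximal_spans[OF Xf oX emax fnX])
        then have "fn v = (\<lambda>x. \<Sum>i<n. ip m (fn v) (e' i) * e' i x)" by blast
        also have "\<dots> \<in> Y"
          using e' kn by (intro function_space_sum[OF Yf]) (auto simp: max_orthonormal_in_def orthonormal_in_def)
        finally obtain w where w: "w \<in> W" "fn v = fn w" by (auto simp: Y_def)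
        then show ?thesis using fn_inj[OF v _ w(2)] Ws(1) by auto
      qed
      then show ?thesis using Ws(1) by blast
    qed
  qed
  then have irr: "irreducible_unitary_rep V" .
  \<comment> \<open>Evaluating the translation formula at the identity expresses \<open>e 0\<close>
    by the coefficients in row 0 of \<open>V\<close>, with the constants
    \<open>e i 0\<close>.\<close>
  have e0: "e 0 x = (\<Sum>i<n. e i 0 * V x $$ (0, i))" for x
  proof -
    have "e 0 x = (\<Sum>i<n. cnj (V (- x) $$ (i, 0)) * e i 0)" using tr[OF n, of "- x" 0] by simp
    also have "\<dots> = (\<Sum>i<n. e i 0 * V x $$ (0, i))"
      using n by (intro sum.cong refl) (simp add: unitary_rep_uminus_index[OF V] Vd)
    finally show ?thesis .
  qed
  have "ip m (e 0) (e 0) = ip m (e 0) (\<lambda>x. \<Sum>i<n. e i 0 * V x $$ (0, i))" using e0 by metis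
  also have "\<dots> = (\<Sum>i<n. cnj (e i 0) * ip m (e 0) (\<lambda>x. V x $$ (0, i)))"
    using n Vd irr es by (subst ip_sum_right)
      (auto simp: ip_scale_right intro!: square_integrable_scale square_integrable_coefficient)
  also have "\<dots> = 0" using perpD(2)[OF perp irr] n Vd by (intro sum.neutral) auto
  finally show False using on n by (simp add: orthonormal_def)
qed

text \<open>The kernel section at \<open>x\<close> has coefficients \<open>\<mu>\<close> times the
  values of the eigenfunctions at \<open>x\<close>, up to conjugation. Bessel's inequality bounds
  the sum of their squares for each \<open>x\<close>, and integrating over \<open>x\<close> bounds
  the multiplicity.\<close>

lemma eigenspace_orthonormal_bound:
  assumes \<phi>: "continuous_on UNIV \<phi>" and B: "\<And>x. \<bar>\<phi> x\<bar> \<le> B" and \<mu>: "\<mu> \<noteq> 0"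
    and on: "orthonormal m {..<n} e" and ec: "\<And>i. i < n \<Longrightarrow> continuous_on UNIV (e i)"
    and eig: "\<And>i. i < n \<Longrightarrow> conv m \<phi> (e i) = (\<lambda>x. complex_of_real \<mu> * e i x)"
  shows "real n * \<mu>\<^sup>2 \<le> B\<^sup>2"
proof -
  have es: "square_integrable m (e i)" if "i < n" for i using ec[OF that] by (rule square_integrable_continuous)
  have B0: "0 \<le> B" using B[of 0] by linarith
  have pw: "(\<Sum>i<n. \<mu>\<^sup>2 * (cmod (e i x))\<^sup>2) \<le> B\<^sup>2" for x
  proof -
    let ?k = "\<lambda>y. complex_of_real (\<phi> (- y + x))"
    note ks = square_integrable_kernel_section[OF \<phi>, of x]
    have "\<mu>\<^sup>2 * (cmod (e i x))\<^sup>2 = (cmod (ip m ?k (e i)))\<^sup>2" if "i < n" for i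
    proof -
      have "ip m (e i) ?k = complex_of_real \<mu> * e i x"
        using fun_cong[OF eig[OF that], of x] by (simp add: conv_eq_ip)
      then have "cmod (ip m ?k (e i)) = cmod (complex_of_real \<mu> * e i x)"
        by (metis complex_mod_cnj ip_cnj)
      then show ?thesis by (simp add: norm_mult power_mult_distrib)
    qed
    then have "(\<Sum>i<n. \<mu>\<^sup>2 * (cmod (e i x))\<^sup>2) = (\<Sum>i<n. (cmod (ip m ?k (e i)))\<^sup>2)" by simp
    also have "\<dots> \<le> (L2_norm m ?k)\<^sup>2" by (rule Bessel_finite[OF on _ ks]) simp
    also have "\<dots> \<le> B\<^sup>2"
      using B B0 ks by (intro power_mono L2_norm_le_sup) (auto simp: square_integrable_def)
    finally show ?thesis .
  qed
  have "real n * \<mu>\<^sup>2 = (\<Sum>i<n. \<mu>\<^sup>2 * (L2_norm m (e i))\<^sup>2)"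
  proof -
    have "(L2_norm m (e i))\<^sup>2 = 1" if "i < n" for i
      using on that ip_self[of m "e i"] unfolding orthonormal_def
      by (metis lessThan_iff of_real_eq_1_iff)
    then show ?thesis by simp
  qed
  also have "\<dots> = (LINT x|m. (\<Sum>i<n. \<mu>\<^sup>2 * (cmod (e i x))\<^sup>2))"
    unfolding L2_norm_power2 using es
    by (subst Bochner_Integration.integral_sum) (auto simp: square_integrable_def)
  also have "\<dots> \<le> (LINT x|m. B\<^sup>2)"
    using es pw by (intro integral_mono) (auto simp: square_integrable_def)
  also have "\<dots> = B\<^sup>2" by simp
  finally show ?thesis .
qed

theorem perp_imp_zero:
  assumes r: "perp r"
  shows "L2_norm m r = 0"
proof (rule ccontr)
  assume nz: "L2_norm m r \<noteq> 0"
  \<comment> \<open>The bump moves \<open>r\<close> by at most half its norm, so the convolution of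
    \<open>r\<close> cannot vanish.\<close>
  define \<epsilon> where "\<epsilon> = L2_norm m r / 2"
  have \<epsilon>: "\<epsilon> > 0" using nz L2_norm_nonneg[of m r] by (simp add: \<epsilon>_def less_le)
  obtain V where V: "open V" "0 \<in> V" "\<And>y. y \<in> V \<Longrightarrow> L2_norm m (\<lambda>x. r (x + y) - r x) < \<epsilon>"
    using translation_continuous[OF perpD(1)[OF r] \<epsilon>] by blast
  obtain \<phi> :: "'g \<Rightarrow> real" where \<phi>: "continuous_on UNIV \<phi>" "\<And>x. 0 \<le> \<phi> x" "\<And>x. \<phi> (- x) = \<phi> x"
    "\<And>x. x \<notin> V \<Longrightarrow> \<phi> x = 0" "(LINT x|m. \<phi> x) = 1"
    using bump[OF V(1,2)] by blast
  have "L2_norm m (\<lambda>x. conv m \<phi> r x - r x) \<le> \<epsilon>"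
    using conv_approx[OF \<phi> perpD(1)[OF r] less_imp_le[OF \<epsilon>]] V(3) by (simp add: less_imp_le)
  moreover have "L2_norm m r \<le> L2_norm m (\<lambda>x. r x - conv m \<phi> r x) + L2_norm m (conv m \<phi> r)"
    using L2_norm_triangle[OF square_integrable_diff[OF perpD(1)[OF r] square_integrable_conv[OF \<phi>(1) perpD(1)[OF r]]]
        square_integrable_conv[OF \<phi>(1) perpD(1)[OF r]]] by simp
  ultimately have "L2_norm m (conv m \<phi> r) \<noteq> 0"
    using \<epsilon> by (simp add: L2_norm_minus_commute[of m r] \<epsilon>_def)
  then obtain u \<mu> where u: "perp u" "continuous_on UNIV u" "L2_norm m u \<noteq> 0" and \<mu>: "\<mu> \<noteq> 0"
    and ueig: "conv m \<phi> u = (\<lambda>x. complex_of_real \<mu> * u x)"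
    using perp_eigenfunction[OF \<phi>(1,3) r] by blast
  define E where "E = {f. continuous_on UNIV f \<and> perp f \<and> conv m \<phi> f = (\<lambda>x. complex_of_real \<mu> * f x)}"
  have E: "invariant_space E"
    unfolding invariant_space_def function_space_def
  proof (intro conjI ballI allI)
    show "continuous_on UNIV f" if "f \<in> E" for f using that by (simp add: E_def)
    show "(\<lambda>x. 0) \<in> E" using perp_scale[OF r, of 0] by (simp add: E_def conv_def[abs_def])
    fix f assume f: "f \<in> E"
    show "(\<lambda>x. c * f x) \<in> E" for c
      using f by (auto simp: E_def conv_scale mult.left_commute intro: perp_scale continuous_intros)
    show "(\<lambda>x. f (a + x)) \<in> E" for a
    proof -
      have "continuous_on UNIV (\<lambda>x. f (a + x))"
        using f by (intro continuous_on_compose2[OF _ continuous_translate(1), of UNIV f]) (simp_all add: E_def)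
      moreover have "conv m \<phi> (\<lambda>x. f (a + x)) = (\<lambda>x. complex_of_real \<mu> * f (a + x))"
        using f conv_left_translate[OF \<phi>(1), of f a] perpD(1)[of f]
        by (intro ext) (simp add: E_def square_integrable_def)
      ultimately show ?thesis using f by (simp add: E_def perp_left_translate)
    qed
    fix g assume g: "g \<in> E"
    show "(\<lambda>x. f x + g x) \<in> E"
      using f g by (auto simp: E_def conv_add[OF \<phi>(1)] perpD(1) distrib_left intro: perp_add continuous_intros)
  qed
  obtain B where B: "B > 0" "\<And>x. norm (\<phi> x) \<le> B" using continuous_bounded[OF \<phi>(1)] by blast
  have bnd: "k \<le> nat \<lceil>B\<^sup>2 / \<mu>\<^sup>2\<rceil>" if "orthonormal_in Y k e" "Y \<subseteq> E" for Y k e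
  proof -
    have "real k * \<mu>\<^sup>2 \<le> B\<^sup>2"
      using that B \<mu> by (intro eigenspace_orthonormal_bound[OF \<phi>(1), of B \<mu> k e]) (auto simp: orthonormal_in_def E_def)
    then have "real k \<le> B\<^sup>2 / \<mu>\<^sup>2" using \<mu> by (simp add: field_simps)
    then show ?thesis by linarith
  qed
  \<comment> \<open>The bound on orthonormal families makes these dimensions finite, so a least
    positive one exists and a minimal nonzero invariant subspace can be chosen.\<close>
  define P where "P n \<longleftrightarrow> n > 0 \<and> (\<exists>Y e. invariant_space Y \<and> Y \<subseteq> E \<and> max_orthonormal_in Y n e)" for n
  obtain n0 e0 where ne: "max_orthonormal_in E n0 e0"
    using max_orthonormal_exists[of E "nat \<lceil>B\<^sup>2 / \<mu>\<^sup>2\<rceil>"] bnd[OF _ order_refl] by blast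
  \<comment> \<open>A maximal family of size 0 would force every function of \<open>E\<close> to
    vanish, in particular \<open>u\<close>.\<close>
  have "n0 > 0"
  proof (rule ccontr)
    assume "\<not> n0 > 0"
    then have "u x = 0" for x
      using max_orthonormal_spans[OF _ ne, of u x] E u ueig by (simp add: invariant_space_def E_def)
    then have "u = (\<lambda>x. 0)" by blast
    then show False using u(3) by (simp add: L2_norm_def)
  qed
  then have "P n0" unfolding P_def using ne E by blast
  define n where "n = (LEAST n. P n)"
  have "P n" unfolding n_def using \<open>P n0\<close> by (rule LeastI)
  then obtain X e where X: "n > 0" "invariant_space X" "X \<subseteq> E" "max_orthonormal_in X n e"
    unfolding P_def by blast
  have "\<not> perp (e 0)"
  proof (rule minimal_invariant_space_not_perp[OF X(2,4,1)])
    fix Y k e' assume "invariant_space Y" "Y \<subseteq> X" "max_orthonormal_in Y k e'" "k > 0"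
    then have "P k" using X(3) unfolding P_def by blast
    then show "n \<le> k" unfolding n_def by (rule Least_le)
  qed
  moreover have "e 0 \<in> E" using X by (auto simp: max_orthonormal_in_def orthonormal_in_def)
  ultimately show False by (simp add: E_def)
qed

text \<open>One representative of each class is enough: the coefficients of
  \<open>T * U x * mat_adjoint T\<close> are linear combinations of those of
  \<open>U\<close>.\<close>

theorem dual_coefficient_complete:
  assumes r: "square_integrable m r"
    and perp: "\<And>p. p \<in> dual_index unitary_dual \<Longrightarrow> ip m r (dual_coefficient p) = 0"
  shows "L2_norm m r = 0"
proof (rule perp_imp_zero)
  show "perp r"
    unfolding perp_def
  proof (intro conjI allI impI r)
    fix V :: "'g \<Rightarrow> complex mat" and i j
    assume V: "irreducible_unitary_rep V" "i < rep_dim V" "j < rep_dim V"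
    obtain \<pi> where \<pi>: "\<pi> \<in> unitary_dual" "(class_rep \<pi>, V) \<in> unitary_equiv"
      using unitary_dual_representative[OF V(1)] by blast
    define U where "U = class_rep \<pi>"
    have U: "irreducible_unitary_rep U" unfolding U_def by (rule class_rep_unitary_dual(1)[OF \<pi>(1)])
    define n where "n = rep_dim U"
    obtain T where d: "rep_dim V = n" and T: "unitary_mat n T" and eq: "\<And>x. V x = T * U x * mat_adjoint T"
      using \<pi>(2) by (auto simp: unitary_equiv_def U_def n_def)
    note t = unitary_matD[OF T]
    have Uc: "U x \<in> carrier_mat n n" for x
      using unitary_repD(1)[OF irreducible_unitary_repD(1)[OF U]] by (simp add: n_def)
    have n0: "n > 0" using irreducible_unitary_repD(2)[OF U] by (simp add: n_def)
    have ipU: "ip m r (\<lambda>x. U x $$ (k, l)) = 0" if "k < n" "l < n" for k l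
    proof -
      have "(\<pi>, k, l) \<in> dual_index unitary_dual"
        using that \<pi>(1) by (simp add: dual_index_def dual_dim_def n_def U_def)
      from perp[OF this] show ?thesis
        using n0 by (simp add: dual_coefficient_def ip_scale_right dual_dim_def n_def U_def)
    qed
    have sqU: "square_integrable m (\<lambda>x. U x $$ (k, l))" if "k < n" "l < n" for k l
      using that by (intro square_integrable_coefficient U) (auto simp: n_def)
    have "V x $$ (i, j) = (\<Sum>l<n. \<Sum>k<n. (T $$ (i, k) * mat_adjoint T $$ (l, j)) * U x $$ (k, l))" for x
    proof -
      have TU: "T * U x \<in> carrier_mat n n" using t(1) Uc[of x] by simp
      have "V x $$ (i, j) = (\<Sum>l<n. (T * U x) $$ (i, l) * mat_adjoint T $$ (l, j))"
        unfolding eq using V d by (intro index_mult_mat_sum[OF TU t(2)]) auto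
      also have "\<dots> = (\<Sum>l<n. (\<Sum>k<n. T $$ (i, k) * U x $$ (k, l)) * mat_adjoint T $$ (l, j))"
        using V d by (intro sum.cong refl) (simp add: index_mult_mat_sum[OF t(1) Uc] del: index_mult_mat)
      finally show ?thesis by (simp add: sum_distrib_left mult_ac)
    qed
    then have "ip m r (\<lambda>x. V x $$ (i, j)) = ip m r (\<lambda>x. \<Sum>l<n. \<Sum>k<n. (T $$ (i, k) * mat_adjoint T $$ (l, j)) * U x $$ (k, l))"
      by metis
    also have "\<dots> = (\<Sum>l<n. \<Sum>k<n. cnj (T $$ (i, k) * mat_adjoint T $$ (l, j)) * ip m r (\<lambda>x. U x $$ (k, l)))"
    proof -
      have "ip m r (\<lambda>x. \<Sum>l<n. \<Sum>k<n. (T $$ (i, k) * mat_adjoint T $$ (l, j)) * U x $$ (k, l))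
          = (\<Sum>l<n. ip m r (\<lambda>x. \<Sum>k<n. (T $$ (i, k) * mat_adjoint T $$ (l, j)) * U x $$ (k, l)))"
        by (rule ip_sum_right) (auto intro!: square_integrable_sum square_integrable_scale sqU r)
      also have "\<dots> = (\<Sum>l<n. \<Sum>k<n. ip m r (\<lambda>x. (T $$ (i, k) * mat_adjoint T $$ (l, j)) * U x $$ (k, l)))"
        by (intro sum.cong refl ip_sum_right) (auto intro!: square_integrable_scale sqU r)
      finally show ?thesis by (simp only: ip_scale_right)
    qed
    also have "\<dots> = 0" by (simp add: ipU)
    finally show "ip m r (\<lambda>x. V x $$ (i, j)) = 0" .
  qed
qed

end

section \<open>Compactness, decay and equicontinuity\<close>

context compact_group
begin

text \<open>The dimension times the squared Hilbert-Schmidt norm of the Fourier transform at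
  \<open>\<pi>\<close>, as \<open>fourier_block_energy\<close> shows, written in the orthonormal
  system so that Parseval's identity applies.\<close>

definition block_energy :: "('g \<Rightarrow> complex) \<Rightarrow> ('g \<Rightarrow> complex mat) set \<Rightarrow> real" where
  "block_energy f \<pi> = (\<Sum>q\<in>{..<dual_dim \<pi>} \<times> {..<dual_dim \<pi>}. (cmod (ip m f (dual_coefficient (\<pi>, q))))\<^sup>2)"

definition dual_projection :: "('g \<Rightarrow> complex mat) set set \<Rightarrow> ('g \<Rightarrow> complex) \<Rightarrow> 'g \<Rightarrow> complex" where
  "dual_projection A f x = (\<Sum>p\<in>dual_index A. ip m f (dual_coefficient p) * dual_coefficient p x)"

lemma orthonormal_dual_index:
  "A \<subseteq> unitary_dual \<Longrightarrow> orthonormal m (dual_index A) (dual_coefficient :: _ \<Rightarrow> 'g \<Rightarrow> complex)"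
  by (rule orthonormal_subset[OF orthonormal_dual_coefficient]) (auto simp: dual_index_def)

lemma square_integrable_dual_coefficient:
  "A \<subseteq> unitary_dual \<Longrightarrow> p \<in> dual_index A \<Longrightarrow> square_integrable m (dual_coefficient p)"
  using orthonormal_dual_index[of A] by (simp add: orthonormal_def)

lemma sum_block_energy:
  assumes "finite A"
  shows "(\<Sum>p\<in>dual_index A. (cmod (ip m f (dual_coefficient p)))\<^sup>2) = (\<Sum>\<pi>\<in>A. block_energy f \<pi>)"
  unfolding block_energy_def dual_index_def using assms
  by (subst sum.Sigma) (auto simp: split_beta)

text \<open>Plancherel's identity: Parseval's sum grouped by representation.\<close>

lemma block_energy_has_sum:
  assumes f: "square_integrable m f"
  shows "(block_energy f has_sum (L2_norm m f)\<^sup>2) unitary_dual"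
proof -
  have "((\<lambda>p. (cmod (ip m f (dual_coefficient p)))\<^sup>2) has_sum (L2_norm m f)\<^sup>2) (dual_index unitary_dual)"
    by (rule orthonormal_Parseval[OF orthonormal_dual_coefficient f dual_coefficient_complete])
  then show ?thesis unfolding dual_index_def
  proof (rule has_sum_SigmaD)
    fix \<pi> :: "('g \<Rightarrow> complex mat) set"
    show "((\<lambda>q. (cmod (ip m f (dual_coefficient (\<pi>, q))))\<^sup>2) has_sum block_energy f \<pi>)
        ({..<dual_dim \<pi>} \<times> {..<dual_dim \<pi>})"
      unfolding block_energy_def by (intro has_sum_finite) auto
  qed
qed

lemma square_integrable_dual_projection:
  assumes A: "A \<subseteq> unitary_dual"
  shows "square_integrable m (dual_projection A f)"
  unfolding dual_projection_def[abs_def]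
  by (intro square_integrable_sum square_integrable_scale square_integrable_dual_coefficient[OF A])

lemma dual_projection_remainder:
  assumes A: "finite A" "A \<subseteq> unitary_dual" and f: "square_integrable m f"
  shows "(L2_norm m (\<lambda>x. f x - dual_projection A f x))\<^sup>2 = (L2_norm m f)\<^sup>2 - (\<Sum>\<pi>\<in>A. block_energy f \<pi>)"
  unfolding dual_projection_def sum_block_energy[OF A(1), symmetric]
  by (rule orthonormal_norm_projection[OF orthonormal_dual_index[OF A(2)] finite_dual_index[OF A(1)] f])

lemma block_energy_nonneg: "0 \<le> block_energy f \<pi>"
  unfolding block_energy_def by (intro sum_nonneg) auto

lemma dual_projection_remainder_le:
  assumes A: "finite A" "A \<subseteq> unitary_dual" and f: "square_integrable m f"
  shows "L2_norm m (\<lambda>x. f x - dual_projection A f x) \<le> L2_norm m f"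
proof (rule power2_le_imp_le)
  have "0 \<le> (\<Sum>\<pi>\<in>A. block_energy f \<pi>)" by (intro sum_nonneg block_energy_nonneg)
  then show "(L2_norm m (\<lambda>x. f x - dual_projection A f x))\<^sup>2 \<le> (L2_norm m f)\<^sup>2"
    using dual_projection_remainder[OF A f] by simp
qed simp

text \<open>A larger set of representations subtracts more energy; this allows finitely many sets to
  be replaced by their union.\<close>

lemma dual_projection_remainder_antimono:
  assumes A: "A \<subseteq> B" and B: "finite B" "B \<subseteq> unitary_dual" and f: "square_integrable m f"
  shows "L2_norm m (\<lambda>x. f x - dual_projection B f x) \<le> L2_norm m (\<lambda>x. f x - dual_projection A f x)"
proof (rule power2_le_imp_le)
  have "(\<Sum>\<pi>\<in>A. block_energy f \<pi>) \<le> (\<Sum>\<pi>\<in>B. block_energy f \<pi>)"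
    using A B by (intro sum_mono2 block_energy_nonneg)
  moreover have "finite A" "A \<subseteq> unitary_dual" using A B finite_subset by auto
  ultimately show "(L2_norm m (\<lambda>x. f x - dual_projection B f x))\<^sup>2 \<le> (L2_norm m (\<lambda>x. f x - dual_projection A f x))\<^sup>2"
    using dual_projection_remainder[OF B f] dual_projection_remainder[OF _ _ f, of A] by simp
qed simp

lemma dual_projection_approx:
  assumes f: "square_integrable m f" and e: "e > 0"
  obtains A where "finite A" "A \<subseteq> unitary_dual" "L2_norm m (\<lambda>x. f x - dual_projection A f x) < e"
proof -
  have "\<forall>\<^sub>F A in finite_subsets_at_top unitary_dual. (L2_norm m f)\<^sup>2 - e\<^sup>2 < (\<Sum>\<pi>\<in>A. block_energy f \<pi>)"
    using block_energy_has_sum[OF f] e unfolding has_sum_def by (intro order_tendstoD(1)) auto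
  then obtain A where A: "finite A" "A \<subseteq> unitary_dual" "(L2_norm m f)\<^sup>2 - e\<^sup>2 < (\<Sum>\<pi>\<in>A. block_energy f \<pi>)"
    by (auto simp: eventually_finite_subsets_at_top)
  have "(L2_norm m (\<lambda>x. f x - dual_projection A f x))\<^sup>2 < e\<^sup>2"
    using dual_projection_remainder[OF A(1,2) f] A(3) by simp
  then have "L2_norm m (\<lambda>x. f x - dual_projection A f x) < e"
    by (rule power_less_imp_less_base) (use e in simp)
  then show ?thesis using that A by blast
qed

lemma dual_projection_diff:
  assumes A: "A \<subseteq> unitary_dual" and "square_integrable m f" "square_integrable m g"
  shows "dual_projection A (\<lambda>x. f x - g x) x = dual_projection A f x - dual_projection A g x"
  unfolding dual_projection_def using assms square_integrable_dual_coefficient[OF A]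
  by (simp add: ip_diff_left left_diff_distrib sum_subtractf)

lemma hs_norm_power2:
  assumes T: "T \<in> carrier_mat d d"
  shows "(hs_norm T)\<^sup>2 = (\<Sum>i<d. \<Sum>k<d. (cmod (T $$ (k, i)))\<^sup>2)"
proof -
  note Ts = mat_adjoint_carrier[OF T]
  have "(\<Sum>i<d. (mat_adjoint T * T) $$ (i, i)) = (\<Sum>i<d. \<Sum>k<d. mat_adjoint T $$ (i, k) * T $$ (k, i))"
    by (intro sum.cong refl index_mult_mat_sum[OF Ts T]) auto
  also have "\<dots> = (\<Sum>i<d. \<Sum>k<d. complex_of_real ((cmod (T $$ (k, i)))\<^sup>2))"
    using T by (intro sum.cong refl) (simp add: index_mat_adjoint cnj_mult_self del: of_real_power)
  also have "\<dots> = complex_of_real (\<Sum>i<d. \<Sum>k<d. (cmod (T $$ (k, i)))\<^sup>2)" by (simp only: of_real_sum)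
  finally have "(\<Sum>i<dim_col T. (mat_adjoint T * T) $$ (i, i)) = complex_of_real (\<Sum>i<d. \<Sum>k<d. (cmod (T $$ (k, i)))\<^sup>2)"
    using T by simp
  then show ?thesis by (simp add: hs_norm_def sum_nonneg del: of_real_sum)
qed

lemma fourier_block_energy:
  assumes \<pi>: "(\<pi> :: ('g \<Rightarrow> complex mat) set) \<in> unitary_dual"
  shows "real (dual_dim \<pi>) * (hs_norm (fourier_transform m F \<pi>))\<^sup>2 = block_energy (class_rep F) \<pi>"
proof -
  define U where "U = class_rep \<pi>"
  define d where "d = dual_dim \<pi>"
  define f where "f = class_rep F"
  have U: "irreducible_unitary_rep U" "rep_dim U = d"
    using class_rep_unitary_dual(1)[OF \<pi>] by (auto simp: U_def d_def dual_dim_def)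
  note Uc = unitary_repD(1)[OF irreducible_unitary_repD(1)[OF U(1)], unfolded U(2)]
  have T: "fourier_transform m F \<pi> \<in> carrier_mat d d" using \<pi> by (simp add: fourier_transform_def d_def)
  \<comment> \<open>The adjoint conjugates, which turns an entry into an inner product with a
    coefficient; it also swaps the indices, to which the Hilbert-Schmidt norm is
    insensitive.\<close>
  have ent: "fourier_transform m F \<pi> $$ (k, i) = ip m f (\<lambda>x. U x $$ (i, k))" if "k < d" "i < d" for k i
  proof -
    have "mat_adjoint (U x) $$ (k, i) = cnj (U x $$ (i, k))" for x
      using that Uc[of x] by (simp add: index_mat_adjoint)
    then show ?thesis
      using \<pi> that by (simp add: fourier_transform_def f_def ip_def U_def[symmetric] d_def[symmetric])
  qed
  have "real d * (hs_norm (fourier_transform m F \<pi>))\<^sup>2 = (\<Sum>i<d. \<Sum>k<d. real d * (cmod (ip m f (\<lambda>x. U x $$ (i, k))))\<^sup>2)"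
    unfolding hs_norm_power2[OF T] sum_distrib_left by (intro sum.cong refl) (simp add: ent)
  also have "\<dots> = (\<Sum>i<d. \<Sum>k<d. (cmod (ip m f (dual_coefficient (\<pi>, i, k))))\<^sup>2)"
    by (intro sum.cong refl)
       (simp add: dual_coefficient_def ip_scale_right norm_mult power_mult_distrib U_def[symmetric] d_def[symmetric])
  also have "\<dots> = block_energy f \<pi>"
    unfolding block_energy_def d_def[symmetric] by (simp add: sum.cartesian_product split_beta)
  finally show ?thesis by (simp add: d_def f_def)
qed

text \<open>Removing a finite set from Plancherel's sum leaves the squared norm minus the energy in
  that set, which by Pythagoras is the squared projection error.\<close>

lemma l2_sum_norm_fourier:
  assumes F: "F \<in> L2 m" and A: "finite A" "A \<subseteq> unitary_dual"
  shows "l2_sum_norm (unitary_dual - A) (fourier_transform m F)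
       = L2_norm m (\<lambda>x. class_rep F x - dual_projection A (class_rep F) x)"
proof -
  define f where "f = class_rep F"
  have f: "square_integrable m f" unfolding f_def by (rule class_rep_L2(2)[OF F])
  have "(block_energy f has_sum ((L2_norm m f)\<^sup>2 - (\<Sum>\<pi>\<in>A. block_energy f \<pi>))) (unitary_dual - A)"
    by (intro has_sum_Diff block_energy_has_sum[OF f] has_sum_finite A)
  then have "(\<Sum>\<^sub>\<infinity>\<pi>\<in>unitary_dual - A. block_energy f \<pi>) = (L2_norm m (\<lambda>x. f x - dual_projection A f x))\<^sup>2"
    using dual_projection_remainder[OF A f] by (simp add: infsumI)
  moreover have "(\<Sum>\<^sub>\<infinity>\<pi>\<in>unitary_dual - A. real (dual_dim \<pi>) * (hs_norm (fourier_transform m F \<pi>))\<^sup>2)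
      = (\<Sum>\<^sub>\<infinity>\<pi>\<in>unitary_dual - A. block_energy f \<pi>)"
    unfolding f_def by (intro infsum_cong fourier_block_energy) auto
  ultimately show ?thesis by (simp add: l2_sum_norm_def f_def)
qed

lemma fourier_transform_mem:
  assumes F: "F \<in> L2 m"
  shows "fourier_transform m F \<in> l2_sum_space unitary_dual"
proof -
  have "(block_energy (class_rep F)) summable_on unitary_dual"
    using block_energy_has_sum[OF class_rep_L2(2)[OF F]] by (rule has_sum_imp_summable)
  then have "(\<lambda>\<pi>. real (dual_dim \<pi>) * (hs_norm (fourier_transform m F \<pi>))\<^sup>2) summable_on unitary_dual"
    by (subst summable_on_cong[OF fourier_block_energy])
  then show ?thesis by (simp add: l2_sum_space_def fourier_transform_def)
qed

section \<open>The conditions restated for functions, and the implications between them\<close>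

lemma uniform_l2_decay_iff:
  assumes K: "K \<subseteq> L2 m"
  shows "uniform_l2_decay (fourier_transform m ` K) \<longleftrightarrow>
    (\<forall>\<epsilon>>0. \<exists>A. finite A \<and> A \<subseteq> unitary_dual \<and>
       (\<forall>f\<in>class_rep ` K. L2_norm m (\<lambda>x. f x - dual_projection A f x) < \<epsilon>))"
proof -
  have "fourier_transform m ` K \<subseteq> l2_sum_space unitary_dual" using K fourier_transform_mem by blast
  moreover have "(\<forall>\<phi>\<in>fourier_transform m ` K. l2_sum_norm (unitary_dual - A) \<phi> < \<epsilon>) \<longleftrightarrow>
      (\<forall>f\<in>class_rep ` K. L2_norm m (\<lambda>x. f x - dual_projection A f x) < \<epsilon>)"
    if "finite A" "A \<subseteq> unitary_dual" for A \<epsilon>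
  proof -
    have "l2_sum_norm (unitary_dual - A) (fourier_transform m F)
        = L2_norm m (\<lambda>x. class_rep F x - dual_projection A (class_rep F) x)" if "F \<in> K" for F
      using that K l2_sum_norm_fourier[OF _ \<open>finite A\<close> \<open>A \<subseteq> unitary_dual\<close>] by blast
    then show ?thesis by simp
  qed
  ultimately show ?thesis unfolding uniform_l2_decay_def by (simp cong: conj_cong)
qed

lemma uniformly_L2_equicontinuous_iff:
  assumes K: "K \<subseteq> L2 m"
  shows "uniformly_L2_equicontinuous m K \<longleftrightarrow>
    (\<forall>\<epsilon>>0. \<exists>V. open V \<and> 0 \<in> V \<and> (\<forall>f\<in>class_rep ` K. \<forall>y\<in>V. L2_norm m (\<lambda>x. f (x + y) - f x) < \<epsilon>))"
proof -
  have "L2_dist m (L2_translate m y F) F = L2_norm m (\<lambda>x. class_rep F (x + y) - class_rep F x)" if "F \<in> K" for F y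
  proof -
    have F: "F \<in> L2 m" using that K by blast
    interpret Metric_space "L2 m" "L2_dist m" by (rule Metric_space_L2)
    have "L2_dist m (L2_translate m y F) F = L2_dist m F (L2_translate m y F)" by (rule commute)
    also have "\<dots> = L2_norm m (\<lambda>x. class_rep F x - class_rep F (x + y))"
      unfolding L2_translate_def by (intro L2_dist_class_right F square_integrable_translate class_rep_L2(2)[OF F])
    finally show ?thesis by (simp add: L2_norm_minus_commute[of m "class_rep F"])
  qed
  then show ?thesis unfolding uniformly_L2_equicontinuous_def by simp
qed

text \<open>Forming the remainder is linear and does not increase norms, so decay passes from a
  finite net to the whole set, with the finite sets of the net merged.\<close>

lemma totally_bounded_imp_decay:
  assumes R: "\<And>f. f \<in> R \<Longrightarrow> square_integrable m f" and tb: "L2_totally_bounded m R" and e: "\<epsilon> > 0"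
  shows "\<exists>A. finite A \<and> A \<subseteq> unitary_dual \<and> (\<forall>f\<in>R. L2_norm m (\<lambda>x. f x - dual_projection A f x) < \<epsilon>)"
proof -
  have e2: "\<epsilon> / 2 > 0" using e by simp
  obtain S where S: "finite S" "S \<subseteq> R" "\<And>f. f \<in> R \<Longrightarrow> \<exists>g\<in>S. L2_norm m (\<lambda>x. f x - g x) < \<epsilon> / 2"
    using tb[unfolded L2_totally_bounded_def, rule_format, OF e2] by auto
  have "\<exists>A. finite A \<and> A \<subseteq> unitary_dual \<and> L2_norm m (\<lambda>x. g x - dual_projection A g x) < \<epsilon> / 2" if "g \<in> S" for g
  proof -
    have gs: "square_integrable m g" using that S R by blast
    show ?thesis by (rule dual_projection_approx[OF gs e2]) blast
  qed
  then obtain A where A: "\<And>g. g \<in> S \<Longrightarrow> finite (A g)" "\<And>g. g \<in> S \<Longrightarrow> A g \<subseteq> unitary_dual"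
    "\<And>g. g \<in> S \<Longrightarrow> L2_norm m (\<lambda>x. g x - dual_projection (A g) g x) < \<epsilon> / 2" by metis
  define B where "B = (\<Union>g\<in>S. A g)"
  have B: "finite B" "B \<subseteq> unitary_dual" using A S by (auto simp: B_def)
  have "L2_norm m (\<lambda>x. f x - dual_projection B f x) < \<epsilon>" if f: "f \<in> R" for f
  proof -
    obtain g where g: "g \<in> S" "L2_norm m (\<lambda>x. f x - g x) < \<epsilon> / 2" using S(3)[OF f] by blast
    have fs: "square_integrable m f" and gs: "square_integrable m g" using f g S R by auto
    note d = square_integrable_diff[OF fs gs]
    have "L2_norm m (\<lambda>x. f x - dual_projection B f x)
        = L2_norm m (\<lambda>x. (f x - g x - dual_projection B (\<lambda>x. f x - g x) x) + (g x - dual_projection B g x))"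
      by (simp add: dual_projection_diff[OF B(2) fs gs])
    also have "\<dots> \<le> L2_norm m (\<lambda>x. f x - g x - dual_projection B (\<lambda>x. f x - g x) x)
        + L2_norm m (\<lambda>x. g x - dual_projection B g x)"
      by (rule L2_norm_triangle[OF square_integrable_diff[OF d square_integrable_dual_projection[OF B(2)]]
            square_integrable_diff[OF gs square_integrable_dual_projection[OF B(2)]]])
    also have "L2_norm m (\<lambda>x. f x - g x - dual_projection B (\<lambda>x. f x - g x) x) < \<epsilon> / 2"
      using dual_projection_remainder_le[OF B d] g(2) by linarith
    also have "L2_norm m (\<lambda>x. g x - dual_projection B g x) < \<epsilon> / 2"
      using dual_projection_remainder_antimono[OF _ B gs, of "A g"] A(3)[OF g(1)] g(1) by (force simp: B_def)
    finally show ?thesis by simp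
  qed
  then show ?thesis using B by blast
qed

text \<open>Up to a small error everything lies in the span of finitely many coefficients, where the
  coordinates are bounded and admit a finite net.\<close>

lemma decay_imp_totally_bounded:
  assumes R: "\<And>f. f \<in> R \<Longrightarrow> square_integrable m f" and C: "\<And>f. f \<in> R \<Longrightarrow> L2_norm m f \<le> C"
    and decay: "\<And>\<epsilon>. \<epsilon> > 0 \<Longrightarrow> \<exists>A. finite A \<and> A \<subseteq> unitary_dual \<and>
      (\<forall>f\<in>R. L2_norm m (\<lambda>x. f x - dual_projection A f x) < \<epsilon>)"
  shows "L2_totally_bounded m R"
  unfolding L2_totally_bounded_def
proof (intro allI impI)
  fix \<epsilon> :: real assume e: "\<epsilon> > 0"
  then have e3: "\<epsilon> / 3 > 0" by simp
  obtain A where "finite A \<and> A \<subseteq> unitary_dual \<and>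
      (\<forall>f\<in>R. L2_norm m (\<lambda>x. f x - dual_projection A f x) < \<epsilon> / 3)"
    using decay[OF e3] by (rule exE)
  then have A: "finite A" "A \<subseteq> unitary_dual"
    "\<And>f. f \<in> R \<Longrightarrow> L2_norm m (\<lambda>x. f x - dual_projection A f x) < \<epsilon> / 3"
    by simp_all
  define I where "I = dual_index A"
  define c where "c f p = ip m f (dual_coefficient p)" for f p
  have I: "finite I" unfolding I_def by (rule finite_dual_index[OF A(1)])
  have on: "orthonormal m I (dual_coefficient :: _ \<Rightarrow> 'g \<Rightarrow> complex)"
    unfolding I_def by (rule orthonormal_dual_index[OF A(2)])
  \<comment> \<open>If \<open>card I\<close> coordinates are off by less than
    \<open>\<delta>\<close> each, the projections differ by at most \<open>\<epsilon> / 3\<close>.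
    The added 1 keeps the denominator positive when \<open>I\<close> is empty.\<close>
  define \<delta> where "\<delta> = \<epsilon> / 3 / sqrt (real (card I) + 1)"
  have \<delta>: "\<delta> > 0" using e by (simp add: \<delta>_def)
  have bd: "cmod (c f p) \<le> C" if "f \<in> R" "p \<in> I" for f p
  proof -
    have "(cmod (c f p))\<^sup>2 \<le> (\<Sum>p\<in>I. (cmod (c f p))\<^sup>2)" using that I by (intro member_le_sum) auto
    also have "\<dots> \<le> (L2_norm m f)\<^sup>2" unfolding c_def by (rule Bessel_finite[OF on I R[OF that(1)]])
    finally have "cmod (c f p) \<le> L2_norm m f" by (rule power2_le_imp_le) simp
    then show ?thesis using C[OF that(1)] by simp
  qed
  obtain S where S: "finite S" "S \<subseteq> R" "\<And>f. f \<in> R \<Longrightarrow> \<exists>g\<in>S. \<forall>p\<in>I. cmod (c f p - c g p) < \<delta>"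
    by (rule finite_net_of_functionals[of I R c C \<delta>, OF I bd \<delta>]) (assumption+, rule that)
  have "\<exists>g\<in>S. L2_norm m (\<lambda>x. f x - g x) < \<epsilon>" if f: "f \<in> R" for f
  proof -
    obtain g where g: "g \<in> S" "\<And>p. p \<in> I \<Longrightarrow> cmod (c f p - c g p) < \<delta>" using S(3)[OF f] by blast
    have gR: "g \<in> R" using g S by blast
    note fs = R[OF f] and gs = R[OF gR] and P = square_integrable_dual_projection[OF A(2)]
    have "(L2_norm m (\<lambda>x. dual_projection A f x - dual_projection A g x))\<^sup>2
        = (L2_norm m (\<lambda>x. \<Sum>p\<in>I. (c f p - c g p) * dual_coefficient p x))\<^sup>2"
      by (simp add: dual_projection_def c_def I_def left_diff_distrib sum_subtractf)
    also have "\<dots> = (\<Sum>p\<in>I. (cmod (c f p - c g p))\<^sup>2)" by (rule orthonormal_norm_sum[OF on I])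
    also have "\<dots> \<le> (\<Sum>p\<in>I. \<delta>\<^sup>2)" using g(2) by (intro sum_mono power_mono) (auto intro: less_imp_le)
    also have "\<dots> = real (card I) * \<delta>\<^sup>2" by simp
    also have "\<dots> \<le> (real (card I) + 1) * \<delta>\<^sup>2" by (intro mult_right_mono) auto
    also have "\<dots> = (\<epsilon> / 3)\<^sup>2"
    proof -
      have "(real n + 1) * (t / sqrt (real n + 1))\<^sup>2 = t\<^sup>2" for n t
        by (simp add: power_divide)
      then show ?thesis unfolding \<delta>_def .
    qed
    finally have "L2_norm m (\<lambda>x. dual_projection A f x - dual_projection A g x) \<le> \<epsilon> / 3"
      by (rule power2_le_imp_le) (use e in simp)
    moreover have "L2_norm m (\<lambda>x. f x - g x) \<le> L2_norm m (\<lambda>x. f x - dual_projection A f x) + L2_norm m (\<lambda>x. dual_projection A f x - g x)"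
      by (rule L2_norm_diff_triangle[OF fs P gs])
    moreover have "L2_norm m (\<lambda>x. dual_projection A f x - g x)
        \<le> L2_norm m (\<lambda>x. dual_projection A f x - dual_projection A g x) + L2_norm m (\<lambda>x. dual_projection A g x - g x)"
      by (rule L2_norm_diff_triangle[OF P P gs])
    ultimately have "L2_norm m (\<lambda>x. f x - g x) < \<epsilon>"
      using A(3)[OF f] A(3)[OF gR] L2_norm_minus_commute[of m g "dual_projection A g"] by linarith
    then show ?thesis using g(1) by blast
  qed
  then show "\<exists>S. finite S \<and> S \<subseteq> R \<and> (\<forall>f\<in>R. \<exists>g\<in>S. L2_norm m (\<lambda>x. f x - g x) < \<epsilon>)"
    using S by blast
qed

text \<open>The neighbourhoods for a finite net are intersected; right translation is an isometry
  and leaves the approximation error unchanged.\<close>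

lemma totally_bounded_imp_equicontinuous:
  assumes R: "\<And>f. f \<in> R \<Longrightarrow> square_integrable m f" and tb: "L2_totally_bounded m R" and e: "\<epsilon> > 0"
  shows "\<exists>V. open V \<and> 0 \<in> V \<and> (\<forall>f\<in>R. \<forall>y\<in>V. L2_norm m (\<lambda>x. f (x + y) - f x) < \<epsilon>)"
proof -
  have e3: "\<epsilon> / 3 > 0" using e by simp
  obtain S where S: "finite S" "S \<subseteq> R" "\<And>f. f \<in> R \<Longrightarrow> \<exists>g\<in>S. L2_norm m (\<lambda>x. f x - g x) < \<epsilon> / 3"
    using tb[unfolded L2_totally_bounded_def, rule_format, OF e3] by auto
  have "\<exists>V. open V \<and> 0 \<in> V \<and> (\<forall>y\<in>V. L2_norm m (\<lambda>x. g (x + y) - g x) < \<epsilon> / 3)" if "g \<in> S" for g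
  proof -
    have gs: "square_integrable m g" using that S R by blast
    show ?thesis by (rule translation_continuous[OF gs e3]) blast
  qed
  then obtain V where V: "\<And>g. g \<in> S \<Longrightarrow> open (V g)" "\<And>g. g \<in> S \<Longrightarrow> 0 \<in> V g"
    "\<And>g y. g \<in> S \<Longrightarrow> y \<in> V g \<Longrightarrow> L2_norm m (\<lambda>x. g (x + y) - g x) < \<epsilon> / 3" by metis
  have "L2_norm m (\<lambda>x. f (x + y) - f x) < \<epsilon>" if f: "f \<in> R" and y: "y \<in> (\<Inter>g\<in>S. V g)" for f y
  proof -
    obtain g where g: "g \<in> S" "L2_norm m (\<lambda>x. f x - g x) < \<epsilon> / 3" using S(3)[OF f] by blast
    have fs: "square_integrable m f" and gs: "square_integrable m g" using f g S R by auto
    have "L2_norm m (\<lambda>x. f (x + y) - f x) \<le> L2_norm m (\<lambda>x. f (x + y) - g (x + y)) + L2_norm m (\<lambda>x. g (x + y) - f x)"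
      by (intro L2_norm_diff_triangle square_integrable_translate fs gs)
    moreover have "L2_norm m (\<lambda>x. f (x + y) - g (x + y)) = L2_norm m (\<lambda>x. f x - g x)"
      using square_integrable_diff[OF fs gs]
      by (intro L2_norm_translate[of "\<lambda>x. f x - g x"]) (simp add: square_integrable_def)
    moreover have "L2_norm m (\<lambda>x. g (x + y) - f x) \<le> L2_norm m (\<lambda>x. g (x + y) - g x) + L2_norm m (\<lambda>x. g x - f x)"
      by (intro L2_norm_diff_triangle square_integrable_translate fs gs)
    moreover have "L2_norm m (\<lambda>x. g (x + y) - g x) < \<epsilon> / 3" using V(3)[OF g(1)] y g(1) by blast
    ultimately show ?thesis using g(2) L2_norm_minus_commute[of m g f] by linarith
  qed
  then show ?thesis using V S by (intro exI[of _ "\<Inter>g\<in>S. V g"]) (auto intro: open_INT)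
qed

text \<open>The bump vanishes outside the neighbourhood supplied by equicontinuity, so convolution
  moves every member of \<open>R\<close> by little. The convolved set has a finite net in the
  supremum norm, hence in norm.\<close>

lemma equicontinuous_imp_totally_bounded:
  assumes R: "\<And>f. f \<in> R \<Longrightarrow> square_integrable m f" and C: "\<And>f. f \<in> R \<Longrightarrow> L2_norm m f \<le> C"
    and equi: "\<And>\<epsilon>. \<epsilon> > 0 \<Longrightarrow> \<exists>V. open V \<and> 0 \<in> V \<and> (\<forall>f\<in>R. \<forall>y\<in>V. L2_norm m (\<lambda>x. f (x + y) - f x) < \<epsilon>)"
  shows "L2_totally_bounded m R"
  unfolding L2_totally_bounded_def
proof (intro allI impI)
  fix \<epsilon> :: real assume e: "\<epsilon> > 0"
  \<comment> \<open>Three errors of at most \<open>\<epsilon> / 4\<close> leave the final inequality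
    strict.\<close>
  then have e4: "\<epsilon> / 4 > 0" by simp
  obtain V where "open V \<and> 0 \<in> V \<and> (\<forall>f\<in>R. \<forall>y\<in>V. L2_norm m (\<lambda>x. f (x + y) - f x) < \<epsilon> / 4)"
    using equi[OF e4] by (rule exE)
  then have V: "open V" "0 \<in> V" "\<And>f y. f \<in> R \<Longrightarrow> y \<in> V \<Longrightarrow> L2_norm m (\<lambda>x. f (x + y) - f x) < \<epsilon> / 4"
    by simp_all
  obtain \<phi> :: "'g \<Rightarrow> real" where \<phi>: "continuous_on UNIV \<phi>" "\<And>x. 0 \<le> \<phi> x" "\<And>x. \<phi> (- x) = \<phi> x"
    "\<And>x. x \<notin> V \<Longrightarrow> \<phi> x = 0" "(LINT x|m. \<phi> x) = 1"
    using bump[OF V(1,2)] by blast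
  have near: "L2_norm m (\<lambda>x. conv m \<phi> f x - f x) \<le> \<epsilon> / 4" if "f \<in> R" for f
    using V(3)[OF that] by (intro conv_approx[OF \<phi> R[OF that] less_imp_le[OF e4]] less_imp_le)
  obtain S where S: "finite S" "S \<subseteq> R" "\<And>f. f \<in> R \<Longrightarrow> \<exists>g\<in>S. \<forall>x. cmod (conv m \<phi> f x - conv m \<phi> g x) < \<epsilon> / 4"
    by (rule conv_totally_bounded[of \<phi> R C "\<epsilon> / 4", OF \<phi>(1) R C e4]) (assumption+, rule that)
  have "\<exists>g\<in>S. L2_norm m (\<lambda>x. f x - g x) < \<epsilon>" if f: "f \<in> R" for f
  proof -
    obtain g where g: "g \<in> S" "\<And>x. cmod (conv m \<phi> f x - conv m \<phi> g x) < \<epsilon> / 4" using S(3)[OF f] by blast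
    have gR: "g \<in> R" using g S by blast
    note fs = R[OF f] and gs = R[OF gR]
    note cf = square_integrable_conv[OF \<phi>(1) fs] and cg = square_integrable_conv[OF \<phi>(1) gs]
    have "L2_norm m (\<lambda>x. conv m \<phi> f x - conv m \<phi> g x) \<le> \<epsilon> / 4"
      using square_integrable_diff[OF cf cg] g(2) e4
      by (intro L2_norm_le_sup) (auto simp: square_integrable_def intro: less_imp_le)
    moreover have "L2_norm m (\<lambda>x. f x - g x) \<le> L2_norm m (\<lambda>x. f x - conv m \<phi> f x) + L2_norm m (\<lambda>x. conv m \<phi> f x - g x)"
      by (rule L2_norm_diff_triangle[OF fs cf gs])
    moreover have "L2_norm m (\<lambda>x. conv m \<phi> f x - g x) \<le> L2_norm m (\<lambda>x. conv m \<phi> f x - conv m \<phi> g x) + L2_norm m (\<lambda>x. conv m \<phi> g x - g x)"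
      by (rule L2_norm_diff_triangle[OF cf cg gs])
    ultimately have "L2_norm m (\<lambda>x. f x - g x) < \<epsilon>"
      using near[OF f] near[OF gR] L2_norm_minus_commute[of m f "conv m \<phi> f"] e by linarith
    then show ?thesis using g(1) by blast
  qed
  then show "\<exists>S. finite S \<and> S \<subseteq> R \<and> (\<forall>f\<in>R. \<exists>g\<in>S. L2_norm m (\<lambda>x. f x - g x) < \<epsilon>)"
    using S by blast
qed

end

theorem theorem3p6:
  fixes m :: "'g::{topological_group_add,t2_space} measure"
    and K :: "('g \<Rightarrow> complex) set set"
  assumes "compact (UNIV :: 'g set)"
    and "normalized_haar_measure m"
    and "K \<subseteq> L2 m"
    and "L2_bounded m K"
  shows "(L2_precompact m K \<longleftrightarrow> uniform_l2_decay (fourier_transform m ` K)) \<and>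
         (uniform_l2_decay (fourier_transform m ` K) \<longleftrightarrow> uniformly_L2_equicontinuous m K)"
proof -
  interpret compact_group m using assms(1,2) by unfold_locales
  define R where "R = class_rep ` K"
  have R: "square_integrable m f" if "f \<in> R" for f
    using that assms(3) class_rep_L2(2) by (auto simp: R_def)
  obtain C where C: "\<And>f. f \<in> R \<Longrightarrow> L2_norm m f \<le> C"
  proof -
    obtain B where "\<And>F. F \<in> K \<Longrightarrow> L2_norm m (class_rep F) \<le> B"
      by (rule L2_bounded_imp_norm_bound[OF assms(3,4)]) (rule that)
    then show ?thesis by (intro that[of B]) (auto simp: R_def)
  qed
  let ?decay = "\<forall>\<epsilon>>0. \<exists>A. finite A \<and> A \<subseteq> unitary_dual \<and>
      (\<forall>f\<in>R. L2_norm m (\<lambda>x. f x - dual_projection A f x) < \<epsilon>)"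
  let ?equi = "\<forall>\<epsilon>>0. \<exists>V. open V \<and> 0 \<in> V \<and> (\<forall>f\<in>R. \<forall>y\<in>V. L2_norm m (\<lambda>x. f (x + y) - f x) < \<epsilon>)"
  have "L2_totally_bounded m R \<longleftrightarrow> ?decay"
  proof
    show ?decay if "L2_totally_bounded m R"
      by (intro allI impI totally_bounded_imp_decay[OF R that])
    show "L2_totally_bounded m R" if d: ?decay
      by (rule decay_imp_totally_bounded[OF R C d[rule_format]])
  qed
  moreover have "L2_totally_bounded m R \<longleftrightarrow> ?equi"
  proof
    show ?equi if "L2_totally_bounded m R"
      by (intro allI impI totally_bounded_imp_equicontinuous[OF R that])
    show "L2_totally_bounded m R" if d: ?equi
      by (rule equicontinuous_imp_totally_bounded[OF R C d[rule_format]])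
  qed
  ultimately show ?thesis
    unfolding L2_precompact_iff[OF assms(3)] uniform_l2_decay_iff[OF assms(3)]
      uniformly_L2_equicontinuous_iff[OF assms(3)] R_def[symmetric] by blast
qed

end
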